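(* Let $n\geq 3$ be odd. The cluster algebra $\mathcal{A}$ of the quiver $P_{n+1}^{(1)}$ is isomorphic, as a Poisson algebra, to the simple Poisson algebra $J/\Delta J$.
   Context: $\mathbb{K}$ is an algebraically closed field of characteristic $0$. The quiver $P_{n+1}^{(1)}$ has vertices $0,1,\dots,n$, arrows $i\rightarrow i+1$ for $0\leq i\leq n-1$ and an arrow $0\rightarrow n$. $\mathcal{A}$ is the (commutative, coefficient-free) cluster algebra over $\mathbb{K}$ of this quiver, i.e. the $\mathbb{K}$-subalgebra of $\mathbb{K}(w_0,\dots,w_n)$ generated by all cluster variables obtained by iterated mutation from the initial seed with cluster $(w_0,\dots,w_n)$. It is contained in the Laurent polynomial algebra $R=\mathbb{K}[w_0^{\pm1},\dots,w_n^{\pm1}]$, which has the Poisson bracket with, for $i\leq j$, $\{w_i,w_j\}=w_iw_j$ if $j-i$ is odd and $\{w_i,w_j\}=0$ if $j-i$ is even; $\mathcal{A}$ is a Poisson subalgebra of $R$ and is given the restricted bracket. $D=\mathbb{K}[W_0,W_1,\dots,W_{n+1}]$ is a polynomial algebra in $n+2$ variables and $E=\mathbb{K}[W_0^{\pm1},W_1^{\pm1},\dots,W_n^{\pm1},W_{n+1}]$. There is a Poisson bracket on $D$, and hence on $E$, such that, for $0\leq i<j\leq n+1$: $\{W_i,W_j\}=W_iW_j$ if $j-i$ is odd; $\{W_i,W_j\}=0$ if $j-i$ is even and $j-i<n+1$; $\{W_0,W_{n+1}\}=2W_1W_n$. $J$ is the subalgebra of $E$ generated by $W_0,W_1,X_1,\dots,X_n$,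 where $X_i=W_i^{-1}(W_{i-1}+W_{i+1})$ for $1\leq i\leq n$; it is a polynomial algebra in these $n+2$ elements, $D\subseteq J\subseteq E$, and $J$ is a Poisson subalgebra of $E$. $\Delta=W_0W_{n+1}-W_1W_n-1$, which is Poisson central in $J$. A Poisson algebra is (Poisson) simple if it is non-zero and its only Poisson ideals are $0$ and itself. *)

theory Defs
  imports
    "HOL-Library.Poly_Mapping"
    "HOL-Computational_Algebra.Fraction_Field"
    "HOL-Algebra.QuotRing"
    "HOL-Algebra.Module"
    "HOL-Algebra.Algebraic_Closure_Type"
begin

section \<open>Poisson algebras\<close>

record ('a, 'b) poisson = "('a, 'b) module" +
  bracket :: "'b \<Rightarrow> 'b \<Rightarrow> 'b"

locale poisson_algebra = algebra K P
  for K (structure) and P :: "('a, 'b, 'c) poisson_scheme" (structure) +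
  assumes bracket_closed:
      "\<lbrakk>x \<in> carrier P; y \<in> carrier P\<rbrakk> \<Longrightarrow> bracket P x y \<in> carrier P"
    and bracket_add_left:
      "\<lbrakk>x \<in> carrier P; y \<in> carrier P; z \<in> carrier P\<rbrakk> \<Longrightarrow>
        bracket P (x \<oplus>\<^bsub>P\<^esub> y) z = bracket P x z \<oplus>\<^bsub>P\<^esub> bracket P y z"
    and bracket_add_right:
      "\<lbrakk>x \<in> carrier P; y \<in> carrier P; z \<in> carrier P\<rbrakk> \<Longrightarrow>
        bracket P x (y \<oplus>\<^bsub>P\<^esub> z) = bracket P x y \<oplus>\<^bsub>P\<^esub> bracket P x z"
    and bracket_smult_left:
      "\<lbrakk>c \<in> carrier K; x \<in> carrier P; y \<in> carrier P\<rbrakk> \<Longrightarrow>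
        bracket P (c \<odot>\<^bsub>P\<^esub> x) y = c \<odot>\<^bsub>P\<^esub> bracket P x y"
    and bracket_smult_right:
      "\<lbrakk>c \<in> carrier K; x \<in> carrier P; y \<in> carrier P\<rbrakk> \<Longrightarrow>
        bracket P x (c \<odot>\<^bsub>P\<^esub> y) = c \<odot>\<^bsub>P\<^esub> bracket P x y"
    and bracket_self:
      "x \<in> carrier P \<Longrightarrow> bracket P x x = \<zero>\<^bsub>P\<^esub>"
    and bracket_jacobi:
      "\<lbrakk>x \<in> carrier P; y \<in> carrier P; z \<in> carrier P\<rbrakk> \<Longrightarrow>
        bracket P x (bracket P y z) \<oplus>\<^bsub>P\<^esub> bracket P y (bracket P z x)
          \<oplus>\<^bsub>P\<^esub> bracket P z (bracket P x y) = \<zero>\<^bsub>P\<^esub>"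
    and bracket_leibniz:
      "\<lbrakk>x \<in> carrier P; y \<in> carrier P; z \<in> carrier P\<rbrakk> \<Longrightarrow>
        bracket P x (y \<otimes>\<^bsub>P\<^esub> z) = bracket P x y \<otimes>\<^bsub>P\<^esub> z \<oplus>\<^bsub>P\<^esub> y \<otimes>\<^bsub>P\<^esub> bracket P x z"

definition poisson_ideal :: "'b set \<Rightarrow> ('a, 'b, 'c) poisson_scheme \<Rightarrow> bool" where
  "poisson_ideal I P \<longleftrightarrow>
     ideal I P \<and> (\<forall>x\<in>I. \<forall>y\<in>carrier P. bracket P x y \<in> I)"

definition poisson_simple :: "('a, 'b, 'c) poisson_scheme \<Rightarrow> bool" where
  "poisson_simple P \<longleftrightarrow> carrier P \<noteq> {\<zero>\<^bsub>P\<^esub>} \<and>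
     (\<forall>I. poisson_ideal I P \<longrightarrow> I = {\<zero>\<^bsub>P\<^esub>} \<or> I = carrier P)"

(* As for multiplication in P Quot I, the operations on cosets are unions over representatives.
   If I is a Poisson ideal, then c . (I + a) = I + ca and {I + a, I + b} = I + {a, b}. *)
definition poisson_quot ::
    "('a, 'b, 'c) poisson_scheme \<Rightarrow> 'b set \<Rightarrow> ('a, 'b set) poisson" where
  "poisson_quot P I =
     \<lparr>carrier = carrier (P Quot I), monoid.mult = (\<otimes>\<^bsub>P Quot I\<^esub>),
      one = \<one>\<^bsub>P Quot I\<^esub>, ring.zero = \<zero>\<^bsub>P Quot I\<^esub>, add = (\<oplus>\<^bsub>P Quot I\<^esub>),
      module.smult = (\<lambda>c A. \<Union>a\<in>A. I +>\<^bsub>P\<^esub> (c \<odot>\<^bsub>P\<^esub> a)),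
      bracket = (\<lambda>A B. \<Union>a\<in>A. \<Union>b\<in>B. I +>\<^bsub>P\<^esub> bracket P a b)\<rparr>"

definition poisson_isomorphic ::
    "('a, 'd) ring_scheme \<Rightarrow> ('a, 'b, 'e) poisson_scheme \<Rightarrow> ('a, 'c, 'f) poisson_scheme \<Rightarrow> bool"
  where
  "poisson_isomorphic K P Q \<longleftrightarrow> (\<exists>h. h \<in> ring_hom P Q \<and> bij_betw h (carrier P) (carrier Q) \<and>
     (\<forall>c\<in>carrier K. \<forall>x\<in>carrier P. h (c \<odot>\<^bsub>P\<^esub> x) = c \<odot>\<^bsub>Q\<^esub> h x) \<and>
     (\<forall>x\<in>carrier P. \<forall>y\<in>carrier P. h (bracket P x y) = bracket Q (h x) (h y)))"


section \<open>Rational functions, partial derivatives and brackets\<close>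

(* The field of rational functions over 'k in countably many variables. Every algebra below is a
   subalgebra of this field that involves only finitely many of the variables. *)
type_synonym 'k mpoly = "(nat \<Rightarrow>\<^sub>0 nat) \<Rightarrow>\<^sub>0 'k"
type_synonym 'k ratfun = "((nat \<Rightarrow>\<^sub>0 nat) \<Rightarrow>\<^sub>0 'k) fract"

definition rconst :: "'k::field \<Rightarrow> 'k ratfun" where
  "rconst c = Fract (Poly_Mapping.single 0 c) 1"

definition rvar :: "nat \<Rightarrow> 'k::field ratfun" where
  "rvar i = Fract (Poly_Mapping.single (Poly_Mapping.single i 1) 1) 1"

inductive_set gen_subalgebra :: "'k::field ratfun set \<Rightarrow> 'k ratfun set" for S where
  const: "rconst c \<in> gen_subalgebra S"
| gen: "f \<in> S \<Longrightarrow> f \<in> gen_subalgebra S"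
| add: "f \<in> gen_subalgebra S \<Longrightarrow> g \<in> gen_subalgebra S \<Longrightarrow> f + g \<in> gen_subalgebra S"
| mult: "f \<in> gen_subalgebra S \<Longrightarrow> g \<in> gen_subalgebra S \<Longrightarrow> f * g \<in> gen_subalgebra S"

definition mpoly_deriv :: "nat \<Rightarrow> 'k::field mpoly \<Rightarrow> 'k mpoly" where
  "mpoly_deriv i p = (\<Sum>m\<in>Poly_Mapping.keys p.
     Poly_Mapping.single (m - Poly_Mapping.single i 1)
       (of_nat (Poly_Mapping.lookup m i) * Poly_Mapping.lookup p m))"

lemma mpoly_deriv_single:
  "mpoly_deriv i (Poly_Mapping.single m c) =
     Poly_Mapping.single (m - Poly_Mapping.single i 1) (of_nat (Poly_Mapping.lookup m i) * c)"
  by (cases "c = 0") (simp_all add: mpoly_deriv_def)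

lemma mpoly_deriv_zero [simp]: "mpoly_deriv i 0 = 0"
  by (simp add: mpoly_deriv_def)

lemma mpoly_deriv_add: "mpoly_deriv i (p + q) = mpoly_deriv i p + mpoly_deriv i q"
  unfolding mpoly_deriv_def
  by (rule setsum_keys_plus_distrib) (simp_all add: single_add [symmetric] algebra_simps)

lemma mpoly_deriv_sum: "mpoly_deriv i (sum f A) = (\<Sum>a\<in>A. mpoly_deriv i (f a))"
  by (induction A rule: infinite_finite_induct) (simp_all add: mpoly_deriv_add)

lemma mpoly_sum_monomials:
  "p = (\<Sum>m\<in>Poly_Mapping.keys p. Poly_Mapping.single m (Poly_Mapping.lookup p m))"
  by (rule poly_mapping_eqI) (simp add: lookup_sum lookup_single when_def in_keys_iff sum.delta)

lemma mpoly_deriv_mult_single: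
  "mpoly_deriv i (Poly_Mapping.single a c * Poly_Mapping.single b d) =
     mpoly_deriv i (Poly_Mapping.single a c) * Poly_Mapping.single b d +
     Poly_Mapping.single a c * mpoly_deriv i (Poly_Mapping.single b d)"
proof -
  let ?e = "Poly_Mapping.single i (1::nat)"
  have shift: "(a - ?e) + b = (a + b) - ?e" if "Poly_Mapping.lookup a i \<noteq> 0" for a b :: "nat \<Rightarrow>\<^sub>0 nat"
    using that
    by (intro poly_mapping_eqI) (auto simp: lookup_add lookup_minus lookup_single when_def)
  have 1: "mpoly_deriv i (Poly_Mapping.single a c) * Poly_Mapping.single b d =
      Poly_Mapping.single (a + b - ?e) (of_nat (Poly_Mapping.lookup a i) * c * d)"
    using shift[of a b]
    by (cases "Poly_Mapping.lookup a i = 0") (auto simp: mpoly_deriv_single mult_single)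
  have 2: "Poly_Mapping.single a c * mpoly_deriv i (Poly_Mapping.single b d) =
      Poly_Mapping.single (a + b - ?e) (of_nat (Poly_Mapping.lookup b i) * c * d)"
    using shift[of b a]
    by (cases "Poly_Mapping.lookup b i = 0")
       (auto simp: mpoly_deriv_single mult_single add.commute mult_ac)
  show ?thesis
    unfolding 1 2
    by (simp add: mult_single mpoly_deriv_single lookup_add single_add [symmetric] algebra_simps)
qed

lemma mpoly_deriv_mult:
  "mpoly_deriv i (p * q) = mpoly_deriv i p * q + p * mpoly_deriv i q"
proof -
  define P where "P m = Poly_Mapping.single m (Poly_Mapping.lookup p m)" for m
  define Q where "Q m = Poly_Mapping.single m (Poly_Mapping.lookup q m)" for m
  have p: "p = sum P (Poly_Mapping.keys p)" and q: "q = sum Q (Poly_Mapping.keys q)"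
    unfolding P_def Q_def by (rule mpoly_sum_monomials)+
  have "mpoly_deriv i (sum P A * sum Q B) =
      mpoly_deriv i (sum P A) * sum Q B + sum P A * mpoly_deriv i (sum Q B)" for A B
    by (simp only: sum_product mpoly_deriv_sum sum.distrib [symmetric])
       (simp only: P_def Q_def mpoly_deriv_mult_single)
  from this[of "Poly_Mapping.keys p" "Poly_Mapping.keys q"] show ?thesis
    using p q by simp
qed

definition rat_deriv :: "nat \<Rightarrow> 'k::field ratfun \<Rightarrow> 'k ratfun" where
  "rat_deriv i f = (THE g. \<forall>a b. b \<noteq> 0 \<and> f = Fract a b \<longrightarrow>
     g = Fract (mpoly_deriv i a * b - a * mpoly_deriv i b) (b * b))"

lemma rat_deriv_Fract:
  assumes "b \<noteq> 0"
  shows "rat_deriv i (Fract a b) = Fract (mpoly_deriv i a * b - a * mpoly_deriv i b) (b * b)"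
proof -
  let ?D = "mpoly_deriv i"
  have wd: "Fract (?D a * b - a * ?D b) (b * b) = Fract (?D c * e - c * ?D e) (e * e)"
    if "e \<noteq> 0" "Fract a b = Fract c e" for c e
  proof -
    have eq: "a * e = c * b"
      using that assms by (simp add: eq_fract)
    have eq': "?D a * e + a * ?D e = ?D c * b + c * ?D b"
      using arg_cong[OF eq, of ?D] by (simp add: mpoly_deriv_mult)
    have "(?D a * b - a * ?D b) * (e * e) - (?D c * e - c * ?D e) * (b * b) =
        b * e * ((?D a * e + a * ?D e) - (?D c * b + c * ?D b))
        - (e * ?D b + b * ?D e) * (a * e - c * b)"
      by (simp add: algebra_simps)
    also have "\<dots> = 0" using eq eq' by simp
    finally show ?thesis using that assms by (simp add: eq_fract)
  qed
  show ?thesis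
    unfolding rat_deriv_def using assms wd by (intro the_equality) blast+
qed

lemma rat_deriv_mult: "rat_deriv i (f * g) = rat_deriv i f * g + f * rat_deriv i g"
  by (cases f; cases g)
     (simp add: rat_deriv_Fract eq_fract mpoly_deriv_mult algebra_simps)

lemma rat_deriv_add: "rat_deriv i (f + g) = rat_deriv i f + rat_deriv i g"
  by (cases f; cases g)
     (simp add: rat_deriv_Fract eq_fract mpoly_deriv_mult mpoly_deriv_add algebra_simps)

lemma mpoly_deriv_one [simp]: "mpoly_deriv i 1 = 0"
  using mpoly_deriv_single[of i 0 1] by simp

lemma rat_deriv_const: "rat_deriv i (rconst c) = 0"
  by (simp add: rconst_def rat_deriv_Fract mpoly_deriv_single Zero_fract_def)

lemma rat_deriv_var: "rat_deriv i (rvar j) = (if i = j then 1 else 0)"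
  by (simp add: rvar_def rat_deriv_Fract mpoly_deriv_single lookup_single Zero_fract_def
      One_fract_def)

(* The biderivation with {x_i, x_j} = u i j for i < j <= N, where x_i = rvar i. It is the unique
   extension of the bracket on polynomials in x_0, ..., x_N to their field of fractions, and hence
   restricts to the bracket on every algebra between these two. *)
definition gen_bracket ::
    "nat \<Rightarrow> (nat \<Rightarrow> nat \<Rightarrow> 'k::field ratfun) \<Rightarrow> 'k ratfun \<Rightarrow> 'k ratfun \<Rightarrow> 'k ratfun" where
  "gen_bracket N u f g = (\<Sum>j\<le>N. \<Sum>i<j.
     u i j * (rat_deriv i f * rat_deriv j g - rat_deriv j f * rat_deriv i g))"

lemma gen_bracket_rvar:
  assumes "i < j" "j \<le> N"
  shows "gen_bracket N u (rvar i) (rvar j) = u i j"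
proof -
  have "gen_bracket N u (rvar i) (rvar j) =
      (\<Sum>b\<le>N. \<Sum>a<b. if b = j \<and> a = i then u i j else 0)"
    unfolding gen_bracket_def using assms
    by (intro sum.cong refl) (auto simp: rat_deriv_var)
  also have "\<dots> = (\<Sum>b\<le>N. if b = j then (\<Sum>a<b. if a = i then u i j else 0) else 0)"
    by (intro sum.cong refl) auto
  also have "\<dots> = u i j"
    using assms by simp
  finally show ?thesis .
qed

definition ratfun_poisson ::
    "'k::field ratfun set \<Rightarrow> ('k ratfun \<Rightarrow> 'k ratfun \<Rightarrow> 'k ratfun) \<Rightarrow> ('k, 'k ratfun) poisson" where
  "ratfun_poisson S br =
     \<lparr>carrier = S, monoid.mult = (*), one = 1, ring.zero = 0, add = (+),
      module.smult = (\<lambda>c f. rconst c * f), bracket = br\<rparr>"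


section \<open>Cluster algebras of quivers\<close>

(* A quiver on the vertices 0, ..., n without loops and 2-cycles is given by
   q i j = number of arrows from i to j. *)
type_synonym quiver = "nat \<Rightarrow> nat \<Rightarrow> nat"

(* Add an arrow i -> j for each path i -> k -> j, reverse the arrows at k, and cancel 2-cycles;
   truncated subtraction performs the cancellation. *)
definition quiver_mutate :: "nat \<Rightarrow> quiver \<Rightarrow> quiver" where
  "quiver_mutate k q i j =
     (if i = k \<or> j = k then q j i
      else (q i j + q i k * q k j) - (q j i + q j k * q k i))"

definition cluster_mutate ::
    "nat \<Rightarrow> nat \<Rightarrow> quiver \<Rightarrow> (nat \<Rightarrow> 'k::field ratfun) \<Rightarrow> nat \<Rightarrow> 'k ratfun" where
  "cluster_mutate n k q x =
     x(k := ((\<Prod>i\<le>n. x i ^ q i k) + (\<Prod>j\<le>n. x j ^ q k j)) / x k)"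

inductive cluster_seed ::
    "nat \<Rightarrow> quiver \<Rightarrow> (nat \<Rightarrow> 'k::field ratfun) \<Rightarrow> quiver \<Rightarrow> bool" for n q\<^sub>0 where
  initial: "cluster_seed n q\<^sub>0 rvar q\<^sub>0"
| mutate: "cluster_seed n q\<^sub>0 x q \<Longrightarrow> k \<le> n \<Longrightarrow>
    cluster_seed n q\<^sub>0 (cluster_mutate n k q x) (quiver_mutate k q)"

definition cluster_algebra :: "nat \<Rightarrow> quiver \<Rightarrow> 'k::field ratfun set" where
  "cluster_algebra n q\<^sub>0 = gen_subalgebra {x i | x q i. cluster_seed n q\<^sub>0 x q \<and> i \<le> n}"


section \<open>The algebras \<open>\<A>\<close> and \<open>J\<close>\<close>

definition quiver_P1 :: "nat \<Rightarrow> quiver" where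
  "quiver_P1 n i j = of_bool (i < n \<and> j = i + 1) + of_bool (i = 0 \<and> j = n)"

definition w_bracket :: "nat \<Rightarrow> 'k::field ratfun \<Rightarrow> 'k ratfun \<Rightarrow> 'k ratfun" where
  "w_bracket n = gen_bracket n (\<lambda>i j. if odd (j - i) then rvar i * rvar j else 0)"

definition alg_A :: "nat \<Rightarrow> ('k::field, 'k ratfun) poisson" where
  "alg_A n = ratfun_poisson (cluster_algebra n (quiver_P1 n)) (w_bracket n)"

definition W_bracket :: "nat \<Rightarrow> 'k::field ratfun \<Rightarrow> 'k ratfun \<Rightarrow> 'k ratfun" where
  "W_bracket n = gen_bracket (n + 1)
     (\<lambda>i j. if odd (j - i) then rvar i * rvar j
            else if j - i < n + 1 then 0
            else 2 * rvar 1 * rvar n)"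

definition elt_X :: "nat \<Rightarrow> 'k::field ratfun" where
  "elt_X i = inverse (rvar i) * (rvar (i - 1) + rvar (i + 1))"

definition alg_J :: "nat \<Rightarrow> ('k::field, 'k ratfun) poisson" where
  "alg_J n = ratfun_poisson (gen_subalgebra ({rvar 0, rvar 1} \<union> elt_X ` {1..n})) (W_bracket n)"

definition elt_Delta :: "nat \<Rightarrow> 'k::field ratfun" where
  "elt_Delta n = rvar 0 * rvar (n + 1) - rvar 1 * rvar n - 1"

definition alg_J_mod_Delta :: "nat \<Rightarrow> ('k::field, 'k ratfun set) poisson" where
  "alg_J_mod_Delta n = poisson_quot (alg_J n) (PIdl\<^bsub>alg_J n\<^esub> (elt_Delta n))"

end

(*
  The seeds of the quiver are realized by triangulations of an annulus with n marked points on the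
  outer and one on the inner boundary, lifted to the universal cover. Each marked point carries a
  vector, the lambda length of an arc is the determinant of the vectors of its end points, and a
  mutation is a flip, by the Pluecker relation. The vectors are chosen with entries in the algebra B
  generated by w_0, w_1, X_1, ..., X_n, where w_(n+1) = (1 + w_1 w_n) / w_0, so that every cluster
  variable lies in B. It is not necessary to know that the triangulations are embedded: only the
  combinatorics of glued triangles is used.

  The substitution W_(n+1) -> w_(n+1) maps J onto B and respects the brackets. Its kernel is generated
  by Delta, because J is graded with W_0, W_1 in degree 1, X_i in degree 0, and Delta + 1 is
  homogeneous of degree 2.

  A non-zero Poisson ideal of B contains a monomial in the w_i, as the log-canonical bracket is
  non-degenerate for odd n. Brackets with the X_i turn a factor w_i into w_(i-1), which leads to a power
  of w_0, then to all monomials of some degree N in w_0 and w_1, and finally to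
  1 = (w_0 w_(n+1) - w_1 w_n)^N.
*)
theory Submission
  imports Defs "HOL-Library.Multiset"
begin

lemma rconst_0 [simp]: "rconst 0 = 0"
  by (simp add: rconst_def Zero_fract_def)

lemma rconst_1 [simp]: "rconst 1 = 1"
  by (simp add: rconst_def One_fract_def)

lemma rconst_add: "rconst (a + b) = rconst a + rconst b"
  by (simp add: rconst_def single_add)

lemma rconst_mult: "rconst (a * b) = rconst a * rconst b"
  by (simp add: rconst_def mult_single)

lemma rconst_uminus: "rconst (- a) = - rconst a"
  by (simp add: rconst_def single_uminus)

lemma rconst_of_nat: "rconst (of_nat k) = of_nat k"
  by (induction k) (simp_all add: rconst_add)

lemma rconst_numeral: "rconst (numeral k) = numeral k"
  using rconst_of_nat[of "numeral k"] by simp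

lemma rconst_of_int: "rconst (of_int k) = of_int k"
  by (cases k rule: int_cases2) (simp_all add: rconst_of_nat rconst_uminus)

lemma rconst_eq_0_iff [simp]: "rconst c = 0 \<longleftrightarrow> c = 0"
proof -
  have "Poly_Mapping.single (0::nat \<Rightarrow>\<^sub>0 nat) c = 0 \<longleftrightarrow> c = 0"
    by (metis lookup_single_eq lookup_zero single_zero)
  then show ?thesis
    by (simp add: rconst_def Zero_fract_def eq_fract)
qed

lemma rvar_nonzero [simp]: "rvar i \<noteq> 0"
proof -
  have "Poly_Mapping.single m (1::'k::field) \<noteq> 0" for m :: "nat \<Rightarrow>\<^sub>0 nat"
    by (metis lookup_single_eq lookup_zero zero_neq_one)
  then show ?thesis
    by (simp add: rvar_def Zero_fract_def eq_fract)
qed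

lemma ratfun_two_neq_0 [simp]: "(2 :: 'k::field_char_0 ratfun) \<noteq> 0"
  using rconst_eq_0_iff[of "2::'k"] unfolding rconst_numeral by simp

section \<open>Generated subalgebras\<close>

lemma gen_subalgebra_0 [simp]: "0 \<in> gen_subalgebra S"
  using gen_subalgebra.const[of 0 S] by simp

lemma gen_subalgebra_1 [simp]: "1 \<in> gen_subalgebra S"
  using gen_subalgebra.const[of 1 S] by simp

lemma gen_subalgebra_uminus: "f \<in> gen_subalgebra S \<Longrightarrow> - f \<in> gen_subalgebra S"
  using gen_subalgebra.mult[OF gen_subalgebra.const[of "-1"], of f S] by (simp add: rconst_uminus)

lemma gen_subalgebra_diff:
  "f \<in> gen_subalgebra S \<Longrightarrow> g \<in> gen_subalgebra S \<Longrightarrow> f - g \<in> gen_subalgebra S"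
  using gen_subalgebra.add[of f S "-g"] gen_subalgebra_uminus[of g] by simp

lemma gen_subalgebra_power: "f \<in> gen_subalgebra S \<Longrightarrow> f ^ k \<in> gen_subalgebra S"
  by (induction k) (auto intro: gen_subalgebra.mult)

lemma gen_subalgebra_numeral: "numeral k \<in> gen_subalgebra S"
  using gen_subalgebra.const[of "numeral k" S] by (simp add: rconst_numeral)

lemma gen_subalgebra_of_int: "of_int k \<in> gen_subalgebra S"
  using gen_subalgebra.const[of "of_int k" S] by (simp add: rconst_of_int)

lemmas gen_subalgebra_intros =
  gen_subalgebra.intros gen_subalgebra_0 gen_subalgebra_1 gen_subalgebra_uminus
  gen_subalgebra_diff gen_subalgebra_power gen_subalgebra_numeral gen_subalgebra_of_int

lemma gen_subalgebra_least:
  assumes "S \<subseteq> gen_subalgebra T"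
  shows "gen_subalgebra S \<subseteq> gen_subalgebra T"
proof
  fix f assume "f \<in> gen_subalgebra S"
  then show "f \<in> gen_subalgebra T"
    by induction (use assms in \<open>auto intro: gen_subalgebra.intros\<close>)
qed

inductive_set gen_subfield :: "'k::field ratfun set \<Rightarrow> 'k ratfun set" for S where
  const: "rconst c \<in> gen_subfield S"
| gen: "f \<in> S \<Longrightarrow> f \<in> gen_subfield S"
| add: "f \<in> gen_subfield S \<Longrightarrow> g \<in> gen_subfield S \<Longrightarrow> f + g \<in> gen_subfield S"
| mult: "f \<in> gen_subfield S \<Longrightarrow> g \<in> gen_subfield S \<Longrightarrow> f * g \<in> gen_subfield S"
| inverse: "f \<in> gen_subfield S \<Longrightarrow> inverse f \<in> gen_subfield S"

lemma gen_subalgebra_subset_subfield: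
  assumes "S \<subseteq> gen_subfield T"
  shows "gen_subalgebra S \<subseteq> gen_subfield T"
proof
  fix f assume "f \<in> gen_subalgebra S"
  then show "f \<in> gen_subfield T"
    by induction (use assms in \<open>auto intro: gen_subfield.intros\<close>)
qed

section \<open>Evaluation of rational functions\<close>

definition ev_mono :: "(nat \<Rightarrow> 'l::field) \<Rightarrow> (nat \<Rightarrow>\<^sub>0 nat) \<Rightarrow> 'l" where
  "ev_mono y m = (\<Prod>i\<in>Poly_Mapping.keys m. y i ^ Poly_Mapping.lookup m i)"

definition ev_poly :: "('k::field \<Rightarrow> 'l::field) \<Rightarrow> (nat \<Rightarrow> 'l) \<Rightarrow> 'k mpoly \<Rightarrow> 'l" where
  "ev_poly c y p = (\<Sum>m\<in>Poly_Mapping.keys p. c (Poly_Mapping.lookup p m) * ev_mono y m)"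

definition regular :: "('k::field \<Rightarrow> 'l::field) \<Rightarrow> (nat \<Rightarrow> 'l) \<Rightarrow> 'k ratfun \<Rightarrow> bool" where
  "regular c y f \<longleftrightarrow> (\<exists>a b. ev_poly c y b \<noteq> 0 \<and> f = Fract a b)"

definition ev :: "('k::field \<Rightarrow> 'l::field) \<Rightarrow> (nat \<Rightarrow> 'l) \<Rightarrow> 'k ratfun \<Rightarrow> 'l" where
  "ev c y f = (THE g. \<forall>a b. ev_poly c y b \<noteq> 0 \<and> f = Fract a b \<longrightarrow>
     g = ev_poly c y a / ev_poly c y b)"

lemma ev_mono_superset:
  assumes "finite A" "Poly_Mapping.keys m \<subseteq> A"
  shows "ev_mono y m = (\<Prod>i\<in>A. y i ^ Poly_Mapping.lookup m i)"
  unfolding ev_mono_def using assms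
  by (intro prod.mono_neutral_left) (auto simp: in_keys_iff)

lemma ev_mono_add: "ev_mono y (m + m') = ev_mono y m * ev_mono y m'"
proof -
  let ?A = "Poly_Mapping.keys m \<union> Poly_Mapping.keys m'"
  have "ev_mono y (m + m') = (\<Prod>i\<in>?A. y i ^ Poly_Mapping.lookup (m + m') i)"
    by (rule ev_mono_superset) (auto dest: keys_add[THEN subsetD])
  also have "\<dots> = ev_mono y m * ev_mono y m'"
    by (simp add: ev_mono_superset[of ?A] lookup_add power_add prod.distrib)
  finally show ?thesis .
qed

lemma ev_mono_0 [simp]: "ev_mono y 0 = 1"
  by (simp add: ev_mono_def)

lemma ev_mono_single [simp]: "ev_mono y (Poly_Mapping.single i k) = y i ^ k"
  by (simp add: ev_mono_def)

locale coeff_hom =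
  fixes c :: "'k::field \<Rightarrow> 'l::field"
  assumes c_add: "c (a + b) = c a + c b"
    and c_mult: "c (a * b) = c a * c b"
    and c_one [simp]: "c 1 = 1"
begin

lemma c_zero [simp]: "c 0 = 0"
  using c_add[of 0 0] by (metis add.right_neutral add_left_cancel)

lemma ev_poly_single: "ev_poly c y (Poly_Mapping.single m a) = c a * ev_mono y m"
  by (cases "a = 0") (simp_all add: ev_poly_def)

lemma ev_poly_0 [simp]: "ev_poly c y 0 = 0"
  by (simp add: ev_poly_def)

lemma ev_poly_1 [simp]: "ev_poly c y 1 = 1"
  using ev_poly_single[of y 0 1] by simp

lemma ev_poly_add: "ev_poly c y (p + q) = ev_poly c y p + ev_poly c y q"
  unfolding ev_poly_def
  by (rule setsum_keys_plus_distrib) (simp_all add: c_add algebra_simps)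

lemma ev_poly_sum: "ev_poly c y (sum f A) = (\<Sum>a\<in>A. ev_poly c y (f a))"
  by (induction A rule: infinite_finite_induct) (simp_all add: ev_poly_add)

lemma ev_poly_mult: "ev_poly c y (p * q) = ev_poly c y p * ev_poly c y q"
proof -
  let ?P = "\<lambda>m. Poly_Mapping.single m (Poly_Mapping.lookup p m)"
  let ?Q = "\<lambda>m. Poly_Mapping.single m (Poly_Mapping.lookup q m)"
  have "ev_poly c y (sum ?P A * sum ?Q B) = ev_poly c y (sum ?P A) * ev_poly c y (sum ?Q B)" for A B
    by (simp add: sum_product ev_poly_sum mult_single ev_poly_single c_mult ev_mono_add algebra_simps)
  from this[of "Poly_Mapping.keys p" "Poly_Mapping.keys q"] show ?thesis
    by (simp add: mpoly_sum_monomials [symmetric])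
qed

lemma ev_Fract:
  assumes "ev_poly c y b \<noteq> 0"
  shows "ev c y (Fract a b) = ev_poly c y a / ev_poly c y b"
proof -
  have wd: "ev_poly c y a / ev_poly c y b = ev_poly c y a' / ev_poly c y b'"
    if "ev_poly c y b' \<noteq> 0" "Fract a b = Fract a' b'" for a' b'
  proof -
    have "b \<noteq> 0" "b' \<noteq> 0" using assms that(1) by auto
    then have "a * b' = a' * b" using that(2) by (simp add: eq_fract)
    then have "ev_poly c y a * ev_poly c y b' = ev_poly c y a' * ev_poly c y b"
      by (simp add: ev_poly_mult [symmetric])
    then show ?thesis using assms that(1) by (simp add: frac_eq_eq)
  qed
  show ?thesis
    unfolding ev_def using assms wd by (intro the_equality) blast+
qed

lemma regularE:
  assumes "regular c y f"
  obtains a b where "ev_poly c y b \<noteq> 0" "b \<noteq> 0" "f = Fract a b"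
    "ev c y f = ev_poly c y a / ev_poly c y b"
proof -
  obtain a b where ab: "ev_poly c y b \<noteq> 0" "f = Fract a b"
    using assms by (auto simp: regular_def)
  then have "b \<noteq> 0" by auto
  with ab show ?thesis using that ev_Fract by blast
qed

lemma regular_Fract: "ev_poly c y b \<noteq> 0 \<Longrightarrow> regular c y (Fract a b)"
  by (auto simp: regular_def)

lemma ev_rconst [simp]: "ev c y (rconst a) = c a" "regular c y (rconst a)"
  by (simp_all add: rconst_def ev_Fract regular_Fract ev_poly_single)

lemma ev_rvar [simp]: "ev c y (rvar i) = y i" "regular c y (rvar i)"
  by (simp_all add: rvar_def ev_Fract regular_Fract ev_poly_single)

lemma ev_add:
  assumes "regular c y f" "regular c y g"
  shows "regular c y (f + g)" "ev c y (f + g) = ev c y f + ev c y g"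
  using assms
  by (auto elim!: regularE simp: regular_Fract ev_Fract ev_poly_mult ev_poly_add add_frac_eq)

lemma ev_mult:
  assumes "regular c y f" "regular c y g"
  shows "regular c y (f * g)" "ev c y (f * g) = ev c y f * ev c y g"
  using assms
  by (auto elim!: regularE simp: regular_Fract ev_Fract ev_poly_mult)

lemma ev_inverse:
  assumes "regular c y f" "ev c y f \<noteq> 0"
  shows "regular c y (inverse f)" "ev c y (inverse f) = inverse (ev c y f)"
  using assms
  by (auto elim!: regularE simp: regular_Fract ev_Fract)

lemma c_uminus: "c (- a) = - c a"
  using c_add[of a "- a"] by (simp add: eq_neg_iff_add_eq_0 add.commute)

lemma ev_diff:
  assumes "regular c y f" "regular c y g"
  shows "regular c y (f - g)" "ev c y (f - g) = ev c y f - ev c y g"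
proof -
  have r: "regular c y (rconst (- 1) * g)" and e: "ev c y (rconst (- 1) * g) = - ev c y g"
    using assms ev_mult[of y "rconst (- 1)" g] ev_rconst[of y "- 1"] c_uminus[of 1] by auto
  have eq: "f - g = f + rconst (- 1) * g" by (simp add: rconst_uminus)
  show "regular c y (f - g)" "ev c y (f - g) = ev c y f - ev c y g"
    unfolding eq using ev_add[OF assms(1) r] e by simp_all
qed

lemma ev_0_1: "ev c y 0 = 0" "regular c y 0" "ev c y 1 = 1" "regular c y 1"
  using ev_rconst[of y 0] ev_rconst[of y 1] by simp_all

lemma regular_gen_subalgebra:
  assumes "\<And>s. s \<in> S \<Longrightarrow> regular c y s" "f \<in> gen_subalgebra S"
  shows "regular c y f"
  using assms(2) by induction (use assms(1) in \<open>auto intro: ev_add ev_mult\<close>)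

lemma ev_in_gen_subalgebra:
  assumes "\<And>s. s \<in> S \<Longrightarrow> regular c y s" "\<And>s. s \<in> S \<Longrightarrow> ev c y s \<in> T"
    and "\<And>a. c a \<in> T" "\<And>a b. a \<in> T \<Longrightarrow> b \<in> T \<Longrightarrow> a + b \<in> T" "\<And>a b. a \<in> T \<Longrightarrow> b \<in> T \<Longrightarrow> a * b \<in> T"
    and "f \<in> gen_subalgebra S"
  shows "ev c y f \<in> T"
  using assms(6)
  by induction (use assms(1-5) in \<open>auto simp: ev_add ev_mult regular_gen_subalgebra[of S]\<close>)

end

section \<open>Biderivations\<close>

locale biderivation =
  fixes br :: "'k::field ratfun \<Rightarrow> 'k ratfun \<Rightarrow> 'k ratfun"
  assumes add_left: "br (f + g) h = br f h + br g h"
    and mult_left: "br (f * g) h = f * br g h + br f h * g"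
    and const_left [simp]: "br (rconst a) h = 0"
    and self [simp]: "br f f = 0"
    and skew: "br f g = - br g f"
begin

lemma add_right: "br h (f + g) = br h f + br h g"
  using add_left[of f g h] skew[of h] by simp

lemma mult_right: "br h (f * g) = f * br h g + br h f * g"
  using mult_left[of f g h] skew[of h] by simp

lemma const_right [simp]: "br h (rconst a) = 0"
  using const_left[of a h] skew[of h] by simp

lemma one_left [simp]: "br 1 h = 0" and one_right [simp]: "br h 1 = 0"
  using const_left[of 1 h] const_right[of h 1] by simp_all

lemma zero_left [simp]: "br 0 h = 0" and zero_right [simp]: "br h 0 = 0"
  using const_left[of 0 h] const_right[of h 0] by simp_all

lemma inverse_left: "br (inverse f) h = - br f h * inverse f * inverse f"
proof (cases "f = 0")
  case False
  have "f * br (inverse f) h + br f h * inverse f = 0"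
    using mult_left[of f "inverse f" h] False by simp
  then have "inverse f * (f * br (inverse f) h + br f h * inverse f) = 0"
    by (simp only: mult_zero_right)
  with False show ?thesis
    by (simp add: distrib_left mult.assoc [symmetric] eq_neg_iff_add_eq_0) (simp add: mult_ac)
qed simp

lemma inverse_right: "br h (inverse f) = - br h f * inverse f * inverse f"
  using inverse_left[of f h] skew[of h] by simp

lemma power_left: "br (f ^ k) h = of_nat k * f ^ (k - 1) * br f h"
proof (induction k)
  case (Suc k)
  then show ?case
    by (cases k) (simp_all add: mult_left algebra_simps)
qed simp

lemma closed:
  assumes S: "\<And>s t. s \<in> S \<Longrightarrow> t \<in> S \<Longrightarrow> br s t \<in> gen_subalgebra S"
    and f: "f \<in> gen_subalgebra S" and g: "g \<in> gen_subalgebra S"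
  shows "br f g \<in> gen_subalgebra S"
proof -
  have 1: "br s g \<in> gen_subalgebra S" if "s \<in> S" for s
    using g by induction
      (auto simp: add_right mult_right intro!: S that gen_subalgebra.add gen_subalgebra.mult
        intro: gen_subalgebra.gen)
  show ?thesis
    using f by induction
      (auto simp: add_left mult_left intro!: 1 g gen_subalgebra.add gen_subalgebra.mult
        intro: gen_subalgebra.gen)
qed

definition jacobiator where
  "jacobiator f g h = br f (br g h) + br g (br h f) + br h (br f g)"

lemma jacobiator_cyclic: "jacobiator f g h = jacobiator g h f"
  by (simp add: jacobiator_def)

lemma jacobiator_add: "jacobiator (f + f') g h = jacobiator f g h + jacobiator f' g h"
  by (simp add: jacobiator_def add_left add_right)

lemma jacobiator_mult: "jacobiator (f * f') g h = f * jacobiator f' g h + jacobiator f g h * f'"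
  unfolding jacobiator_def mult_left mult_right add_right
  by (simp add: skew[of g f] skew[of g f'] algebra_simps)

lemma jacobiator_vanishes_left:
  assumes "\<And>s. s \<in> S \<Longrightarrow> jacobiator s g h = 0" "f \<in> gen_subfield S"
  shows "jacobiator f g h = 0"
  using assms(2)
proof induction
  case (const c)
  then show ?case by (simp add: jacobiator_def)
next
  case (inverse f)
  show ?case
  proof (cases "f = 0")
    case False
    have "jacobiator (f * inverse f) g h = 0"
      using False by (simp add: jacobiator_def)
    then show ?thesis
      unfolding jacobiator_mult inverse.IH using False by simp
  qed (simp add: jacobiator_def)
qed (simp_all add: assms(1) jacobiator_add jacobiator_mult)

lemma jacobiator_vanishes:
  assumes "\<And>s t u. s \<in> S \<Longrightarrow> t \<in> S \<Longrightarrow> u \<in> S \<Longrightarrow> jacobiator s t u = 0"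
    and "f \<in> gen_subfield S" "g \<in> gen_subfield S" "h \<in> gen_subfield S"
  shows "jacobiator f g h = 0"
proof -
  have 1: "jacobiator s t h = 0" if "s \<in> S" "t \<in> S" for s t
    using jacobiator_vanishes_left[of S s t h] assms(1,4) that
    by (simp add: jacobiator_cyclic[of h])
  have 2: "jacobiator s g h = 0" if "s \<in> S" for s
    using jacobiator_vanishes_left[of S h s g] assms(3) 1 that
    by (simp add: jacobiator_cyclic[of g h s] jacobiator_cyclic[of h s] jacobiator_cyclic[of _ h s])
  show ?thesis
    by (rule jacobiator_vanishes_left[of S]) (use 2 assms in auto)
qed

end

lemma biderivation_gen_bracket: "biderivation (gen_bracket N u)"
proof
  show "gen_bracket N u (f + g) h = gen_bracket N u f h + gen_bracket N u g h" for f g h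
    by (simp add: gen_bracket_def rat_deriv_add algebra_simps sum.distrib [symmetric])
  show "gen_bracket N u (f * g) h = f * gen_bracket N u g h + gen_bracket N u f h * g" for f g h
    by (simp add: gen_bracket_def rat_deriv_mult sum_distrib_left sum_distrib_right
        sum.distrib [symmetric]) (intro sum.cong refl, simp add: algebra_simps)
  show "gen_bracket N u f g = - gen_bracket N u g f" for f g
    by (simp add: gen_bracket_def sum_negf [symmetric]) (intro sum.cong refl, simp add: algebra_simps)
qed (simp_all add: gen_bracket_def rat_deriv_const)

lemma ev_bracket:
  assumes "coeff_hom c" "biderivation br1" "biderivation br2"
    and c: "\<And>a. c a = rconst a"
    and reg: "\<And>s. s \<in> S \<Longrightarrow> regular c y s"
    and cl: "\<And>s t. s \<in> S \<Longrightarrow> t \<in> S \<Longrightarrow> br1 s t \<in> gen_subalgebra S"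
    and S: "\<And>s t. s \<in> S \<Longrightarrow> t \<in> S \<Longrightarrow> ev c y (br1 s t) = br2 (ev c y s) (ev c y t)"
    and f: "f \<in> gen_subalgebra S" and g: "g \<in> gen_subalgebra S"
  shows "ev c y (br1 f g) = br2 (ev c y f) (ev c y g)"
proof -
  interpret coeff_hom c by fact
  interpret b1: biderivation br1 by fact
  interpret b2: biderivation br2 by fact
  note r = regular_gen_subalgebra[of S y, OF reg]
  note cl' = b1.closed[of S, OF cl]
  have 1: "ev c y (br1 s g) = br2 (ev c y s) (ev c y g)" if "s \<in> S" for s
    using g
  proof induction
    case (const a)
    have "br2 z (c a) = 0" "br2 (c a) z = 0" for z
      unfolding c by simp_all
    then show ?case using ev_rconst[of y 0] by simp
  next
    case (gen t)
    then show ?case by (simp add: S that)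
  next
    case (add f g)
    moreover have "regular c y (br1 s f)" "regular c y (br1 s g)"
      using add that by (auto intro!: r cl' intro: gen_subalgebra.gen)
    ultimately show ?case by (simp add: b1.add_right b2.add_right ev_add r)
  next
    case (mult f g)
    moreover have "regular c y (br1 s f)" "regular c y (br1 s g)"
      using mult that by (auto intro!: r cl' intro: gen_subalgebra.gen)
    ultimately show ?case by (simp add: b1.mult_right b2.mult_right ev_add ev_mult r)
  qed
  show ?thesis
    using f
  proof induction
    case (const a)
    have "br2 z (c a) = 0" "br2 (c a) z = 0" for z
      unfolding c by simp_all
    then show ?case using ev_rconst[of y 0] by simp
  next
    case (gen t)
    then show ?case by (simp add: 1)
  next
    case (add f f')
    moreover have "regular c y (br1 f g)" "regular c y (br1 f' g)"
      using add g by (auto intro!: r cl')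
    ultimately show ?case by (simp add: b1.add_left b2.add_left ev_add r)
  next
    case (mult f f')
    moreover have "regular c y (br1 f g)" "regular c y (br1 f' g)"
      using mult g by (auto intro!: r cl')
    ultimately show ?case by (simp add: b1.mult_left b2.mult_left ev_add ev_mult r)
  qed
qed

section \<open>Triangulations of the annulus\<close>

text \<open>Marked points of the universal cover, a strip. The deck transformation moves the outer points by
  \<open>n\<close> and the inner points by one. Along the boundary of the strip, the inner points follow the outer
  ones in descending order.\<close>

datatype pt = Out nat | In nat

fun pt_less :: "pt \<Rightarrow> pt \<Rightarrow> bool" where
  "pt_less (Out i) (Out j) \<longleftrightarrow> i < j"
| "pt_less (Out i) (In m) \<longleftrightarrow> True"
| "pt_less (In m) (Out i) \<longleftrightarrow> False"
| "pt_less (In m) (In l) \<longleftrightarrow> l < m"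

definition cyc :: "pt \<Rightarrow> pt \<Rightarrow> pt \<Rightarrow> bool" where
  "cyc P Q R \<longleftrightarrow> pt_less P Q \<and> pt_less Q R \<or> pt_less Q R \<and> pt_less R P \<or> pt_less R P \<and> pt_less P Q"

fun shift :: "nat \<Rightarrow> nat \<Rightarrow> pt \<Rightarrow> pt" where
  "shift n g (Out i) = Out (i + g * n)"
| "shift n g (In m) = In (m + g)"

lemma shift_add: "shift n g (shift n h P) = shift n (g + h) P"
  by (cases P) (simp_all add: algebra_simps)

lemma shift_eq_iff [simp]: "shift n g P = shift n g Q \<longleftrightarrow> P = Q"
  by (cases P; cases Q) simp_all

lemma pt_less_shift [simp]: "pt_less (shift n g P) (shift n g Q) \<longleftrightarrow> pt_less P Q"
  by (cases P; cases Q) simp_all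

lemma cyc_shift [simp]: "cyc (shift n g P) (shift n g Q) (shift n g R) \<longleftrightarrow> cyc P Q R"
  by (simp add: cyc_def)

lemma cyc_distinct: "cyc P Q R \<Longrightarrow> P \<noteq> Q \<and> Q \<noteq> R \<and> R \<noteq> P"
  by (cases P; cases Q; cases R) (auto simp: cyc_def)

lemma cyc_rotate: "cyc P Q R \<longleftrightarrow> cyc Q R P"
  by (auto simp: cyc_def)

lemma cyc_quad:
  assumes "cyc P Q R" "cyc Q P S"
  shows "pt_less Q R \<and> pt_less R P \<and> pt_less P S \<or> pt_less R P \<and> pt_less P S \<and> pt_less S Q \<or>
    pt_less P S \<and> pt_less S Q \<and> pt_less Q R \<or> pt_less S Q \<and> pt_less Q R \<and> pt_less R P"
  using assms by (cases P; cases Q; cases R; cases S) (auto simp: cyc_def)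

lemma pt_less_trans: "pt_less P Q \<Longrightarrow> pt_less Q R \<Longrightarrow> pt_less P R"
  by (cases P; cases Q; cases R) auto

lemma pt_less_asym: "pt_less P Q \<Longrightarrow> \<not> pt_less Q P"
  by (cases P; cases Q) auto

lemma pt_less_linear: "pt_less P Q \<or> P = Q \<or> pt_less Q P"
  by (cases P; cases Q) auto

lemma cyc_flip:
  assumes "cyc P Q R" "cyc Q P S"
  shows "R \<noteq> S" "cyc R S Q" "cyc S R P"
  using cyc_quad[OF assms] by (auto simp: cyc_def dest: pt_less_trans pt_less_asym)

definition same_edge :: "nat \<Rightarrow> pt \<Rightarrow> pt \<Rightarrow> pt \<Rightarrow> pt \<Rightarrow> bool" where
  "same_edge n P Q P' Q' \<longleftrightarrow> (\<exists>g g'. shift n g P = shift n g' P' \<and> shift n g Q = shift n g' Q')"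

lemma same_edge_refl [simp]: "same_edge n P Q P Q"
  by (auto simp: same_edge_def)

lemma same_edge_sym: "same_edge n P Q P' Q' \<Longrightarrow> same_edge n P' Q' P Q"
  unfolding same_edge_def by metis

lemma same_edge_swap: "same_edge n P Q P' Q' \<longleftrightarrow> same_edge n Q P Q' P'"
  unfolding same_edge_def by metis

lemma same_edge_trans:
  assumes "same_edge n P Q P' Q'" "same_edge n P' Q' P'' Q''"
  shows "same_edge n P Q P'' Q''"
proof -
  obtain g g' h h' where
    "shift n g P = shift n g' P'" "shift n g Q = shift n g' Q'"
    "shift n h P' = shift n h' P''" "shift n h Q' = shift n h' Q''"
    using assms by (auto simp: same_edge_def)
  then have "shift n (h + g) P = shift n (g' + h') P''" "shift n (h + g) Q = shift n (g' + h') Q''"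
    by (metis shift_add add.commute)+
  then show ?thesis by (auto simp: same_edge_def)
qed

lemma same_edge_shift [simp]: "same_edge n (shift n g P) (shift n g Q) P' Q' \<longleftrightarrow> same_edge n P Q P' Q'"
proof -
  have "same_edge n (shift n g P) (shift n g Q) P Q"
    unfolding same_edge_def by (rule exI[of _ 0], rule exI[of _ g]) (simp add: shift_add)
  then show ?thesis by (meson same_edge_sym same_edge_trans)
qed

lemma same_edge_unique:
  assumes "n > 0" "same_edge n P Q s t" "same_edge n P Q' s t"
  shows "Q = Q'"
proof -
  obtain g g' h h' where
    *: "shift n g P = shift n g' s" "shift n g Q = shift n g' t"
    "shift n h P = shift n h' s" "shift n h Q' = shift n h' t"
    using assms by (auto simp: same_edge_def)
  have eq: "g + h' = h + g'"
  proof (cases P)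
    case (Out i)
    with * obtain j where "i + g * n = j + g' * n" "i + h * n = j + h' * n"
      by (cases s) auto
    then have "(g + h') * n = (h + g') * n"
      by (simp add: algebra_simps)
    then show ?thesis using assms(1) by simp
  next
    case (In i)
    with * show ?thesis by (cases s) auto
  qed
  have "shift n (h' + g) Q = shift n (h' + g') t" "shift n (g' + h) Q' = shift n (g' + h') t"
    using * by (metis shift_add)+
  moreover have "g' + h = h' + g" using eq by simp
  ultimately show ?thesis by (metis shift_eq_iff add.commute)
qed

lemma same_edge_unique':
  assumes "n > 0" "same_edge n P Q s t" "same_edge n P' Q s t"
  shows "P = P'"
  using same_edge_unique[of n Q P t s P'] assms by (simp add: same_edge_swap[of n Q])

text \<open>A side of a triangle is a segment of the boundary (\<open>None\<close>) or one of the two sides of the arc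
  with a given label.\<close>

type_synonym side = "(nat \<times> bool) option"
type_synonym triangle = "side \<times> side \<times> side \<times> pt \<times> pt \<times> pt"

definition has_label :: "side \<Rightarrow> nat \<Rightarrow> int" where
  "has_label h i = of_bool (\<exists>b. h = Some (i, b))"

fun sides :: "triangle \<Rightarrow> side multiset" where
  "sides (h1, h2, h3, _) = {#h1, h2, h3#}"

fun tri_arrows :: "nat \<Rightarrow> nat \<Rightarrow> triangle \<Rightarrow> int" where
  "tri_arrows i j (h1, h2, h3, _) =
     has_label h2 i * has_label h1 j + has_label h3 i * has_label h2 j + has_label h1 i * has_label h3 j"

definition all_sides :: "triangle multiset \<Rightarrow> side multiset" where
  "all_sides Ts = (\<Sum>T\<in>#Ts. sides T)"

definition arrows :: "triangle multiset \<Rightarrow> nat \<Rightarrow> nat \<Rightarrow> int" where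
  "arrows Ts i j = (\<Sum>T\<in>#Ts. tri_arrows i j T - tri_arrows j i T)"

lemma all_sides_simps [simp]:
  "all_sides {#} = {#}" "all_sides (add_mset T Ts) = sides T + all_sides Ts"
  by (simp_all add: all_sides_def)

lemma arrows_simps [simp]:
  "arrows {#} i j = 0"
  "arrows (add_mset T Ts) i j = tri_arrows i j T - tri_arrows j i T + arrows Ts i j"
  by (simp_all add: arrows_def)

lemma arrows_skew: "arrows Ts j i = - arrows Ts i j"
  by (induction Ts) auto

lemma tri_arrows_eq_0:
  assumes "\<And>b. Some (i, b) \<notin># sides T"
  shows "tri_arrows i j T = 0" "tri_arrows j i T = 0"
proof -
  obtain h1 h2 h3 P Q R where T: "T = (h1, h2, h3, P, Q, R)" by (cases T)
  have "has_label h i = 0" if "h \<in># sides T" for h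
    using assms that by (auto simp: has_label_def simp del: sides.simps)
  then have "has_label h1 i = 0" "has_label h2 i = 0" "has_label h3 i = 0" using T by simp_all
  then show "tri_arrows i j T = 0" "tri_arrows j i T = 0" using T by simp_all
qed

lemma arrows_eq_0:
  assumes "\<And>b. Some (i, b) \<notin># all_sides Ts"
  shows "arrows Ts i j = 0"
  using assms
proof (induction Ts)
  case (add T Ts)
  then have "Some (i, b) \<notin># sides T" for b by auto
  then have "tri_arrows i j T = 0" "tri_arrows j i T = 0" using tri_arrows_eq_0[of i T j] by auto
  with add show ?case by simp
qed simp

locale lambda_lengths =
  fixes n :: nat and lam :: "pt \<Rightarrow> pt \<Rightarrow> 'k::field ratfun"
  assumes n_pos: "n > 0"
    and lam_sym: "lam P Q = lam Q P"
    and lam_shift: "lam (shift n g P) (shift n g Q) = lam P Q"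
    and ptolemy: "cyc P Q R \<Longrightarrow> cyc Q P S \<Longrightarrow>
      lam P Q * lam R S = lam Q R * lam P S + lam R P * lam S Q"
begin

lemma lam_same_edge:
  assumes "same_edge n P Q P' Q'"
  shows "lam P Q = lam P' Q'"
proof -
  obtain g g' where *: "shift n g P = shift n g' P'" "shift n g Q = shift n g' Q'"
    using assms by (auto simp: same_edge_def)
  have "lam P Q = lam (shift n g P) (shift n g Q)" by (simp only: lam_shift)
  also have "\<dots> = lam P' Q'" by (simp only: * lam_shift)
  finally show ?thesis .
qed

fun lies_on :: "(nat \<Rightarrow> pt \<times> pt) \<Rightarrow> side \<Rightarrow> pt \<Rightarrow> pt \<Rightarrow> bool" where
  "lies_on e None P Q \<longleftrightarrow> lam P Q = 1"
| "lies_on e (Some (k, b)) P Q \<longleftrightarrow>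
     (if b then same_edge n P Q (fst (e k)) (snd (e k)) else same_edge n Q P (fst (e k)) (snd (e k)))"

fun realized :: "(nat \<Rightarrow> pt \<times> pt) \<Rightarrow> triangle \<Rightarrow> bool" where
  "realized e (h1, h2, h3, P, Q, R) \<longleftrightarrow>
     cyc P Q R \<and> lies_on e h1 P Q \<and> lies_on e h2 Q R \<and> lies_on e h3 R P"

lemma lies_on_lam:
  assumes "lies_on e (Some (k, b)) P Q"
  shows "lam P Q = lam (fst (e k)) (snd (e k))"
  using assms lam_same_edge[of P Q] lam_same_edge[of Q P] lam_sym[of Q P] by (cases b) auto

definition triangulation :: "(nat \<Rightarrow> pt \<times> pt) \<Rightarrow> triangle multiset \<Rightarrow> bool" where
  "triangulation e Ts \<longleftrightarrow> (\<forall>T\<in>#Ts. realized e T) \<and>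
     (\<forall>k\<le>n. \<forall>b. count (all_sides Ts) (Some (k, b)) = 1) \<and>
     (\<forall>k b. Some (k, b) \<in># all_sides Ts \<longrightarrow> k \<le> n)"

lemma lies_on_shift [simp]: "lies_on e h (shift n g P) (shift n g Q) \<longleftrightarrow> lies_on e h P Q"
  by (cases "(e, h, P, Q)" rule: lies_on.cases) (auto simp: lam_shift)

lemma lies_on_upd: "h \<noteq> Some (k, True) \<Longrightarrow> h \<noteq> Some (k, False) \<Longrightarrow>
    lies_on (e(k := E)) h P Q \<longleftrightarrow> lies_on e h P Q"
  by (cases "(e, h, P, Q)" rule: lies_on.cases) auto

lemma realized_rotate:
  assumes "realized e T" "h \<in># sides T"
  obtains a b P Q R where "realized e (h, a, b, P, Q, R)" "sides (h, a, b, P, Q, R) = sides T"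
    "\<And>i j. tri_arrows i j (h, a, b, P, Q, R) = tri_arrows i j T"
proof -
  obtain h1 h2 h3 P Q R where T: "T = (h1, h2, h3, P, Q, R)" by (cases T)
  consider "h = h1" | "h = h2" | "h = h3" using assms T by auto
  then show thesis
  proof cases
    case 1
    then show ?thesis using that[of h2 h3 P Q R] T assms by simp
  next
    case 2
    then show ?thesis using that[of h3 h1 Q R P] T assms cyc_rotate[of P Q R] by simp
  next
    case 3
    then show ?thesis using that[of h1 h2 R P Q] T assms cyc_rotate[of R P Q] by simp
  qed
qed

lemma in_all_sidesE:
  assumes "h \<in># all_sides Ts"
  obtains T where "T \<in># Ts" "h \<in># sides T"
proof -
  have "\<exists>T. T \<in># Ts \<and> h \<in># sides T"
    using assms
  proof (induction Ts)
    case (add T Ts)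
    show ?case
    proof (cases "h \<in># sides T")
      case True
      then show ?thesis by (intro exI[of _ T]) simp
    next
      case False
      then have "\<exists>T. T \<in># Ts \<and> h \<in># sides T" using add by simp
      then obtain T' where "T' \<in># Ts" "h \<in># sides T'" by blast
      then show ?thesis by (intro exI[of _ T']) simp
    qed
  qed simp
  then show thesis using that by blast
qed

lemma opposite_sides:
  assumes "lies_on e (Some (k, b)) P Q" "lies_on e (Some (k, b')) Q R" "b \<noteq> b'"
  shows "P = R"
proof (cases b)
  case True
  then show ?thesis using assms same_edge_unique'[OF n_pos, of P Q _ _ R] by simp
next
  case False
  then show ?thesis using assms same_edge_unique[OF n_pos, of Q P _ _ R] by simp
qed

lemma quadrilateralE:
  assumes tri: "triangulation e Ts" and k: "k \<le> n"
  obtains a b c d P Q R S Rest where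
    "triangulation e ({#(Some (k, True), a, b, P, Q, R), (Some (k, False), c, d, Q, P, S)#} + Rest)"
    "arrows Ts = arrows ({#(Some (k, True), a, b, P, Q, R), (Some (k, False), c, d, Q, P, S)#} + Rest)"
proof -
  have cnt: "count (all_sides Ts) (Some (k, b)) = 1" for b
    using tri k by (auto simp: triangulation_def)
  have real: "\<And>T. T \<in># Ts \<Longrightarrow> realized e T"
    using tri by (auto simp: triangulation_def)
  have "Some (k, True) \<in># all_sides Ts" "Some (k, False) \<in># all_sides Ts"
    using cnt[of True] cnt[of False] by (metis count_inI zero_neq_one)+
  then obtain T1 T2 where T1: "T1 \<in># Ts" "Some (k, True) \<in># sides T1"
    and T2: "T2 \<in># Ts" "Some (k, False) \<in># sides T2"
    by (meson in_all_sidesE)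
  obtain a b P1 Q1 R1 where 1: "realized e (Some (k, True), a, b, P1, Q1, R1)"
    "sides (Some (k, True), a, b, P1, Q1, R1) = sides T1"
    "\<And>i j. tri_arrows i j (Some (k, True), a, b, P1, Q1, R1) = tri_arrows i j T1"
    using realized_rotate[OF real[OF T1(1)] T1(2)] by blast
  obtain c d P2 Q2 S2 where 2: "realized e (Some (k, False), c, d, Q2, P2, S2)"
    "sides (Some (k, False), c, d, Q2, P2, S2) = sides T2"
    "\<And>i j. tri_arrows i j (Some (k, False), c, d, Q2, P2, S2) = tri_arrows i j T2"
    using realized_rotate[OF real[OF T2(1)] T2(2)] by blast
  have "T1 \<noteq> T2"
  proof
    assume "T1 = T2"
    then have "Some (k, False) \<in># {#Some (k, True), a, b#}"
      using T2(2) 1(2) by simp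
    then have "a = Some (k, False) \<or> b = Some (k, False)" by auto
    then show False
    proof
      assume "a = Some (k, False)"
      then have "P1 = R1" using opposite_sides[of e k True P1 Q1 False R1] 1(1) by simp
      then show False using cyc_distinct[of P1 Q1 R1] 1(1) by simp
    next
      assume "b = Some (k, False)"
      then have "R1 = Q1" using opposite_sides[of e k False R1 P1 True Q1] 1(1) by simp
      then show False using cyc_distinct[of P1 Q1 R1] 1(1) by simp
    qed
  qed
  then obtain Rest where Rest: "Ts = add_mset T1 (add_mset T2 Rest)"
    using T1(1) T2(1) by (metis insert_DiffM insert_noteq_member)
  have "same_edge n P1 Q1 P2 Q2"
    using 1(1) 2(1) by simp (meson same_edge_sym same_edge_trans)
  then obtain g h where gh: "shift n g P1 = shift n h P2" "shift n g Q1 = shift n h Q2"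
    by (auto simp: same_edge_def)
  define P Q R S where "P = shift n g P1" "Q = shift n g Q1" "R = shift n g R1" "S = shift n h S2"
  note PQRS = this
  let ?T1 = "(Some (k, True), a, b, P, Q, R)" and ?T2 = "(Some (k, False), c, d, Q, P, S)"
  have T1': "realized e ?T1" "sides ?T1 = sides T1" "\<And>i j. tri_arrows i j ?T1 = tri_arrows i j T1"
    using 1 PQRS by auto
  have T2': "realized e ?T2" "sides ?T2 = sides T2" "\<And>i j. tri_arrows i j ?T2 = tri_arrows i j T2"
    using 2 PQRS gh by auto
  have all: "all_sides ({#?T1, ?T2#} + Rest) = all_sides Ts"
    using T1'(2) T2'(2) Rest by (simp del: sides.simps)
  show thesis
  proof (rule that)
    show "triangulation e ({#?T1, ?T2#} + Rest)"
      unfolding triangulation_def all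
      using tri T1'(1) T2'(1) Rest by (auto simp: triangulation_def simp del: realized.simps)
    show "arrows Ts = arrows ({#?T1, ?T2#} + Rest)"
      using T1'(3) T2'(3) Rest by (intro ext) (simp del: tri_arrows.simps)
  qed
qed

definition seed_realized :: "(nat \<Rightarrow> 'k ratfun) \<Rightarrow> quiver \<Rightarrow> bool" where
  "seed_realized x q \<longleftrightarrow> (\<exists>e Ts. triangulation e Ts \<and> (\<forall>k\<le>n. x k = lam (fst (e k)) (snd (e k))) \<and>
     (\<forall>i\<le>n. \<forall>j\<le>n. q i j = nat (arrows Ts i j)))"

lemma prod_labels:
  assumes "\<And>k b. h = Some (k, b) \<Longrightarrow> k \<le> n"
  shows "(\<Prod>i\<le>n. x i ^ nat (has_label h i)) =
    (case h of None \<Rightarrow> 1 | Some (k, b) \<Rightarrow> (x k :: 'k ratfun))"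
proof (cases h)
  case (Some p)
  obtain k b where p: "p = (k, b)" by (cases p)
  have "(\<Prod>i\<le>n. x i ^ nat (has_label h i)) = (\<Prod>i\<le>n. if i = k then x i else 1)"
    by (intro prod.cong refl) (auto simp: has_label_def Some p)
  then show ?thesis using assms[of k b] Some p by (simp add: prod.delta)
qed (simp add: has_label_def)

lemma seed_realized_mutate:
  assumes "seed_realized x q" and k: "k \<le> n" and x0: "x k \<noteq> 0"
  shows "seed_realized (cluster_mutate n k q x) (quiver_mutate k q)"
proof -
  obtain e Ts0 where Ts0: "triangulation e Ts0" and x: "\<And>k. k \<le> n \<Longrightarrow> x k = lam (fst (e k)) (snd (e k))"
    and q0: "\<And>i j. i \<le> n \<Longrightarrow> j \<le> n \<Longrightarrow> q i j = nat (arrows Ts0 i j)"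
    using assms(1) by (auto simp: seed_realized_def)
  obtain a b c d P Q R S Rest where
    tri: "triangulation e ({#(Some (k, True), a, b, P, Q, R), (Some (k, False), c, d, Q, P, S)#} + Rest)"
    and arr: "arrows Ts0 =
      arrows ({#(Some (k, True), a, b, P, Q, R), (Some (k, False), c, d, Q, P, S)#} + Rest)"
    by (rule quadrilateralE[OF Ts0 k])
  let ?Ts = "{#(Some (k, True), a, b, P, Q, R), (Some (k, False), c, d, Q, P, S)#} + Rest"
  note q = q0[unfolded arr]
  have cnt: "count (all_sides ?Ts) (Some (j, b)) = 1" if "j \<le> n" for j b
    using tri that by (auto simp: triangulation_def)
  have le: "j \<le> n" if "Some (j, b) \<in># all_sides ?Ts" for j b
    using tri that by (auto simp: triangulation_def)
  have geo: "cyc P Q R" "cyc Q P S"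
      "lies_on e (Some (k, True)) P Q" "lies_on e a Q R" "lies_on e b R P"
      "lies_on e c P S" "lies_on e d S Q"
    using tri by (auto simp: triangulation_def)
  have real: "\<And>T. T \<in># Rest \<Longrightarrow> realized e T"
    using tri by (auto simp: triangulation_def)
  have free: "h \<noteq> Some (k, True)" "h \<noteq> Some (k, False)"
    if "h \<in># {#a, b, c, d#} + all_sides Rest" for h
  proof -
    have "count ({#a, b, c, d#} + all_sides Rest) (Some (k, b')) = 0" for b'
      using cnt[OF k, of b'] by (cases b') (auto split: if_splits)
    then show "h \<noteq> Some (k, True)" "h \<noteq> Some (k, False)"
      using that by (metis count_eq_zero_iff)+
  qed
  have lab_k: "has_label a k = 0" "has_label b k = 0" "has_label c k = 0" "has_label d k = 0"
    using free[of a] free[of b] free[of c] free[of d] by (auto simp: has_label_def)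
  have clash: False if "h = Some (j, b1)" "h' = Some (j, b2)" "lies_on e h U V" "lies_on e h' V W"
      "U \<noteq> W" "{#h, h'#} \<subseteq># {#a, b, c, d#}" for h h' j b1 b2 U V W
  proof -
    have "b1 \<noteq> b2"
    proof
      assume "b1 = b2"
      then have "count {#h, h'#} (Some (j, b1)) = 2" using that by simp
      moreover have "count {#h, h'#} (Some (j, b1)) \<le> count {#a, b, c, d#} (Some (j, b1))"
        using that(6) by (rule mset_subset_eq_count)
      moreover have "count {#a, b, c, d#} (Some (j, b1)) \<le> count (all_sides ?Ts) (Some (j, b1))"
        by (rule mset_subset_eq_count) (simp add: subseteq_mset_def)
      moreover have "j \<le> n"
      proof (rule le)
        have "Some (j, b1) \<in># {#a, b, c, d#}" using that(1,6)
          by (metis mset_subset_eqD union_single_eq_member add_mset_add_single)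
        then show "Some (j, b1) \<in># all_sides ?Ts" by auto
      qed
      ultimately show False using cnt[of j b1] by linarith
    qed
    then show False using that opposite_sides by blast
  qed
  have ne: "P \<noteq> Q" "Q \<noteq> P" "R \<noteq> S" "S \<noteq> R"
    using cyc_distinct[OF geo(1)] cyc_flip(1)[OF geo(1,2)] by auto
  have disj: "has_label a i = 0 \<and> has_label c i = 0 \<or> has_label b i = 0 \<and> has_label d i = 0" for i
  proof (rule ccontr)
    assume "\<not> ?thesis"
    then consider b1 b2 where "a = Some (i, b1)" "b = Some (i, b2)"
      | b1 b2 where "a = Some (i, b1)" "d = Some (i, b2)"
      | b1 b2 where "c = Some (i, b1)" "b = Some (i, b2)"
      | b1 b2 where "c = Some (i, b1)" "d = Some (i, b2)"
      by (auto simp: has_label_def split: if_splits)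
    then show False
    proof cases
      case 1
      then show False using clash[of a i b1 b b2 Q R P] geo ne by simp
    next
      case 2
      then show False using clash[of d i b2 a b1 S Q R] geo ne by simp
    next
      case 3
      then show False using clash[of b i b2 c b1 R P S] geo ne by simp
    next
      case 4
      then show False using clash[of c i b1 d b2 P S Q] geo ne by simp
    qed
  qed
  have Rest0: "arrows Rest i k = 0" "arrows Rest k i = 0" for i
  proof -
    show "arrows Rest k i = 0" by (rule arrows_eq_0) (metis (full_types) free union_iff)
    then show "arrows Rest i k = 0" using arrows_skew[of Rest k i] by simp
  qed
  have kk: "has_label (Some (k, b')) i = of_bool (i = k)" for i b'
    by (auto simp: has_label_def)
  have arr_k: "arrows ?Ts i k = has_label a i + has_label c i - has_label b i - has_label d i" for i
    by (simp add: kk lab_k Rest0 of_bool_def)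
  define e' where "e' = e(k := (R, S))"
  define Ts' where
    "Ts' = {#(Some (k, True), d, a, R, S, Q), (Some (k, False), b, c, S, R, P)#} + Rest"
  have all: "all_sides Ts' = all_sides ?Ts"
    by (simp add: Ts'_def)
  have tri': "triangulation e' Ts'"
  proof -
    have "realized e' T" if T: "T \<in># Ts'" for T
    proof -
      consider "T = (Some (k, True), d, a, R, S, Q)" | "T = (Some (k, False), b, c, S, R, P)" | "T \<in># Rest"
        using T by (auto simp: Ts'_def)
      then show ?thesis
      proof cases
        case 1
        then show ?thesis using geo cyc_flip[OF geo(1,2)] free[of a] free[of d]
          by (simp add: e'_def lies_on_upd)
      next
        case 2
        then show ?thesis using geo cyc_flip[OF geo(1,2)] free[of b] free[of c]
          by (simp add: e'_def lies_on_upd)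
      next
        case 3
        obtain h1 h2 h3 U V W where T: "T = (h1, h2, h3, U, V, W)" by (cases T)
        have "h \<in># all_sides Rest" if "h \<in># sides T" for h
          using 3 that by (induction Rest) auto
        then have "h \<noteq> Some (k, True) \<and> h \<noteq> Some (k, False)" if "h \<in># sides T" for h
          using that free by (metis union_iff)
        then show ?thesis using real[OF 3] T by (simp add: e'_def lies_on_upd)
      qed
    qed
    then show ?thesis
      using tri unfolding triangulation_def all by blast
  qed
  have arr'_k: "arrows Ts' i k = - arrows ?Ts i k" for i
    by (simp add: Ts'_def kk lab_k Rest0 of_bool_def)
  have arr': "arrows Ts' i j = arrows ?Ts i j
      + (has_label a i + has_label c i) * (has_label b j + has_label d j)
      - (has_label a j + has_label c j) * (has_label b i + has_label d i)" if "i \<noteq> k" "j \<noteq> k" for i j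
    using that by (simp add: Ts'_def kk algebra_simps)
  have lab_nn: "has_label h i \<ge> 0" for h i by (simp add: has_label_def)
  have q_in: "q i k = nat (has_label a i + has_label c i)"
    and q_out: "q k i = nat (has_label b i + has_label d i)" if "i \<le> n" for i
  proof -
    have "q i k = nat (has_label a i + has_label c i - has_label b i - has_label d i)"
         "q k i = nat (- (has_label a i + has_label c i - has_label b i - has_label d i))"
      using q[OF that k] q[OF k that] arrows_skew[of ?Ts i k] unfolding arr_k by simp_all
    then show "q i k = nat (has_label a i + has_label c i)"
       "q k i = nat (has_label b i + has_label d i)"
      using disj[of i] lab_nn[of a i] lab_nn[of b i] lab_nn[of c i] lab_nn[of d i] by auto
  qed
  have q': "quiver_mutate k q i j = nat (arrows Ts' i j)" if ij: "i \<le> n" "j \<le> n" for i j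
  proof (cases "i = k \<or> j = k")
    case True
    then show ?thesis
      using q[OF ij(2,1)] arr'_k[of i] arr'_k[of j] arrows_skew[of Ts' j k] arrows_skew[of ?Ts i k]
        arrows_skew[of ?Ts j k]
      by (auto simp: quiver_mutate_def)
  next
    case False
    have "int (q i j + q i k * q k j) - int (q j i + q j k * q k i) = arrows Ts' i j"
      using False arr'[of i j] q[OF ij] q[OF ij(2,1)] arrows_skew[of ?Ts j i]
        lab_nn[of a i] lab_nn[of b i] lab_nn[of c i] lab_nn[of d i]
        lab_nn[of a j] lab_nn[of b j] lab_nn[of c j] lab_nn[of d j]
      by (simp only: q_in[OF ij(1)] q_in[OF ij(2)] q_out[OF ij(1)] q_out[OF ij(2)]
          of_nat_add of_nat_mult) (simp add: algebra_simps)
    moreover have "a - b = nat z" if "int a - int b = z" for a b z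
      using that by linarith
    ultimately show ?thesis using False by (simp only: quiver_mutate_def if_False de_Morgan_disj simp_thms)
  qed
  have val: "(\<Prod>i\<le>n. x i ^ nat (has_label h i)) = lam U V"
    if "lies_on e h U V" "h \<in># {#a, b, c, d#}" for h U V
  proof -
    have hle: "j \<le> n" if "h = Some (j, b')" for j b'
      by (rule le[of j b']) (use that \<open>h \<in># {#a, b, c, d#}\<close> in auto)
    have "(\<Prod>i\<le>n. x i ^ nat (has_label h i)) = (case h of None \<Rightarrow> 1 | Some (k, b) \<Rightarrow> x k)"
      by (rule prod_labels) (rule hle)
    also have "\<dots> = lam U V"
    proof (cases h)
      case (Some p)
      then show ?thesis
        using that(1) lies_on_lam[of e "fst p" "snd p" U V] x[OF hle, of "fst p" "snd p"]
        by (cases p) simp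
    qed (use that in simp)
    finally show ?thesis .
  qed
  have "(\<Prod>i\<le>n. x i ^ q i k) = lam Q R * lam P S"
  proof -
    have "(\<Prod>i\<le>n. x i ^ q i k) = (\<Prod>i\<le>n. x i ^ nat (has_label a i) * x i ^ nat (has_label c i))"
      by (intro prod.cong refl)
         (simp add: q_in nat_add_distrib lab_nn power_add)
    then show ?thesis using geo by (simp add: prod.distrib val)
  qed
  moreover have "(\<Prod>j\<le>n. x j ^ q k j) = lam R P * lam S Q"
  proof -
    have "(\<Prod>i\<le>n. x i ^ q k i) = (\<Prod>i\<le>n. x i ^ nat (has_label b i) * x i ^ nat (has_label d i))"
      by (intro prod.cong refl)
         (simp add: q_out nat_add_distrib lab_nn power_add)
    then show ?thesis using geo by (simp add: prod.distrib val)
  qed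
  moreover have "x k = lam P Q"
    using geo(3) x[OF k] by (simp add: lam_same_edge)
  moreover have "(lam Q R * lam P S + lam R P * lam S Q) / lam P Q = lam R S" if "lam P Q \<noteq> 0"
    unfolding ptolemy[OF geo(1,2), symmetric] using that by simp
  ultimately have "cluster_mutate n k q x = x(k := lam R S)"
    using x0 by (simp add: cluster_mutate_def)
  then have x': "cluster_mutate n k q x j = lam (fst (e' j)) (snd (e' j))" if "j \<le> n" for j
    using x[OF that] by (simp add: e'_def)
  show ?thesis
    unfolding seed_realized_def using tri' x' q' by blast
qed

end

section \<open>Generators and lambda lengths\<close>

definition X_of :: "(nat \<Rightarrow> 'k::field ratfun) \<Rightarrow> nat \<Rightarrow> 'k ratfun" where
  "X_of a i = inverse (a i) * (a (i - 1) + a (i + 1))"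

definition frieze_gens :: "nat \<Rightarrow> (nat \<Rightarrow> 'k::field ratfun) \<Rightarrow> 'k ratfun set" where
  "frieze_gens n a = {a 0, a 1} \<union> X_of a ` {1..n}"

definition w_seq :: "nat \<Rightarrow> nat \<Rightarrow> 'k::field ratfun" where
  "w_seq n i = (if i \<le> n then rvar i else (1 + rvar 1 * rvar n) / rvar 0)"

lemma X_of_rec: "a i \<noteq> 0 \<Longrightarrow> i \<ge> 1 \<Longrightarrow> a (i + 1) = X_of a i * a i - a (i - 1)"
  by (simp add: X_of_def field_simps)

lemma frieze_gens_seq:
  assumes "\<And>i. 1 \<le> i \<Longrightarrow> i \<le> n \<Longrightarrow> a i \<noteq> 0" "i \<le> n + 1"
  shows "a i \<in> gen_subalgebra (frieze_gens n a)"
  using assms(2)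
proof (induction i rule: less_induct)
  case (less i)
  consider "i = 0" | "i = 1" | "i \<ge> 2" by linarith
  then show ?case
  proof cases
    case 3
    then obtain k where k: "i = k + 1" "k \<ge> 1" by (metis add.commute le_Suc_ex nat_1_add_1 le_add1 add.assoc)
    have "X_of a k \<in> gen_subalgebra (frieze_gens n a)"
      using k less.prems by (intro gen_subalgebra.gen) (auto simp: frieze_gens_def)
    then have "X_of a k * a k - a (k - 1) \<in> gen_subalgebra (frieze_gens n a)"
      using k less by (intro gen_subalgebra_diff gen_subalgebra.mult) auto
    then show ?thesis
      using X_of_rec[of a k] assms(1)[of k] k less.prems by simp
  qed (auto simp: frieze_gens_def intro: gen_subalgebra.gen)
qed

fun frieze_rec :: "(nat \<Rightarrow> 'a::comm_ring_1) \<Rightarrow> 'a \<Rightarrow> 'a \<Rightarrow> nat \<Rightarrow> 'a" where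
  "frieze_rec x u v 0 = u"
| "frieze_rec x u v (Suc 0) = v"
| "frieze_rec x u v (Suc (Suc k)) = x (Suc k) * frieze_rec x u v (Suc k) - frieze_rec x u v k"

lemma frieze_rec_linear:
  "frieze_rec x u v k = u * frieze_rec x 1 0 k + v * frieze_rec x 0 1 k"
  by (induction x u v k rule: frieze_rec.induct) (simp_all add: algebra_simps)

lemma frieze_rec_wronskian:
  "frieze_rec x 1 0 k * frieze_rec x 0 1 (Suc k) - frieze_rec x 1 0 (Suc k) * frieze_rec x 0 1 k = 1"
  by (induction k) (simp_all add: algebra_simps)

lemma frieze_rec_period:
  assumes "\<And>k. k \<ge> 1 \<Longrightarrow> x (k + n) = x k"
  shows "frieze_rec x u v (k + n) = frieze_rec x (frieze_rec x u v n) (frieze_rec x u v (Suc n)) k"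
proof (induction k rule: less_induct)
  case (less k)
  consider "k = 0" | "k = 1" | j where "k = Suc (Suc j)" by (metis One_nat_def not0_implies_Suc)
  then show ?case
  proof cases
    case 3
    then show ?thesis using less[of j] less[of "Suc j"] assms[of "Suc j"] by simp
  qed simp_all
qed

lemma frieze_rec_in:
  assumes "\<And>k. k \<ge> 1 \<Longrightarrow> x k \<in> gen_subalgebra S" "u \<in> gen_subalgebra S" "v \<in> gen_subalgebra S"
  shows "frieze_rec x u v k \<in> gen_subalgebra S"
  using assms by (induction x u v k rule: frieze_rec.induct)
    (auto intro!: gen_subalgebra_diff gen_subalgebra.mult)

definition det2 :: "'a::comm_ring_1 \<times> 'a \<Rightarrow> 'a \<times> 'a \<Rightarrow> 'a" where
  "det2 p q = fst p * snd q - snd p * fst q"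

locale frieze =
  fixes n :: nat and a :: "nat \<Rightarrow> 'k::field ratfun"
  assumes n2: "n \<ge> 2"
    and a_nz: "i \<le> n \<Longrightarrow> a i \<noteq> 0"
    and a_last: "a 0 * a (n + 1) - a 1 * a n = 1"
begin

abbreviation "X_per k \<equiv> X_of a ((k - 1) mod n + 1)"
abbreviation "p \<equiv> frieze_rec X_per 1 0"
abbreviation "q \<equiv> frieze_rec X_per 0 1"

definition monodromy :: "'k ratfun \<times> 'k ratfun \<Rightarrow> 'k ratfun \<times> 'k ratfun" where
  "monodromy r = (fst r * p n + snd r * p (Suc n), fst r * q n + snd r * q (Suc n))"

text \<open>The vectors of the outer marked points solve \<open>v\<^sub>i\<^sub>+\<^sub>1 = X\<^sub>i v\<^sub>i - v\<^sub>i\<^sub>-\<^sub>1\<close> with periodic \<open>X\<close>; the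
  vector of \<open>In 0\<close> is chosen such that its determinant with \<open>v\<^sub>i\<close> is \<open>a i\<close>.\<close>

fun vec :: "pt \<Rightarrow> 'k ratfun \<times> 'k ratfun" where
  "vec (Out i) = (p i, q i)"
| "vec (In m) = (monodromy ^^ m) (- a 1, a 0)"

definition lam :: "pt \<Rightarrow> pt \<Rightarrow> 'k ratfun" where
  "lam P Q = (if pt_less P Q then det2 (vec P) (vec Q) else det2 (vec Q) (vec P))"

lemma n_pos: "n > 0" using n2 by simp

lemma X_per: "k \<ge> 1 \<Longrightarrow> X_per (k + n) = X_per k"
proof -
  assume "k \<ge> 1"
  then have "(k + n - 1) mod n = (k - 1) mod n"
    by (metis Nat.add_diff_assoc2 mod_add_self2)
  then show ?thesis by simp
qed

lemma det2_monodromy: "det2 (monodromy r) (monodromy s) = det2 r s"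
proof -
  have "det2 (monodromy r) (monodromy s) = det2 r s * (p n * q (Suc n) - p (Suc n) * q n)"
    by (simp add: det2_def monodromy_def algebra_simps)
  then show ?thesis by (simp only: frieze_rec_wronskian mult_1_right)
qed

lemma det2_monodromy_pow: "det2 ((monodromy ^^ g) r) ((monodromy ^^ g) s) = det2 r s"
  by (induction g) (simp_all add: det2_monodromy)

lemma monodromy_Out: "monodromy (vec (Out i)) = vec (Out (i + n))"
proof -
  have "p (i + n) = p n * p i + p (Suc n) * q i" "q (i + n) = q n * p i + q (Suc n) * q i"
    by (subst frieze_rec_period, rule X_per, assumption, subst frieze_rec_linear, rule refl)+
  then show ?thesis by (simp add: monodromy_def algebra_simps)
qed

lemma vec_shift: "vec (shift n g P) = (monodromy ^^ g) (vec P)"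
proof (cases P)
  case (Out i)
  have "(monodromy ^^ g) (vec (Out i)) = vec (Out (i + g * n))"
  proof (induction g)
    case (Suc g)
    then have "(monodromy ^^ Suc g) (vec (Out i)) = monodromy (vec (Out (i + g * n)))" by simp
    also have "\<dots> = vec (Out (i + Suc g * n))"
      unfolding monodromy_Out by (simp add: algebra_simps)
    finally show ?case .
  qed simp
  then show ?thesis using Out by simp
next
  case (In m)
  then show ?thesis by (simp add: funpow_add add.commute[of m])
qed

lemma lam_less: "pt_less P Q \<Longrightarrow> lam P Q = det2 (vec P) (vec Q)"
    "pt_less P Q \<Longrightarrow> lam Q P = det2 (vec P) (vec Q)"
  using pt_less_asym[of P Q] by (simp_all add: lam_def)

sublocale lambda_lengths n lam
proof
  show "n > 0" by (rule n_pos)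
  show "lam P Q = lam Q P" for P Q
    using pt_less_linear[of P Q] lam_less by metis
  show "lam (shift n g P) (shift n g Q) = lam P Q" for g P Q
    by (simp add: lam_def vec_shift det2_monodromy_pow)
  show "lam P Q * lam R S = lam Q R * lam P S + lam R P * lam S Q" if "cyc P Q R" "cyc Q P S" for P Q R S
    using cyc_quad[OF that]
  proof (elim disjE conjE)
    assume *: "pt_less Q R" "pt_less R P" "pt_less P S"
    then have "pt_less Q P" "pt_less Q S" "pt_less R S" by (meson pt_less_trans)+
    with * show ?thesis by (simp add: lam_less det2_def algebra_simps)
  next
    assume *: "pt_less R P" "pt_less P S" "pt_less S Q"
    then have "pt_less R S" "pt_less R Q" "pt_less P Q" by (meson pt_less_trans)+
    with * show ?thesis by (simp add: lam_less det2_def algebra_simps)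
  next
    assume *: "pt_less P S" "pt_less S Q" "pt_less Q R"
    then have "pt_less P Q" "pt_less P R" "pt_less S R" by (meson pt_less_trans)+
    with * show ?thesis by (simp add: lam_less det2_def algebra_simps)
  next
    assume *: "pt_less S Q" "pt_less Q R" "pt_less R P"
    then have "pt_less S R" "pt_less S P" "pt_less Q P" by (meson pt_less_trans)+
    with * show ?thesis by (simp add: lam_less det2_def algebra_simps)
  qed
qed

lemma det2_seq:
  assumes "i \<le> n + 1"
  shows "det2 (p i, q i) (- a 1, a 0) = a i"
  using assms
proof (induction i rule: less_induct)
  case (less i)
  consider "i = 0" | "i = 1" | j where "i = Suc (Suc j)" by (metis One_nat_def not0_implies_Suc)
  then show ?case
  proof cases
    case 3
    have X: "X_per (Suc j) = X_of a (Suc j)" using 3 less.prems by simp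
    have "det2 (p i, q i) (- a 1, a 0) = X_of a (Suc j) * det2 (p (Suc j), q (Suc j)) (- a 1, a 0)
        - det2 (p j, q j) (- a 1, a 0)"
      unfolding 3 frieze_rec.simps X by (simp add: det2_def algebra_simps)
    also have "\<dots> = X_of a (Suc j) * a (Suc j) - a j"
      using less.IH[of j] less.IH[of "Suc j"] less.prems 3 by simp
    also have "\<dots> = a i"
      using X_of_rec[of a "Suc j"] a_nz[of "Suc j"] less.prems 3 by simp
    finally show ?thesis .
  qed (simp_all add: det2_def)
qed

lemma lam_Out_In: "i \<le> n + 1 \<Longrightarrow> lam (Out i) (In 0) = a i"
  using det2_seq[of i] by (simp add: lam_def)

lemma lam_Out_Out: "lam (Out i) (Out (Suc i)) = 1"
  using frieze_rec_wronskian[of X_per i] by (simp add: lam_def det2_def algebra_simps)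

lemma lam_In_In: "lam (In (Suc 0)) (In 0) = 1"
proof -
  have "lam (In (Suc 0)) (In 0) = det2 (monodromy (- a 1, a 0)) (- a 1, a 0)"
    by (simp add: lam_def)
  also have "\<dots> = - a 1 * det2 (p n, q n) (- a 1, a 0) + a 0 * det2 (p (Suc n), q (Suc n)) (- a 1, a 0)"
    by (simp add: det2_def monodromy_def algebra_simps)
  also have "\<dots> = 1"
    using det2_seq[of n] det2_seq[of "Suc n"] a_last by simp
  finally show ?thesis .
qed

abbreviation "B \<equiv> gen_subalgebra (frieze_gens n a)"

lemma lam_in: "lam P Q \<in> B"
proof -
  have X: "X_per k \<in> B" for k
    using n_pos mod_less_divisor[of n "k - 1"]
    by (intro gen_subalgebra.gen) (auto simp: frieze_gens_def Suc_le_eq)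
  then have pq: "p k \<in> B" "q k \<in> B" for k
    by (auto intro!: frieze_rec_in)
  have a01: "a 0 \<in> B" "a 1 \<in> B"
    by (auto intro!: gen_subalgebra.gen simp: frieze_gens_def)
  have "fst ((monodromy ^^ m) (- a 1, a 0)) \<in> B \<and> snd ((monodromy ^^ m) (- a 1, a 0)) \<in> B" for m
  proof (induction m)
    case (Suc m)
    then show ?case
      unfolding funpow.simps comp_apply monodromy_def fst_conv snd_conv
      by (intro conjI gen_subalgebra.add gen_subalgebra.mult pq) auto
  qed (simp add: a01 [simplified] gen_subalgebra_uminus)
  then have v: "fst (vec P) \<in> B \<and> snd (vec P) \<in> B" for P
    using pq by (cases P) (simp_all only: vec.simps fst_conv snd_conv simp_thms)
  have "det2 (vec P) (vec Q) \<in> B" for P Q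
    unfolding det2_def by (intro gen_subalgebra_diff gen_subalgebra.mult v[THEN conjunct1] v[THEN conjunct2])
  then show ?thesis
    by (cases "pt_less P Q") (simp_all only: lam_def if_True if_False)
qed

lemma initial_seed_realized: "seed_realized a (quiver_P1 n)"
proof -
  define e where "e i = (Out i, In 0)" for i
  define T where "T i = (None::side, Some (Suc i, True), Some (i, False), Out i, Out (Suc i), In 0)" for i
  define T0 :: triangle where "T0 = (Some (0, True), None, Some (n, False), Out n, In 1, In 0)"
  define Ts where "Ts = add_mset T0 (image_mset T (mset_set {..<n}))"
  have all: "all_sides Ts = sides T0 + (\<Sum>i<n. sides (T i))"
    by (simp add: Ts_def all_sides_def sum_unfold_sum_mset image_mset.compositionality comp_def)
  have "same_edge n (Out n) (In 1) (Out 0) (In 0)"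
    unfolding same_edge_def by (rule exI[of _ 0], rule exI[of _ 1]) simp
  then have T0: "realized e T0"
    using lam_In_In by (simp add: T0_def e_def cyc_def)
  have T: "realized e (T i)" for i
    using lam_Out_Out[of i] by (simp add: T_def e_def cyc_def)
  have cnt: "count (all_sides Ts) (Some (k, b)) = 1" if "k \<le> n" for k b
  proof -
    have c: "count (sides (T i)) (Some (k, b)) = of_bool (b \<and> k = Suc i) + of_bool (\<not> b \<and> k = i)" for i
      by (auto simp: T_def)
    have c0: "count (sides T0) (Some (k, b)) = of_bool (b \<and> k = 0) + of_bool (\<not> b \<and> k = n)"
      by (auto simp: T0_def)
    have "count (all_sides Ts) (Some (k, b)) =
        of_bool (b \<and> k = 0) + of_bool (\<not> b \<and> k = n) + (\<Sum>i<n. of_bool (b \<and> k = Suc i) + of_bool (\<not> b \<and> k = i))"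
      by (simp only: all count_union count_sum c c0)
    also have "(\<Sum>i<n. of_bool (b \<and> k = Suc i) + of_bool (\<not> b \<and> k = i)) =
        (\<Sum>i<n. (if i = k - 1 then of_bool (b \<and> k \<ge> 1) else 0) + (if i = k then of_bool (\<not> b) else (0::nat)))"
      by (intro sum.cong refl) auto
    also have "of_bool (b \<and> k = 0) + of_bool (\<not> b \<and> k = n) + \<dots> = 1"
      using that n_pos by (auto simp: sum.distrib sum.delta)
    finally show ?thesis .
  qed
  have le: "k \<le> n" if "Some (k, b) \<in># all_sides Ts" for k b
    using that by (auto simp: all T0_def T_def set_mset_sum split: if_splits)
  have tri: "triangulation e Ts"
    unfolding triangulation_def using T0 T cnt le by (auto simp: Ts_def)
  have arr: "arrows Ts i j = int (quiver_P1 n i j) - int (quiver_P1 n j i)" for i j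
  proof -
    have lab: "has_label None l = 0" "has_label (Some (k, b)) l = of_bool (l = k)" for k b l
      by (auto simp: has_label_def)
    have t: "tri_arrows i j (T l) = (if l = i then of_bool (j = Suc i) else 0)" for i j l
      by (simp add: T_def lab)
    have t0: "tri_arrows i j T0 = of_bool (i = 0 \<and> j = n)" for i j
      by (simp add: T0_def lab)
    have "arrows Ts i j = tri_arrows i j T0 - tri_arrows j i T0
        + (\<Sum>l<n. tri_arrows i j (T l) - tri_arrows j i (T l))"
      by (simp add: Ts_def arrows_def sum_unfold_sum_mset image_mset.compositionality comp_def)
    also have "\<dots> = of_bool (i = 0 \<and> j = n) - of_bool (j = 0 \<and> i = n)
        + (of_bool (i < n \<and> j = Suc i) - of_bool (j < n \<and> i = Suc j))"
      by (simp add: t t0 sum_subtractf sum.delta)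
    finally show ?thesis by (simp add: quiver_P1_def)
  qed
  have "quiver_P1 n i j = nat (arrows Ts i j)" for i j
    unfolding arr using n2 by (auto simp: quiver_P1_def)
  moreover have "a k = lam (fst (e k)) (snd (e k))" if "k \<le> n" for k
    using lam_Out_In[of k] that by (simp add: e_def)
  ultimately show ?thesis
    unfolding seed_realized_def using tri by blast
qed

end

section \<open>Cluster variables are subtraction-free\<close>

definition subtraction_free :: "'k::field_char_0 ratfun \<Rightarrow> bool" where
  "subtraction_free f \<longleftrightarrow> (\<exists>p q. p \<noteq> 0 \<and> q \<noteq> 0 \<and> (\<forall>m. Poly_Mapping.lookup p m \<in> \<nat>) \<and>
     (\<forall>m. Poly_Mapping.lookup q m \<in> \<nat>) \<and> f = Fract p q)"

lemma Nats_sum': "(\<And>i. i \<in> A \<Longrightarrow> f i \<in> \<nat>) \<Longrightarrow> sum f A \<in> (\<nat> :: 'a::semiring_1 set)"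
  by (induction A rule: infinite_finite_induct) auto

lemma nat_coeffs_mult:
  fixes p q :: "'k::field_char_0 mpoly"
  assumes "\<And>m. Poly_Mapping.lookup p m \<in> \<nat>" "\<And>m. Poly_Mapping.lookup q m \<in> \<nat>"
  shows "Poly_Mapping.lookup (p * q) m \<in> \<nat>"
proof -
  have "p * q = (\<Sum>a\<in>Poly_Mapping.keys p. Poly_Mapping.single a (Poly_Mapping.lookup p a)) *
      (\<Sum>b\<in>Poly_Mapping.keys q. Poly_Mapping.single b (Poly_Mapping.lookup q b))"
    by (simp add: mpoly_sum_monomials [symmetric])
  also have "Poly_Mapping.lookup \<dots> m \<in> \<nat>"
    unfolding sum_product mult_single lookup_sum
    by (intro Nats_sum') (simp add: lookup_single when_def assms)
  finally show ?thesis .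
qed

lemma nat_coeffs_add_neq_0:
  fixes p q :: "'k::field_char_0 mpoly"
  assumes "p \<noteq> 0" "\<And>m. Poly_Mapping.lookup p m \<in> \<nat>" "\<And>m. Poly_Mapping.lookup q m \<in> \<nat>"
  shows "p + q \<noteq> 0"
proof
  assume 0: "p + q = 0"
  have "Poly_Mapping.lookup p m = 0" for m
  proof -
    obtain i j where "Poly_Mapping.lookup p m = of_nat i" "Poly_Mapping.lookup q m = of_nat j"
      using assms(2,3)[of m] by (auto elim!: Nats_cases)
    moreover from this have "of_nat (i + j) = (0::'k)"
      using arg_cong[OF 0, of "\<lambda>r. Poly_Mapping.lookup r m"] by (simp add: lookup_add)
    then have "i + j = 0" by (simp only: of_nat_eq_0_iff)
    ultimately show ?thesis by simp
  qed
  then show False using assms(1) by (auto intro: poly_mapping_eqI)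
qed

lemma subtraction_free_nonzero: "subtraction_free f \<Longrightarrow> f \<noteq> 0"
  by (auto simp: subtraction_free_def Zero_fract_def eq_fract)

lemma subtraction_free_mult: "subtraction_free f \<Longrightarrow> subtraction_free g \<Longrightarrow> subtraction_free (f * g)"
  unfolding subtraction_free_def
  by (elim exE conjE, rule_tac x = "p * pa" in exI, rule_tac x = "q * qa" in exI)
     (simp add: nat_coeffs_mult)

lemma subtraction_free_divide: "subtraction_free f \<Longrightarrow> subtraction_free g \<Longrightarrow> subtraction_free (f / g)"
  unfolding subtraction_free_def
  by (elim exE conjE, rule_tac x = "p * qa" in exI, rule_tac x = "q * pa" in exI)
     (simp add: nat_coeffs_mult)

lemma subtraction_free_add: "subtraction_free f \<Longrightarrow> subtraction_free g \<Longrightarrow> subtraction_free (f + g)"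
  unfolding subtraction_free_def
  by (elim exE conjE, rule_tac x = "p * qa + pa * q" in exI, rule_tac x = "q * qa" in exI)
     (simp add: nat_coeffs_mult nat_coeffs_add_neq_0 lookup_add)

lemma subtraction_free_rvar: "subtraction_free (rvar i)"
  unfolding subtraction_free_def rvar_def
proof (intro exI conjI)
  show "Poly_Mapping.single (Poly_Mapping.single i 1) (1::'a) \<noteq> 0"
    by (metis lookup_single_eq lookup_zero zero_neq_one)
qed (auto simp: lookup_single lookup_one when_def)

lemma subtraction_free_1: "subtraction_free 1"
  unfolding subtraction_free_def One_fract_def
  by (rule exI[of _ 1], rule exI[of _ 1]) (auto simp: lookup_one when_def)

lemma subtraction_free_prod:
  "(\<And>i. i \<in> A \<Longrightarrow> subtraction_free (f i)) \<Longrightarrow> subtraction_free (prod f A)"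
  by (induction A rule: infinite_finite_induct) (auto simp: subtraction_free_1 subtraction_free_mult)

lemma subtraction_free_power: "subtraction_free f \<Longrightarrow> subtraction_free (f ^ k)"
  by (induction k) (auto simp: subtraction_free_1 subtraction_free_mult)

lemma cluster_seed_subtraction_free:
  "cluster_seed n q0 x q \<Longrightarrow> subtraction_free (x i)"
proof (induction arbitrary: i rule: cluster_seed.induct)
  case (mutate x q k)
  then show ?case
    by (auto simp: cluster_mutate_def intro!: subtraction_free_divide subtraction_free_add
        subtraction_free_prod subtraction_free_power)
qed (rule subtraction_free_rvar)

section \<open>Generators of the cluster algebra\<close>

lemma frieze_w_seq: "n \<ge> 2 \<Longrightarrow> frieze n (w_seq n)"
  by unfold_locales (auto simp: w_seq_def)

lemma prod_of_bool_power:
  assumes "m \<le> (n::nat)"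
  shows "(\<Prod>i\<le>n. x i ^ of_bool (i = m)) = (x m :: 'a::comm_monoid_mult)"
proof -
  have "(\<Prod>i\<le>n. x i ^ of_bool (i = m)) = (\<Prod>i\<le>n. if i = m then x i else 1)"
    by (intro prod.cong refl) auto
  then show ?thesis using assms by (simp add: prod.delta)
qed

theorem cluster_algebra_P1:
  assumes n: "n \<ge> 3"
  shows "cluster_algebra n (quiver_P1 n) =
    (gen_subalgebra (frieze_gens n (w_seq n)) :: 'k::field_char_0 ratfun set)"
proof
  have n2: "n \<ge> 2" using n by simp
  interpret frieze n "w_seq n :: nat \<Rightarrow> 'k ratfun" by (rule frieze_w_seq[OF n2])
  have "seed_realized x q" if "cluster_seed n (quiver_P1 n) x q" for x :: "nat \<Rightarrow> 'k ratfun" and q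
    using that
  proof induction
    case initial
    have "w_seq n k = rvar k" if "k \<le> n" for k using that by (simp add: w_seq_def)
    then show ?case
      using initial_seed_realized unfolding seed_realized_def by metis
  next
    case (mutate x q k)
    show ?case
      using mutate cluster_seed_subtraction_free subtraction_free_nonzero
      by (intro seed_realized_mutate) blast+
  qed
  then have "x i \<in> gen_subalgebra (frieze_gens n (w_seq n))"
    if "cluster_seed n (quiver_P1 n) x q" "i \<le> n" for x :: "nat \<Rightarrow> 'k ratfun" and q i
    using that lam_in by (fastforce simp: seed_realized_def)
  then show "cluster_algebra n (quiver_P1 n) \<subseteq> (gen_subalgebra (frieze_gens n (w_seq n)) :: 'k ratfun set)"
    unfolding cluster_algebra_def by (intro gen_subalgebra_least) auto
next
  let ?A = "cluster_algebra n (quiver_P1 n) :: 'k ratfun set" and ?q = "quiver_P1 n"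
  have var: "x i \<in> ?A" if "cluster_seed n ?q x q" "i \<le> n" for x q i
    unfolding cluster_algebra_def using that by (intro gen_subalgebra.gen) auto
  have init: "rvar i \<in> ?A" if "i \<le> n" for i
    using var[OF cluster_seed.initial that] .
  have X: "X_of (w_seq n) i \<in> ?A" if i: "1 \<le> i" "i < n" for i
  proof -
    have "?q l i = of_bool (l = i - 1)" "?q i l = of_bool (l = i + 1)" for l
      using i by (auto simp: quiver_P1_def)
    then have "cluster_mutate n i ?q rvar i = (rvar (i - 1) + rvar (i + 1)) / (rvar i :: 'k ratfun)"
      using i by (simp add: cluster_mutate_def prod_of_bool_power)
    also have "\<dots> = X_of (w_seq n) i"
      using i by (auto simp: X_of_def w_seq_def divide_inverse mult.commute)
    finally show ?thesis
      using var[OF cluster_seed.mutate[OF cluster_seed.initial, of i], of i] i by simp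
  qed
  let ?x = "cluster_mutate n 0 ?q rvar :: nat \<Rightarrow> 'k ratfun" and ?q' = "quiver_mutate 0 ?q"
  have x: "?x = rvar(0 := w_seq n (n + 1))"
  proof -
    have "?q l 0 = 0" "?q 0 l = of_bool (l = 1) + of_bool (l = n)" for l
      using n by (auto simp: quiver_P1_def)
    then show ?thesis
      using n by (simp add: cluster_mutate_def power_add prod.distrib prod_of_bool_power w_seq_def)
  qed
  have seed: "cluster_seed n ?q ?x ?q'"
    by (rule cluster_seed.mutate[OF cluster_seed.initial]) simp
  have "?q' l n = of_bool (l = n - 1)" "?q' n l = of_bool (l = 0)" for l
    using n by (auto simp: quiver_P1_def quiver_mutate_def)
  then have "cluster_mutate n n ?q' ?x n = (?x (n - 1) + ?x 0) / ?x n"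
    by (simp add: cluster_mutate_def prod_of_bool_power)
  also have "\<dots> = X_of (w_seq n) n"
    using n by (auto simp: x X_of_def w_seq_def divide_inverse mult.commute add.commute)
  finally have "X_of (w_seq n) n \<in> ?A"
    using var[OF cluster_seed.mutate[OF seed, of n], of n] by simp
  with X have "X_of (w_seq n) i \<in> ?A" if "1 \<le> i" "i \<le> n" for i
    using that by (cases "i = n") auto
  then have "frieze_gens n (w_seq n) \<subseteq> ?A"
    using init[of 0] init[of 1] n by (auto simp: frieze_gens_def w_seq_def)
  then show "gen_subalgebra (frieze_gens n (w_seq n)) \<subseteq> ?A"
    unfolding cluster_algebra_def by (rule gen_subalgebra_least)
qed

section \<open>Brackets of the generators\<close>

definition frieze_gen :: "(nat \<Rightarrow> 'k::field ratfun) \<Rightarrow> nat \<Rightarrow> 'k ratfun" where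
  "frieze_gen a k = (if k \<le> 1 then a k else X_of a (k - 1))"

definition bracket_table :: "nat \<Rightarrow> (nat \<Rightarrow> 'k::field ratfun) \<Rightarrow> nat \<Rightarrow> nat \<Rightarrow> 'k ratfun" where
  "bracket_table n G k l =
    (if k = 0 \<and> l = 1 then G 0 * G 1
     else if k = 0 then (if odd l then G 0 * G l else - (G 0 * G l)) + (if l = n + 1 then 2 * G 1 else 0)
     else if k = 1 \<and> l = 2 then G 1 * G 2 - 2 * G 0
     else if k = 1 then (if even l then G 1 * G l else - (G 1 * G l))
     else if even (l - k) then (if k = 2 \<and> l = n + 1 then 2 else 0) - 2 * (G k * G l)
     else 2 * (G k * G l) - (if l = k + 1 then 2 else 0))"

lemma frieze_gens_eq: "n \<ge> 1 \<Longrightarrow> frieze_gens n a = frieze_gen a ` {..n + 1}"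
proof -
  assume "n \<ge> 1"
  have "(\<lambda>i. frieze_gen a (Suc i)) ` {1..n} = X_of a ` {1..n}"
    by (intro image_cong refl) (auto simp: frieze_gen_def)
  moreover have "{..n + 1} = {0, 1} \<union> Suc ` {1..n}"
    using \<open>n \<ge> 1\<close> by (auto simp: image_iff Suc_le_eq)
  then have "frieze_gen a ` {..n + 1} = {a 0, a 1} \<union> (\<lambda>i. frieze_gen a (Suc i)) ` {1..n}"
    by (simp only: image_Un image_image) (simp add: frieze_gen_def)
  ultimately show ?thesis by (simp only: frieze_gens_def)
qed

lemma bracket_table_in:
  assumes "n \<ge> 1" "k < l" "l \<le> n + 1"
  shows "bracket_table n (frieze_gen a) k l \<in> gen_subalgebra (frieze_gens n a)"
proof -
  have "frieze_gen a i \<in> gen_subalgebra (frieze_gens n a)" if "i \<le> n + 1" for i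
    using that assms(1) by (intro gen_subalgebra.gen) (auto simp: frieze_gens_eq)
  note this[of 0] this[of 1] this[of 2] this[of k] this[of l]
  then show ?thesis
    using assms
    by (simp add: bracket_table_def gen_subalgebra_intros del: One_nat_def)
qed

locale frieze_bracket = biderivation br for br :: "'k::field ratfun \<Rightarrow> _" +
  fixes n :: nat and a :: "nat \<Rightarrow> 'k ratfun"
  assumes n: "n \<ge> 3" "odd n"
    and a_nz: "i \<le> n \<Longrightarrow> a i \<noteq> 0"
    and br_odd: "i < j \<Longrightarrow> j \<le> n + 1 \<Longrightarrow> odd (j - i) \<Longrightarrow> br (a i) (a j) = a i * a j"
    and br_even: "i < j \<Longrightarrow> j \<le> n + 1 \<Longrightarrow> even (j - i) \<Longrightarrow> j - i < n + 1 \<Longrightarrow> br (a i) (a j) = 0"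
    and br_ends: "br (a 0) (a (n + 1)) = 2 * a 1 * a n"
begin

abbreviation "Xa \<equiv> X_of a"

lemma X_mult: "1 \<le> i \<Longrightarrow> i \<le> n \<Longrightarrow> a (i - 1) + a (i + 1) = Xa i * a i"
  using a_nz[of i] by (simp add: X_of_def)

lemma br_X_right:
  assumes "1 \<le> i" "i \<le> n"
  shows "br h (Xa i) = (br h (a (i - 1)) + br h (a (i + 1)) - br h (a i) * Xa i) / a i"
  using a_nz[of i] assms
  by (simp add: X_of_def mult_right inverse_right add_right) (simp add: field_simps)

lemma br_X_left:
  assumes "1 \<le> i" "i \<le> n"
  shows "br (Xa i) h = (br (a (i - 1)) h + br (a (i + 1)) h - br (a i) h * Xa i) / a i"
  using br_X_right[OF assms, of h] skew[of _ h] a_nz[of i] assms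
  by (simp add: field_simps)

lemma br_a_X_even:
  assumes "j < i" "i \<le> n" "even (i - j)"
  shows "br (a j) (Xa i) = a j * Xa i"
proof -
  have "j < i - 1" using assms by (cases "j = i - 1") auto
  then have "br (a j) (Xa i) = (a j * a (i - 1) + a j * a (i + 1)) / a i"
    using assms br_odd[of j "i - 1"] br_odd[of j "i + 1"] br_even[of j i]
    by (simp add: br_X_right Suc_diff_le)
  also have "\<dots> = a j * (Xa i * a i) / a i"
    using X_mult[of i] assms by (simp add: distrib_left [symmetric])
  finally show ?thesis using a_nz[of i] assms by simp
qed

lemma br_a_X_odd':
  assumes "j < i" "i \<le> n" "odd (i - j)"
  shows "br (a j) (Xa i) = (br (a j) (a (i + 1))) / a i - a j * Xa i"
proof -
  have "br (a j) (a (i - 1)) = 0"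
    using assms by (cases "j = i - 1") (auto intro!: br_even)
  then show ?thesis
    using assms br_odd[of j i] a_nz[of i] by (simp add: br_X_right field_simps)
qed

lemma br_a_X_odd:
  assumes "j < i" "i \<le> n" "odd (i - j)" "\<not> (j = 0 \<and> i = n)"
  shows "br (a j) (Xa i) = - (a j * Xa i)"
proof -
  have "even (i + 1 - j)" using assms by (simp add: Suc_diff_le)
  then have "br (a j) (a (i + 1)) = 0" using assms by (intro br_even) auto
  then show ?thesis using br_a_X_odd'[OF assms(1-3)] by simp
qed

lemma br_0_X_n: "br (a 0) (Xa n) = 2 * a 1 - a 0 * Xa n"
  using br_a_X_odd'[of 0 n] n br_ends a_nz[of n] by simp

lemma br_a_X_self:
  assumes "1 \<le> i" "i \<le> n"
  shows "br (a i) (Xa i) = a (i + 1) - a (i - 1)"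
proof -
  have "br (a i) (Xa i) = (a i * (a (i + 1) - a (i - 1))) / a i"
    using assms br_X_right[OF assms, of "a i"] br_odd[of "i - 1" i] br_odd[of i "i + 1"]
      skew[of "a i" "a (i - 1)"] by (simp add: algebra_simps)
  then show ?thesis using a_nz[of i] assms by simp
qed

lemma br_a_X_self':
  assumes "1 \<le> i" "i \<le> n"
  shows "br (a i) (Xa i) = a i * Xa i - 2 * a (i - 1)"
proof -
  have "a (i + 1) = Xa i * a i - a (i - 1)"
    using X_mult[OF assms] by (simp add: eq_diff_eq add.commute)
  then show ?thesis using br_a_X_self[OF assms] by (simp add: mult.commute)
qed

lemma br_X_X:
  assumes "1 \<le> i" "i < j" "j \<le> n"
  shows "br (Xa i) (Xa j) = (if even (j - i) then (if i = 1 \<and> j = n then 2 else 0) - 2 * (Xa i * Xa j)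
     else 2 * (Xa i * Xa j) - (if j = i + 1 then 2 else 0))"
proof (cases "even (j - i)")
  case True
  then have "i + 1 < j" using assms by (cases "j = i + 1") auto
  then have 1: "br (a (i + 1)) (Xa j) = - (a (i + 1) * Xa j)"
    using assms True by (intro br_a_X_odd) auto
  have 2: "br (a i) (Xa j) = a i * Xa j"
    using assms True by (intro br_a_X_even)
  show ?thesis
  proof (cases "i = 1 \<and> j = n")
    case True
    then have "br (Xa i) (Xa j) = (2 * a 1 - (a 0 + a 2) * Xa n - a 1 * Xa n * Xa 1) / a 1"
      using 1 2 assms br_0_X_n by (simp add: br_X_left algebra_simps numeral_2_eq_2)
    also have "a 0 + a 2 = Xa 1 * a 1"
      using X_mult[of 1] n by (simp add: numeral_2_eq_2)
    also have "2 * a 1 - Xa 1 * a 1 * Xa n - a 1 * Xa n * Xa 1 = (2 - 2 * (Xa 1 * Xa n)) * a 1"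
      by (simp add: algebra_simps)
    finally show ?thesis
      using a_nz[of 1] True \<open>even (j - i)\<close> n by simp
  next
    case False
    have "br (a (i - 1)) (Xa j) = - (a (i - 1) * Xa j)"
      using assms True False by (intro br_a_X_odd) auto
    then have "br (Xa i) (Xa j) = - ((a (i - 1) + a (i + 1)) * Xa j + a i * Xa j * Xa i) / a i"
      using 1 2 assms by (simp add: br_X_left algebra_simps)
    also have "(a (i - 1) + a (i + 1)) * Xa j + a i * Xa j * Xa i = 2 * (Xa i * Xa j) * a i"
      using X_mult[of i] assms by (simp add: algebra_simps)
    finally show ?thesis
      using assms False True a_nz[of i] by auto
  qed
next
  case False
  have 2: "br (a i) (Xa j) = - (a i * Xa j)"
    using assms False by (intro br_a_X_odd) auto
  have 3: "br (a (i - 1)) (Xa j) = a (i - 1) * Xa j"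
    using assms False by (intro br_a_X_even) (auto simp: Suc_diff_le)
  show ?thesis
  proof (cases "j = i + 1")
    case True
    have "br (a (i + 1)) (Xa j) = Xa j * a (i + 1) - 2 * a i"
      using br_a_X_self'[of j] assms True by (simp add: mult.commute)
    then have "br (Xa i) (Xa j) = ((a (i - 1) + a (i + 1)) * Xa j + a i * Xa j * Xa i - 2 * a i) / a i"
      using 2 3 assms by (simp add: br_X_left algebra_simps)
    also have "(a (i - 1) + a (i + 1)) * Xa j + a i * Xa j * Xa i - 2 * a i = (2 * (Xa i * Xa j) - 2) * a i"
      using X_mult[of i] assms by (simp add: algebra_simps)
    finally show ?thesis
      using assms False True a_nz[of i] by simp
  next
    case j: False
    have "br (a (i + 1)) (Xa j) = a (i + 1) * Xa j"
      using assms False j by (intro br_a_X_even) auto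
    then have "br (Xa i) (Xa j) = ((a (i - 1) + a (i + 1)) * Xa j + a i * Xa j * Xa i) / a i"
      using 2 3 assms by (simp add: br_X_left algebra_simps)
    also have "(a (i - 1) + a (i + 1)) * Xa j + a i * Xa j * Xa i = 2 * (Xa i * Xa j) * a i"
      using X_mult[of i] assms by (simp add: algebra_simps)
    finally show ?thesis
      using assms False j a_nz[of i] by simp
  qed
qed

lemma br_frieze_gen:
  assumes "k < l" "l \<le> n + 1"
  shows "br (frieze_gen a k) (frieze_gen a l) = bracket_table n (frieze_gen a) k l"
proof -
  consider "k = 0" "l = 1" | "k = 0" "l \<ge> 2" | "k = 1" "l = 2" | "k = 1" "l > 2" | "k \<ge> 2"
    using assms by linarith
  then show ?thesis
  proof cases
    case 1
    then show ?thesis using br_odd[of 0 1] n by (simp add: bracket_table_def frieze_gen_def)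
  next
    case 2
    show ?thesis
    proof (cases "even (l - 1)")
      case True
      then show ?thesis using 2 assms n br_a_X_even[of 0 "l - 1"]
        by (auto simp: bracket_table_def frieze_gen_def)
    next
      case False
      then show ?thesis using 2 assms n br_a_X_odd[of 0 "l - 1"] br_0_X_n
        by (auto simp: bracket_table_def frieze_gen_def)
    qed
  next
    case 3
    then show ?thesis using br_a_X_self'[of 1] n
      by (simp add: bracket_table_def frieze_gen_def)
  next
    case 4
    show ?thesis
    proof (cases "even (l - 1 - 1)")
      case True
      then show ?thesis using 4 assms n br_a_X_even[of 1 "l - 1"]
        by (auto simp: bracket_table_def frieze_gen_def)
    next
      case False
      then show ?thesis using 4 assms n br_a_X_odd[of 1 "l - 1"]
        by (auto simp: bracket_table_def frieze_gen_def)
    qed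
  next
    case 5
    have "l - 1 - (k - 1) = l - k" "l - 1 = k - 1 + 1 \<longleftrightarrow> l = k + 1" "k - 1 = 1 \<longleftrightarrow> k = 2"
      "l - 1 = n \<longleftrightarrow> l = n + 1" using 5 assms by auto
    then show ?thesis using 5 assms n br_X_X[of "k - 1" "l - 1"]
      by (simp add: bracket_table_def frieze_gen_def)
  qed
qed

lemma gens_closed:
  assumes "s \<in> frieze_gens n a" "t \<in> frieze_gens n a"
  shows "br s t \<in> gen_subalgebra (frieze_gens n a)"
proof -
  obtain k l where kl: "s = frieze_gen a k" "t = frieze_gen a l" "k \<le> n + 1" "l \<le> n + 1"
    using assms n by (auto simp: frieze_gens_eq)
  consider "k < l" | "k = l" | "l < k" by linarith
  then show ?thesis
  proof cases
    case 1
    then show ?thesis using kl n bracket_table_in[of n k l a] by (simp add: br_frieze_gen)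
  next
    case 3
    then show ?thesis using kl n bracket_table_in[of n l k a] skew[of s t]
      by (simp add: br_frieze_gen gen_subalgebra_uminus)
  qed (simp add: kl)
qed

lemmas algebra_closed = closed[OF gens_closed]

end

section \<open>The two brackets\<close>

lemma frieze_bracket_W:
  assumes "n \<ge> 3" "odd n"
  shows "frieze_bracket (W_bracket n) n (rvar :: nat \<Rightarrow> 'k::field ratfun)"
proof -
  interpret biderivation "W_bracket n :: 'k ratfun \<Rightarrow> _"
    unfolding W_bracket_def by (rule biderivation_gen_bracket)
  show ?thesis
    by unfold_locales (use assms in \<open>auto simp: W_bracket_def gen_bracket_rvar\<close>)
qed

interpretation w: biderivation "w_bracket n" for n
  unfolding w_bracket_def by (rule biderivation_gen_bracket)

lemma w_bracket_of_int [simp]: "w_bracket n f (of_int z) = 0"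
  using w.const_right[of n f "of_int z"] by (simp add: rconst_of_int)

definition w_coeff :: "nat \<Rightarrow> nat \<Rightarrow> int" where
  "w_coeff i j = (if even (i + j) then 0 else if i < j then 1 else - 1)"

lemma w_bracket_rvar:
  assumes "i \<le> n" "j \<le> n"
  shows "w_bracket n (rvar i) (rvar j) = of_int (w_coeff i j) * (rvar i * rvar j :: 'k::field ratfun)"
proof -
  have less: "w_bracket n (rvar i) (rvar j) = of_int (w_coeff i j) * (rvar i * rvar j :: 'k ratfun)"
    if "i < j" "j \<le> n" for i j
    using that unfolding w_bracket_def by (simp add: gen_bracket_rvar w_coeff_def)
  consider "i < j" | "i = j" | "j < i" by linarith
  then show ?thesis
  proof cases
    case 3
    then show ?thesis
      using less[of j i] assms w.skew[of n "rvar i :: 'k ratfun" "rvar j"] by (auto simp: w_coeff_def add.commute)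
  qed (use less assms in \<open>auto simp: w_coeff_def\<close>)
qed

lemma w_jacobi:
  assumes "f \<in> gen_subfield (rvar ` {..n})" "g \<in> gen_subfield (rvar ` {..n})" "h \<in> gen_subfield (rvar ` {..n})"
  shows "w.jacobiator n f g h = 0"
proof (rule w.jacobiator_vanishes[OF _ assms])
  fix s t u :: "'a ratfun"
  assume "s \<in> rvar ` {..n}" "t \<in> rvar ` {..n}" "u \<in> rvar ` {..n}"
  then obtain i j k where *: "s = rvar i" "t = rvar j" "u = rvar k" "i \<le> n" "j \<le> n" "k \<le> n" by auto
  have c: "w_bracket n f (of_int z * g) = of_int z * w_bracket n f g" for f g z
    by (simp add: w.mult_right)
  have "w_bracket n (rvar x) (w_bracket n (rvar y) (rvar z)) =
      of_int (w_coeff y z * (w_coeff x y + w_coeff x z)) * (rvar x * rvar y * rvar z :: 'a ratfun)"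
    if "x \<le> n" "y \<le> n" "z \<le> n" for x y z
    using that by (simp add: w_bracket_rvar c w.mult_right algebra_simps)
  then have "w.jacobiator n s t u = of_int (w_coeff j k * (w_coeff i j + w_coeff i k)
      + w_coeff k i * (w_coeff j k + w_coeff j i) + w_coeff i j * (w_coeff k i + w_coeff k j)) *
      (rvar i * rvar j * rvar k)"
    using * by (simp add: w.jacobiator_def algebra_simps)
  also have "w_coeff j k * (w_coeff i j + w_coeff i k)
      + w_coeff k i * (w_coeff j k + w_coeff j i) + w_coeff i j * (w_coeff k i + w_coeff k j) = 0"
  proof -
    have s: "w_coeff x y = - w_coeff y x" for x y by (auto simp: w_coeff_def add.commute)
    show ?thesis using s[of i j] s[of j k] s[of k i] by (simp add: algebra_simps)
  qed
  finally show "w.jacobiator n s t u = 0" by simp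
qed

lemma frieze_bracket_w:
  assumes n: "n \<ge> 3" "odd n"
  shows "frieze_bracket (w_bracket n) n (w_seq n :: nat \<Rightarrow> 'k::field ratfun)"
proof -
  let ?w = "w_seq n :: nat \<Rightarrow> 'k ratfun"
  have w: "?w i = rvar i" if "i \<le> n" for i using that by (simp add: w_seq_def)
  have last: "w_bracket n (rvar i) (?w (n + 1)) =
      of_int (w_coeff i 1 + w_coeff i n) * (rvar i * rvar 1 * rvar n) / rvar 0
      - of_int (w_coeff i 0) * (1 + rvar 1 * rvar n) * rvar i / rvar 0" if "i \<le> n" for i
  proof -
    have "?w (n + 1) = (1 + rvar 1 * rvar n) * inverse (rvar 0)"
      by (simp add: w_seq_def divide_inverse)
    then show ?thesis using that n
      by (simp add: w.mult_right w.add_right w.inverse_right w_bracket_rvar) (simp add: field_simps)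
  qed
  have wl: "?w (n + 1) = (1 + rvar 1 * rvar n) / rvar 0" by (simp add: w_seq_def)
  show ?thesis
  proof
    show "n \<ge> 3" "odd n" by fact+
    show "?w i \<noteq> 0" if "i \<le> n" for i using that by (simp add: w)
    show "w_bracket n (?w i) (?w j) = ?w i * ?w j" if "i < j" "j \<le> n + 1" "odd (j - i)" for i j
    proof (cases "j = n + 1")
      case True
      have "odd i" using that n True by (cases "even i") auto
      then have "w_coeff i 1 = 0" "w_coeff i n = 0" "w_coeff i 0 = - 1"
        using n by (auto simp: w_coeff_def elim: oddE)
      then have "w_bracket n (rvar i) (?w (n + 1)) = rvar i * ?w (n + 1)"
        using that True by (subst last) (simp_all add: wl [simplified] field_simps)
      then show ?thesis using True that w[of i] by simp
    next
      case False
      then show ?thesis using that by (simp add: w w_bracket_rvar w_coeff_def)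
    qed
    show "w_bracket n (?w i) (?w j) = 0" if "i < j" "j \<le> n + 1" "even (j - i)" "j - i < n + 1" for i j
    proof (cases "j = n + 1")
      case True
      have "even i" "i \<noteq> 0" "i < n" using that n True by (cases "even i"; cases "i = n"; auto)+
      then have "w_coeff i 1 = - 1" "w_coeff i n = 1" "w_coeff i 0 = 0"
        using n by (auto simp: w_coeff_def)
      then show ?thesis using True that last[of i] w[of i] by simp
    next
      case False
      then show ?thesis using that by (simp add: w w_bracket_rvar w_coeff_def)
    qed
    have "w_coeff 0 1 = 1" "w_coeff 0 n = 1" "w_coeff 0 0 = 0"
      using n by (auto simp: w_coeff_def)
    then show "w_bracket n (?w 0) (?w (n + 1)) = 2 * ?w 1 * ?w n"
      using last[of 0] n by (simp add: w)
  qed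
qed

section \<open>Poisson algebras of rational functions\<close>

lemma poisson_algebra_ratfun:
  assumes "biderivation br"
    and cl: "\<And>f g. f \<in> gen_subalgebra S \<Longrightarrow> g \<in> gen_subalgebra S \<Longrightarrow> br f g \<in> gen_subalgebra S"
    and jacobi: "\<And>f g h. f \<in> gen_subalgebra S \<Longrightarrow> g \<in> gen_subalgebra S \<Longrightarrow> h \<in> gen_subalgebra S \<Longrightarrow>
      br f (br g h) + br g (br h f) + br h (br f g) = 0"
  shows "poisson_algebra (ring_of_type_algebra :: 'k::field ring) (ratfun_poisson (gen_subalgebra S) br)"
    (is "poisson_algebra ?K ?P")
proof -
  interpret biderivation br by fact
  note simps = ratfun_poisson_def ring_of_type_algebra_def
  have ag: "abelian_group ?P"
    by (rule abelian_groupI)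
       (auto simp: simps intro: gen_subalgebra.add gen_subalgebra_uminus exI[of _ "- x" for x]
         intro!: bexI[of _ "- x" for x])
  have cm: "Group.comm_monoid ?P"
    by (rule comm_monoidI) (auto simp: simps intro: gen_subalgebra.mult)
  have "cring ?P"
    by (rule cringI[OF ag cm]) (auto simp: simps algebra_simps)
  moreover have "module ?K ?P"
    by (rule moduleI[OF _ ag])
       (auto simp: simps rconst_add rconst_mult algebra_simps
         intro: gen_subalgebra.mult gen_subalgebra.const
           cring_from_type_algebra[unfolded ring_of_type_algebra_def])
  ultimately have "algebra ?K ?P"
    by (intro algebra.intro algebra_axioms.intro) (auto simp: simps)
  moreover have "br f (g * h) = br f g * h + g * br f h" for f g h
    by (simp add: mult_right add.commute)
  moreover have "br (rconst c * f) g = rconst c * br f g" "br f (rconst c * g) = rconst c * br f g" for c f g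
    by (simp_all add: mult_left mult_right)
  ultimately show ?thesis
    by (intro poisson_algebra.intro poisson_algebra_axioms.intro)
       (auto simp: simps cl add_left add_right intro: jacobi)
qed

lemma frieze_gens_w_subfield:
  assumes "n \<ge> 1"
  shows "gen_subalgebra (frieze_gens n (w_seq n)) \<subseteq> gen_subfield (rvar ` {..n})"
proof (rule gen_subalgebra_subset_subfield)
  have v: "rvar i \<in> gen_subfield (rvar ` {..n})" if "i \<le> n" for i
    using that by (auto intro: gen_subfield.gen)
  have "1 \<in> gen_subfield (rvar ` {..n})"
    using gen_subfield.const[of 1] by simp
  then have w: "w_seq n i \<in> gen_subfield (rvar ` {..n})" for i
    using assms v by (auto simp: w_seq_def divide_inverse intro!: gen_subfield.intros(3-5))
  then show "frieze_gens n (w_seq n) \<subseteq> gen_subfield (rvar ` {..n})"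
    by (auto simp: frieze_gens_def X_of_def simp del: One_nat_def intro!: gen_subfield.intros(3-5))
qed

section \<open>The evaluation homomorphism from J\<close>

lemma (in coeff_hom) ev_X_of:
  assumes "regular c y (a i)" "regular c y (a (i - 1))" "regular c y (a (i + 1))" "ev c y (a i) \<noteq> 0"
  shows "regular c y (X_of a i)"
    "ev c y (X_of a i) = inverse (ev c y (a i)) * (ev c y (a (i - 1)) + ev c y (a (i + 1)))"
  unfolding X_of_def using assms by (simp_all add: ev_mult ev_add ev_inverse)

lemma (in coeff_hom) regular_frieze_gens:
  assumes "\<And>i. i \<le> n \<Longrightarrow> y i \<noteq> 0" "s \<in> frieze_gens n rvar"
  shows "regular c y s"
  using assms by (auto simp: frieze_gens_def intro!: ev_X_of)

lemma (in coeff_hom) regular_J: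
  assumes "\<And>i. i \<le> n \<Longrightarrow> y i \<noteq> 0" "f \<in> gen_subalgebra (frieze_gens n rvar)"
  shows "regular c y f"
  by (rule regular_gen_subalgebra[OF regular_frieze_gens[OF assms(1)] assms(2)]) auto

interpretation r: coeff_hom rconst
  by unfold_locales (simp_all add: rconst_add rconst_mult)

abbreviation rconst_ac :: "'k::field \<Rightarrow> 'k ratfun alg_closure" where
  "rconst_ac c \<equiv> to_ac (rconst c)"

interpretation ac: coeff_hom rconst_ac
  by unfold_locales (simp_all add: rconst_add rconst_mult)

definition phi :: "nat \<Rightarrow> 'k::field ratfun \<Rightarrow> 'k ratfun" where
  "phi n = ev rconst (w_seq n)"

lemma w_seq_nonzero: "i \<le> n \<Longrightarrow> w_seq n i \<noteq> 0"
  by (simp add: w_seq_def)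

context
  fixes n :: nat
begin

lemma phi_regular:
  "f \<in> gen_subalgebra (frieze_gens n rvar) \<Longrightarrow> regular rconst (w_seq n) f"
  by (rule r.regular_J) (rule w_seq_nonzero)

lemma phi_simps:
  assumes "f \<in> gen_subalgebra (frieze_gens n rvar)" "g \<in> gen_subalgebra (frieze_gens n rvar)"
  shows "phi n (f + g) = phi n f + phi n g" "phi n (f * g) = phi n f * phi n g"
    "phi n (f - g) = phi n f - phi n g"
  using phi_regular[OF assms(1)] phi_regular[OF assms(2)]
  by (simp_all add: phi_def r.ev_add r.ev_mult r.ev_diff)

lemma phi_rconst [simp]: "phi n (rconst c) = rconst c"
  by (simp add: phi_def)

lemma phi_0_1 [simp]: "phi n 0 = 0" "phi n 1 = 1"
  by (simp_all add: phi_def r.ev_0_1)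

lemma phi_rvar [simp]: "phi n (rvar i) = w_seq n i"
  by (simp add: phi_def)

lemma phi_X:
  assumes "1 \<le> i" "i \<le> n"
  shows "phi n (X_of rvar i) = X_of (w_seq n) i"
  unfolding phi_def using assms by (subst r.ev_X_of) (auto simp: w_seq_nonzero X_of_def)

lemma phi_frieze_gen: "k \<le> n + 1 \<Longrightarrow> phi n (frieze_gen rvar k) = frieze_gen (w_seq n) k"
  by (simp add: frieze_gen_def phi_X)

lemma phi_in:
  assumes "f \<in> gen_subalgebra (frieze_gens n rvar)"
  shows "phi n f \<in> gen_subalgebra (frieze_gens n (w_seq n))"
  unfolding phi_def
proof (rule r.ev_in_gen_subalgebra[OF _ _ _ _ _ assms])
  show "regular rconst (w_seq n) s" if "s \<in> frieze_gens n rvar" for s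
    by (rule phi_regular) (rule gen_subalgebra.gen[OF that])
  show "ev rconst (w_seq n) s \<in> gen_subalgebra (frieze_gens n (w_seq n))" if "s \<in> frieze_gens n rvar" for s
    unfolding phi_def [symmetric] using that
    by (intro gen_subalgebra.gen) (auto simp: frieze_gens_def phi_X)
qed (auto intro: gen_subalgebra.intros)

lemma phi_surj:
  assumes "f \<in> gen_subalgebra (frieze_gens n (w_seq n))"
  shows "\<exists>g\<in>gen_subalgebra (frieze_gens n rvar). phi n g = f"
  using assms
proof induction
  case (const c)
  show ?case by (rule bexI[of _ "rconst c"]) (auto intro: gen_subalgebra.const)
next
  case (gen f)
  then have "\<exists>g\<in>frieze_gens n rvar. phi n g = f"
    by (auto simp: frieze_gens_def phi_X)
  then show ?case by (auto intro: gen_subalgebra.gen)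
next
  case (add f g)
  then show ?case by (metis gen_subalgebra.add phi_simps(1))
next
  case (mult f g)
  then show ?case by (metis gen_subalgebra.mult phi_simps(2))
qed

lemma phi_bracket_table:
  assumes "n \<ge> 1" "k < l" "l \<le> n + 1"
  shows "phi n (bracket_table n (frieze_gen rvar) k l) =
    (bracket_table n (frieze_gen (w_seq n)) k l :: 'k::field ratfun)"
proof -
  let ?J = "gen_subalgebra (frieze_gens n (rvar :: nat \<Rightarrow> 'k ratfun))"
  have G: "frieze_gen rvar i \<in> ?J" if "i \<le> n + 1" for i
    using that assms(1) by (intro gen_subalgebra.gen) (auto simp: frieze_gens_eq)
  have two: "phi n 2 = (2 :: 'k ratfun)"
    using phi_rconst[of 2] unfolding rconst_numeral .
  note Gs = G[of 0] G[of 1] G[of 2] G[of k] G[of l]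
  have um: "phi n (- f) = - phi n f" if "f \<in> ?J" for f
    using phi_simps(3)[OF gen_subalgebra_0 that] by simp
  show ?thesis
    unfolding bracket_table_def
    using assms Gs
    by (simp add: phi_simps um two phi_frieze_gen gen_subalgebra_intros if_distrib[of "phi n"]
        del: One_nat_def cong: if_cong)
qed

lemma phi_bracket:
  fixes f g :: "'k::field ratfun"
  assumes n: "n \<ge> 3" "odd n"
    and f: "f \<in> gen_subalgebra (frieze_gens n rvar)" and g: "g \<in> gen_subalgebra (frieze_gens n rvar)"
  shows "phi n (W_bracket n f g) = w_bracket n (phi n f) (phi n g)"
proof -
  interpret W: frieze_bracket "W_bracket n" n "rvar :: nat \<Rightarrow> 'k ratfun"
    by (rule frieze_bracket_W[OF n])
  interpret fw: frieze_bracket "w_bracket n" n "w_seq n :: nat \<Rightarrow> 'k ratfun"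
    by (rule frieze_bracket_w[OF n])
  have n1: "n \<ge> 1" using n by simp
  show ?thesis
    unfolding phi_def
  proof (rule ev_bracket[OF r.coeff_hom_axioms W.biderivation_axioms w.biderivation_axioms _ _ W.gens_closed _ f g])
    show "regular rconst (w_seq n) s" if "s \<in> frieze_gens n rvar" for s :: "'k ratfun"
      by (rule phi_regular) (rule gen_subalgebra.gen[OF that])
    show "ev rconst (w_seq n) (W_bracket n s t) = w_bracket n (ev rconst (w_seq n) s) (ev rconst (w_seq n) t)"
      if st: "s \<in> frieze_gens n rvar" "t \<in> frieze_gens n rvar" for s t :: "'k ratfun"
      unfolding phi_def [symmetric]
    proof -
      obtain k l where kl: "s = frieze_gen rvar k" "t = frieze_gen rvar l" "k \<le> n + 1" "l \<le> n + 1"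
        using st n1 by (auto simp: frieze_gens_eq)
      have less: "phi n (W_bracket n (frieze_gen rvar k) (frieze_gen rvar l)) =
          w_bracket n (phi n (frieze_gen rvar k)) (phi n (frieze_gen rvar l :: 'k ratfun))"
        if "k < l" "l \<le> n + 1" for k l
        using that W.br_frieze_gen[OF that] fw.br_frieze_gen[OF that] n1
        by (simp add: phi_bracket_table phi_frieze_gen)
      consider "k < l" | "k = l" | "l < k" by linarith
      then show "phi n (W_bracket n s t) = w_bracket n (phi n s) (phi n t)"
      proof cases
        case 3
        have "phi n (- W_bracket n t s) = - phi n (W_bracket n t s)"
          using phi_simps(3)[OF gen_subalgebra_0 W.gens_closed[OF st(2,1)]] by simp
        then show ?thesis
          using less[OF 3 kl(3)] kl W.skew[of s t] w.skew[of n "phi n s" "phi n t"] by simp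
      qed (use less kl in auto)
    qed
  qed auto
qed

end

section \<open>The kernel of the evaluation\<close>

context
  fixes n :: nat
  assumes n3: "n \<ge> 3"
begin

abbreviation J where "J \<equiv> gen_subalgebra (frieze_gens n (rvar :: nat \<Rightarrow> 'k::field_char_0 ratfun))"

definition J_deg :: "nat \<Rightarrow> 'k::field_char_0 ratfun set" where
  "J_deg d = {f \<in> J. \<forall>y t. t \<noteq> 0 \<longrightarrow> (\<forall>i\<le>n. y i \<noteq> 0) \<longrightarrow>
     ev rconst_ac (\<lambda>i. t * y i) f = t ^ d * ev rconst_ac y f}"

lemma J_rvar: "i \<le> n + 1 \<Longrightarrow> rvar i \<in> J"
  by (rule frieze_gens_seq) auto

lemma J_X: "1 \<le> i \<Longrightarrow> i \<le> n \<Longrightarrow> X_of rvar i \<in> J"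
  by (rule gen_subalgebra.gen) (auto simp: frieze_gens_def)

lemma J_regular:
  assumes "f \<in> J" "\<And>i. i \<le> n \<Longrightarrow> y i \<noteq> 0"
  shows "regular (rconst_ac :: 'k::field_char_0 \<Rightarrow> _) y f"
  by (rule ac.regular_J[OF _ assms(1)]) (rule assms(2))

lemma J_degI:
  assumes "f \<in> J"
    "\<And>y t. t \<noteq> 0 \<Longrightarrow> (\<And>i. i \<le> n \<Longrightarrow> y i \<noteq> 0) \<Longrightarrow> ev rconst_ac (\<lambda>i. t * y i) f = t ^ d * ev rconst_ac y f"
  shows "f \<in> J_deg d"
  using assms by (simp add: J_deg_def)

lemma J_degD:
  assumes "f \<in> J_deg d"
  shows "f \<in> J"
    "t \<noteq> 0 \<Longrightarrow> (\<And>i. i \<le> n \<Longrightarrow> y i \<noteq> 0) \<Longrightarrow> ev rconst_ac (\<lambda>i. t * y i) f = t ^ d * ev rconst_ac y f"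
  using assms by (simp_all add: J_deg_def)

lemma J_deg_add:
  assumes "f \<in> J_deg d" "g \<in> J_deg d"
  shows "f + g \<in> J_deg d"
proof (rule J_degI)
  fix y :: "nat \<Rightarrow> 'a ratfun alg_closure" and t :: "'a ratfun alg_closure"
  assume *: "t \<noteq> 0" "\<And>i. i \<le> n \<Longrightarrow> y i \<noteq> 0"
  then show "ev rconst_ac (\<lambda>i. t * y i) (f + g) = t ^ d * ev rconst_ac y (f + g)"
    using J_degD[OF assms(1)] J_degD[OF assms(2)] J_regular[of f] J_regular[of g]
    by (simp add: ac.ev_add distrib_left)
qed (use assms J_degD(1) gen_subalgebra.add in blast)

lemma J_deg_mult:
  assumes "f \<in> J_deg d" "g \<in> J_deg d'"
  shows "f * g \<in> J_deg (d + d')"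
proof (rule J_degI)
  fix y :: "nat \<Rightarrow> 'a ratfun alg_closure" and t :: "'a ratfun alg_closure"
  assume *: "t \<noteq> 0" "\<And>i. i \<le> n \<Longrightarrow> y i \<noteq> 0"
  then show "ev rconst_ac (\<lambda>i. t * y i) (f * g) = t ^ (d + d') * ev rconst_ac y (f * g)"
    using J_degD[OF assms(1)] J_degD[OF assms(2)] J_regular[of f] J_regular[of g]
    by (simp add: ac.ev_mult power_add mult_ac)
qed (use assms J_degD(1) gen_subalgebra.mult in blast)

lemma J_deg_rconst: "rconst c \<in> J_deg 0"
  by (rule J_degI) (auto intro: gen_subalgebra.const)

lemma J_deg_0: "0 \<in> J_deg d"
  by (rule J_degI) (auto simp: ac.ev_0_1)

lemma J_deg_rvar: "i \<le> n + 1 \<Longrightarrow> rvar i \<in> J_deg 1"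
  by (rule J_degI) (auto intro: J_rvar)

lemma J_deg_X: "1 \<le> i \<Longrightarrow> i \<le> n \<Longrightarrow> X_of rvar i \<in> J_deg 0"
proof (rule J_degI)
  fix y :: "nat \<Rightarrow> 'a ratfun alg_closure" and t :: "'a ratfun alg_closure"
  assume *: "t \<noteq> 0" "\<And>i. i \<le> n \<Longrightarrow> y i \<noteq> 0" "1 \<le> i" "i \<le> n"
  then show "ev rconst_ac (\<lambda>i. t * y i) (X_of rvar i) = t ^ 0 * ev rconst_ac y (X_of rvar i)"
    by (simp add: ac.ev_X_of distrib_left [symmetric] mult_ac)
qed (auto intro: J_X)

definition Q_elt :: "'k::field_char_0 ratfun" where
  "Q_elt = rvar 0 * rvar (n + 1) - rvar 1 * rvar n"

lemma Delta_Q: "elt_Delta n = Q_elt - 1"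
  by (simp add: elt_Delta_def Q_elt_def)

lemma J_deg_Q: "Q_elt \<in> J_deg 2"
proof -
  have "rvar 0 * rvar (n + 1) \<in> J_deg (1 + 1)" "rvar 1 * rvar n \<in> J_deg (1 + 1)"
    by (intro J_deg_mult J_deg_rvar; simp)+
  moreover from this(2) have "rconst (- 1) * (rvar 1 * rvar n) \<in> J_deg (0 + 2)"
    by (intro J_deg_mult J_deg_rconst) (simp add: numeral_2_eq_2)
  ultimately have "rvar 0 * rvar (n + 1) + rconst (- 1) * (rvar 1 * rvar n) \<in> J_deg 2"
    by (intro J_deg_add) (simp_all add: numeral_2_eq_2)
  then show ?thesis by (simp add: Q_elt_def rconst_uminus)
qed

lemma Delta_in_J: "elt_Delta n \<in> J"
  unfolding Delta_Q by (intro gen_subalgebra_diff J_degD(1)[OF J_deg_Q] gen_subalgebra_1)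

text \<open>Modulo \<open>\<Delta>\<close> the degree of a homogeneous element can be raised by two, multiplying by \<open>\<Delta> + 1\<close>.\<close>

definition split_at :: "nat \<Rightarrow> 'k::field_char_0 ratfun \<Rightarrow> bool" where
  "split_at m f \<longleftrightarrow> (\<exists>E\<in>J_deg (2 * m). \<exists>F\<in>J_deg (2 * m + 1). \<exists>g\<in>J. f = E + F + elt_Delta n * g)"

lemma split_at_Suc:
  assumes "split_at m f"
  shows "split_at (Suc m) f"
proof -
  obtain E F g where *: "E \<in> J_deg (2 * m)" "F \<in> J_deg (2 * m + 1)" "g \<in> J"
    "f = E + F + elt_Delta n * g"
    using assms by (auto simp: split_at_def)
  have "Q_elt * E \<in> J_deg (2 * Suc m)" "Q_elt * F \<in> J_deg (2 * Suc m + 1)"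
    using J_deg_mult[OF J_deg_Q *(1)] J_deg_mult[OF J_deg_Q *(2)] by simp_all
  moreover have "g - E - F \<in> J"
    using *(3) J_degD(1)[OF *(1)] J_degD(1)[OF *(2)] by (simp add: gen_subalgebra_diff)
  moreover have "f = Q_elt * E + Q_elt * F + elt_Delta n * (g - E - F)"
    unfolding *(4) Delta_Q by (simp add: algebra_simps)
  ultimately show ?thesis unfolding split_at_def by blast
qed

lemma split_at_mono:
  assumes "split_at m f" "m \<le> m'"
  shows "split_at m' f"
  using assms(2,1) by (induction rule: dec_induct) (auto intro: split_at_Suc)

lemma split_exists:
  assumes "f \<in> J"
  shows "\<exists>m. split_at m f"
  using assms
proof induction
  case (const c)
  have "split_at 0 (rconst c)"
    unfolding split_at_def using J_deg_rconst[of c] J_deg_0[of 1] gen_subalgebra_0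
    by (intro bexI[of _ "rconst c"] bexI[of _ 0]) auto
  then show ?case ..
next
  case (gen f)
  then consider "f = rvar 0 \<or> f = rvar 1" | i where "1 \<le> i" "i \<le> n" "f = X_of rvar i"
    by (auto simp: frieze_gens_def)
  then have "split_at 0 f"
  proof cases
    case 1
    then have "f \<in> J_deg 1" using J_deg_rvar[of 0] J_deg_rvar[of 1] by auto
    then show ?thesis
      unfolding split_at_def using J_deg_0[of 0] gen_subalgebra_0
      by (intro bexI[of _ f] bexI[of _ 0]) auto
  next
    case 2
    then have "f \<in> J_deg 0" using J_deg_X[of i] by auto
    then show ?thesis
      unfolding split_at_def using J_deg_0[of 1] gen_subalgebra_0
      by (intro bexI[of _ f] bexI[of _ 0]) auto
  qed
  then show ?case ..
next
  case (add f f')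
  then obtain m m' where "split_at m f" "split_at m' f'" by blast
  then have "split_at (max m m') f" "split_at (max m m') f'"
    by (auto intro: split_at_mono)
  then obtain E F g E' F' g' where *: "E \<in> J_deg (2 * max m m')" "F \<in> J_deg (2 * max m m' + 1)" "g \<in> J"
    "f = E + F + elt_Delta n * g" "E' \<in> J_deg (2 * max m m')" "F' \<in> J_deg (2 * max m m' + 1)" "g' \<in> J"
    "f' = E' + F' + elt_Delta n * g'"
    unfolding split_at_def by blast
  have "f + f' = (E + E') + (F + F') + elt_Delta n * (g + g')"
    using * by (simp add: algebra_simps)
  then have "split_at (max m m') (f + f')"
    unfolding split_at_def using * J_deg_add gen_subalgebra.add by blast
  then show ?case ..
next
  case (mult f f')
  then obtain m m' where "split_at m f" "split_at m' f'" by blast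
  then obtain E F g E' F' g' where *: "E \<in> J_deg (2 * m)" "F \<in> J_deg (2 * m + 1)" "g \<in> J"
    "f = E + F + elt_Delta n * g" "E' \<in> J_deg (2 * m')" "F' \<in> J_deg (2 * m' + 1)" "g' \<in> J"
    "f' = E' + F' + elt_Delta n * g'"
    unfolding split_at_def by blast
  let ?k = "m + m' + 1" and ?O = "E * F' + F * E'"
  have "E * E' \<in> J_deg (2 * m + 2 * m')" "F * F' \<in> J_deg (2 * m + 1 + (2 * m' + 1))"
    "E * F' \<in> J_deg (2 * m + (2 * m' + 1))" "F * E' \<in> J_deg (2 * m + 1 + 2 * m')"
    using * by (auto intro: J_deg_mult simp del: add_Suc_right)
  then have EE: "E * E' \<in> J_deg (2 * (m + m'))" and FF: "F * F' \<in> J_deg (2 * ?k)"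
    and O: "?O \<in> J_deg (2 * (m + m') + 1)"
    by (auto simp: algebra_simps intro!: J_deg_add)
  have "Q_elt * (E * E') + F * F' \<in> J_deg (2 * ?k)" "Q_elt * ?O \<in> J_deg (2 * ?k + 1)"
    using J_deg_mult[OF J_deg_Q EE] J_deg_mult[OF J_deg_Q O] FF by (auto intro: J_deg_add)
  moreover have "g * f' + (E + F) * g' - E * E' - ?O \<in> J"
    using * mult.hyps EE O J_degD(1)
    by (intro gen_subalgebra_diff gen_subalgebra.add gen_subalgebra.mult) blast+
  moreover have "f * f' = (Q_elt * (E * E') + F * F') + Q_elt * ?O
      + elt_Delta n * (g * f' + (E + F) * g' - E * E' - ?O)"
    unfolding *(4,8) Delta_Q by (simp add: algebra_simps)
  ultimately have "split_at ?k (f * f')"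
    unfolding split_at_def by blast
  then show ?case ..
qed

lemma ev_phi:
  fixes y :: "nat \<Rightarrow> 'k::field_char_0 ratfun alg_closure"
  assumes y: "\<And>i. i \<le> n \<Longrightarrow> y i \<noteq> 0" and Q: "y 0 * y (n + 1) - y 1 * y n = 1"
    and f: "f \<in> J"
  shows "regular rconst_ac y (phi n f) \<and> ev rconst_ac y (phi n f) = ev rconst_ac y f"
  using f
proof induction
  case (gen f)
  have w: "regular rconst_ac y (w_seq n i)" "ev rconst_ac y (w_seq n i) = y i" if "i \<le> n + 1" for i
  proof -
    have "w_seq n (n + 1) = (1 + rvar 1 * rvar n) * inverse (rvar 0 :: 'k ratfun)"
      by (simp add: w_seq_def divide_inverse)
    then have last: "regular rconst_ac y (w_seq n (n + 1))"
      "ev rconst_ac y (w_seq n (n + 1)) = (1 + y 1 * y n) * inverse (y 0)"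
      using y[of 0] by (simp_all add: ac.ev_mult ac.ev_add ac.ev_inverse ac.ev_0_1)
    have "(1 + y 1 * y n) * inverse (y 0) = y (n + 1)"
      unfolding Q[symmetric] using y[of 0] by simp
    then show "regular rconst_ac y (w_seq n i)" "ev rconst_ac y (w_seq n i) = y i"
      using last that by (cases "i = n + 1"; simp add: w_seq_def)+
  qed
  from gen consider "f = rvar 0 \<or> f = rvar 1" | i where "1 \<le> i" "i \<le> n" "f = X_of rvar i"
    by (auto simp: frieze_gens_def)
  then show ?case
  proof cases
    case 1
    then show ?thesis using w[of 0] w[of 1] by auto
  next
    case 2
    then show ?thesis
      using w[of i] w[of "i - 1"] w[of "i + 1"] y[of i] by (simp add: phi_X ac.ev_X_of)
  qed
next
  case (add f g)
  then show ?case
    using J_regular[OF add.hyps(1) y] J_regular[OF add.hyps(2) y]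
    by (simp add: phi_simps ac.ev_add)
next
  case (mult f g)
  then show ?case
    using J_regular[OF mult.hyps(1) y] J_regular[OF mult.hyps(2) y]
    by (simp add: phi_simps ac.ev_mult)
qed simp

lemma ev_generic:
  assumes "f \<in> J"
  shows "ev rconst_ac (\<lambda>i. to_ac (rvar i)) f = to_ac f"
  using assms
proof induction
  case (gen f)
  then show ?case by (auto simp: frieze_gens_def ac.ev_X_of) (simp add: X_of_def)
next
  case (add f g)
  then show ?case using J_regular[OF add.hyps(1)] J_regular[OF add.hyps(2)] by (simp add: ac.ev_add)
next
  case (mult f g)
  then show ?case using J_regular[OF mult.hyps(1)] J_regular[OF mult.hyps(2)] by (simp add: ac.ev_mult)
qed simp

lemma Q_elt_nonzero: "Q_elt \<noteq> (0 :: 'k::field_char_0 ratfun)"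
proof
  assume "Q_elt = (0 :: 'k ratfun)"
  then have "rvar 0 * rvar (n + 1) = (rvar 1 * rvar n :: 'k ratfun)" by (simp add: Q_elt_def)
  then have "rat_deriv (n + 1) (rvar 0 * rvar (n + 1)) = rat_deriv (n + 1) (rvar 1 * rvar n :: 'k ratfun)"
    by simp
  then show False using n3 by (simp add: rat_deriv_mult rat_deriv_var)
qed

text \<open>On homogeneous elements the evaluation is injective: rescaling the generic point by a square root
  of \<open>\<Delta> + 1\<close> moves it to the hypersurface \<open>\<Delta> = 0\<close>.\<close>

theorem kernel_phi:
  fixes f :: "'k::field_char_0 ratfun"
  assumes f: "f \<in> J" and 0: "phi n f = 0"
  shows "\<exists>g\<in>J. f = elt_Delta n * g"
proof -
  obtain m E F g where *: "E \<in> J_deg (2 * m)" "F \<in> J_deg (2 * m + 1)" "g \<in> J"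
    "f = E + F + elt_Delta n * g"
    using split_exists[OF f] by (auto simp: split_at_def)
  have EJ: "E \<in> J" "F \<in> J" using *(1,2) J_degD(1) by blast+
  define x :: "nat \<Rightarrow> 'k ratfun alg_closure" where "x = (\<lambda>i. to_ac (rvar i))"
  obtain s :: "'k ratfun alg_closure" where s: "s ^ 2 = to_ac Q_elt"
    using nth_root_exists[of 2 "to_ac Q_elt :: 'k ratfun alg_closure"] by auto
  then have s0: "s \<noteq> 0" using Q_elt_nonzero by auto
  define y where "y i = x i / s" for i
  have x_eq: "x = (\<lambda>i. s * y i)" using s0 by (auto simp: y_def)
  have y0: "y i \<noteq> 0" for i using s0 by (simp add: y_def x_def)
  have "y 0 * y (n + 1) - y 1 * y n = to_ac Q_elt / s ^ 2"
    by (simp add: y_def x_def Q_elt_def power2_eq_square diff_divide_distrib)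
  then have Qy: "y 0 * y (n + 1) - y 1 * y n = 1"
    using s s0 Q_elt_nonzero by simp
  have zero: "ev rconst_ac z E + ev rconst_ac z F = 0" if z: "\<And>i. z i \<noteq> 0" and Qz: "z 0 * z (n + 1) - z 1 * z n = 1"
    for z :: "nat \<Rightarrow> 'k ratfun alg_closure"
  proof -
    have "ev rconst_ac z (elt_Delta n) = 0"
      using Qz by (simp add: elt_Delta_def ac.ev_diff ac.ev_mult ac.ev_0_1)
    moreover have "ev rconst_ac z f = 0"
      using ev_phi[OF z Qz f] 0 by (simp add: ac.ev_0_1)
    moreover have r: "regular rconst_ac z h" if "h \<in> J" for h
      using J_regular[OF that] z by blast
    note r[OF EJ(1)] r[OF EJ(2)] r[OF *(3)] r[OF Delta_in_J]
    ultimately show ?thesis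
      unfolding *(4) by (simp add: ac.ev_add ac.ev_mult)
  qed
  have "ev rconst_ac (\<lambda>i. - 1 * y i) E = ev rconst_ac y E"
      "ev rconst_ac (\<lambda>i. - 1 * y i) F = - ev rconst_ac y F"
    using J_degD(2)[OF *(1), of "- 1" y] J_degD(2)[OF *(2), of "- 1" y] y0 by auto
  moreover have "ev rconst_ac (\<lambda>i. - 1 * y i) E + ev rconst_ac (\<lambda>i. - 1 * y i) F = 0"
    by (rule zero) (use y0 Qy in auto)
  ultimately have minus: "ev rconst_ac y E - ev rconst_ac y F = 0"
    by (simp only: diff_conv_add_uminus)
  have plus: "ev rconst_ac y E + ev rconst_ac y F = 0"
    by (rule zero) (use y0 Qy in auto)
  have "(2 :: 'k ratfun alg_closure) \<noteq> 0"
    using to_ac_eq_0_iff[of "2 :: 'k ratfun"] by simp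
  moreover have "2 * ev rconst_ac y E = (ev rconst_ac y E - ev rconst_ac y F) + (ev rconst_ac y E + ev rconst_ac y F)"
    by simp
  then have "2 * ev rconst_ac y E = 0" unfolding minus plus by simp
  ultimately have "ev rconst_ac y E = 0"
    by (simp only: mult_eq_0_iff simp_thms)
  with plus have "ev rconst_ac y F = 0 \<and> ev rconst_ac y E = 0" by simp
  then have "ev rconst_ac x E = 0" "ev rconst_ac x F = 0"
    using J_degD(2)[OF *(1) s0, of y] J_degD(2)[OF *(2) s0, of y] y0 unfolding x_eq by auto
  then have "E = 0" "F = 0"
    using ev_generic[OF EJ(1)] ev_generic[OF EJ(2)] unfolding x_def by simp_all
  then show ?thesis using * by auto
qed

lemma phi_Delta: "phi n (elt_Delta n) = (0 :: 'k::field_char_0 ratfun)"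
proof -
  have "phi n (elt_Delta n) = w_seq n 0 * w_seq n (n + 1) - w_seq n 1 * w_seq n n - (1 :: 'k ratfun)"
    using n3
    by (simp add: elt_Delta_def J_rvar phi_simps gen_subalgebra_intros del: One_nat_def)
  also have "\<dots> = 0" using n3 by (simp add: w_seq_def)
  finally show ?thesis .
qed

end

section \<open>Poisson ideals\<close>

inductive_set monoid_gen :: "'a::comm_monoid_mult set \<Rightarrow> 'a set" for S where
  one: "1 \<in> monoid_gen S"
| mult: "s \<in> S \<Longrightarrow> m \<in> monoid_gen S \<Longrightarrow> s * m \<in> monoid_gen S"

lemma monoid_gen_mult: "m \<in> monoid_gen S \<Longrightarrow> m' \<in> monoid_gen S \<Longrightarrow> m * m' \<in> monoid_gen S"
  by (induction rule: monoid_gen.induct) (auto simp: mult.assoc intro: monoid_gen.mult)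

lemma monoid_gen_gen: "s \<in> S \<Longrightarrow> s \<in> monoid_gen S"
  using monoid_gen.mult[OF _ monoid_gen.one] by fastforce

lemma monoid_gen_power: "m \<in> monoid_gen S \<Longrightarrow> m ^ k \<in> monoid_gen S"
  by (induction k) (auto intro: monoid_gen.one monoid_gen_mult)

lemma monoid_gen_insert:
  assumes "m \<in> monoid_gen (insert s S)"
  obtains u k where "u \<in> monoid_gen S" "m = u * s ^ k"
proof -
  have "\<exists>u\<in>monoid_gen S. \<exists>k. m = u * s ^ k"
    using assms
  proof induction
    case one
    show ?case by (rule bexI[of _ 1], rule exI[of _ 0]) (auto intro: monoid_gen.one)
  next
    case (mult t m)
    then obtain u k where u: "u \<in> monoid_gen S" "m = u * s ^ k" by blast
    show ?case
    proof (cases "t = s")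
      case True
      show ?thesis using u True by (intro bexI[of _ u] exI[of _ "Suc k"]) (simp_all add: mult_ac)
    next
      case False
      then show ?thesis using u mult.hyps
        by (intro bexI[of _ "t * u"] exI[of _ k]) (auto simp: mult_ac intro: monoid_gen.mult)
    qed
  qed
  then show ?thesis using that by blast
qed

locale frieze_poisson_ideal = frieze_bracket br n a
  for br :: "'k::field_char_0 ratfun \<Rightarrow> _" and n a +
  fixes I :: "'k ratfun set"
  assumes det_one: "a 0 * a (n + 1) - a 1 * a n = 1"
    and I_zero: "0 \<in> I"
    and I_add: "x \<in> I \<Longrightarrow> y \<in> I \<Longrightarrow> x + y \<in> I"
    and I_mult: "x \<in> I \<Longrightarrow> y \<in> gen_subalgebra (frieze_gens n a) \<Longrightarrow> y * x \<in> I"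
    and I_br: "x \<in> I \<Longrightarrow> y \<in> gen_subalgebra (frieze_gens n a) \<Longrightarrow> br x y \<in> I"
begin

abbreviation "B \<equiv> gen_subalgebra (frieze_gens n a)"

lemma a_in: "i \<le> n + 1 \<Longrightarrow> a i \<in> B"
  by (rule frieze_gens_seq) (use a_nz in auto)

lemma X_in: "1 \<le> i \<Longrightarrow> i \<le> n \<Longrightarrow> Xa i \<in> B"
  by (rule gen_subalgebra.gen) (auto simp: frieze_gens_def)

lemma I_diff: "x \<in> I \<Longrightarrow> y \<in> I \<Longrightarrow> x - y \<in> I"
  using I_add[of x "- 1 * y"] I_mult[of y "- 1"] gen_subalgebra_uminus[OF gen_subalgebra_1, of "frieze_gens n a"]
  by simp

lemma I_cancel_nat:
  assumes "of_nat (Suc k) * x \<in> I"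
  shows "x \<in> I"
proof -
  have "rconst (inverse (of_nat (Suc k))) * (of_nat (Suc k) * x) \<in> I"
    using assms by (rule I_mult) (rule gen_subalgebra.const)
  moreover have "rconst (inverse (of_nat (Suc k))) * of_nat (Suc k) = (1 :: 'k ratfun)"
  proof -
    have "inverse (of_nat (Suc k)) * of_nat (Suc k) = (1 :: 'k)"
      using of_nat_neq_0[of k, where 'a = 'k] by (rule left_inverse)
    then show ?thesis
      using rconst_mult[of "inverse (of_nat (Suc k)) :: 'k" "of_nat (Suc k)"]
      by (simp only: rconst_of_nat rconst_1)
  qed
  ultimately show ?thesis by (simp only: mult.assoc [symmetric] mult_1_left)
qed

lemma monomial_in:
  assumes "u \<in> monoid_gen (a ` {..<i})" "i \<le> n + 1"
  shows "u \<in> B"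
  using assms by induction (auto intro!: gen_subalgebra.mult a_in)

text \<open>The factor \<open>a 0\<close> absorbs the exceptional term of the bracket of \<open>a 0\<close> and \<open>X n\<close>.\<close>

lemma br_monomial_X:
  assumes "u \<in> monoid_gen (a ` {..<i})" "1 \<le> i" "i \<le> n"
  shows "\<exists>r\<in>B. a 0 * br u (Xa i) = r * u"
  using assms(1)
proof induction
  case one
  show ?case by (intro bexI[of _ 0]) auto
next
  case (mult s m)
  then obtain j where j: "s = a j" "j < i" by auto
  obtain r where r: "r \<in> B" "a 0 * br m (Xa i) = r * m" using mult by blast
  have "\<exists>r\<in>B. a 0 * br s (Xa i) = r * s"
  proof -
    consider "even (i - j)" | "odd (i - j)" "\<not> (j = 0 \<and> i = n)" | "j = 0" "i = n" by blast
    then show ?thesis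
    proof cases
      case 1
      then show ?thesis
        using j assms br_a_X_even[of j i]
        by (intro bexI[of _ "a 0 * Xa i"]) (auto intro!: gen_subalgebra.mult a_in X_in)
    next
      case 2
      then show ?thesis
        using j assms br_a_X_odd[of j i]
        by (intro bexI[of _ "- (a 0 * Xa i)"])
           (auto intro!: gen_subalgebra.mult a_in X_in gen_subalgebra_uminus)
    next
      case 3
      have "br s (Xa i) = 2 * a 1 - a 0 * Xa n" using br_0_X_n 3 j by simp
      moreover have "2 * a 1 - a 0 * Xa n \<in> B"
        using n by (intro gen_subalgebra_intros a_in X_in) auto
      ultimately show ?thesis
        using 3 j by (intro bexI[of _ "2 * a 1 - a 0 * Xa n"]) (simp_all add: mult_ac)
    qed
  qed
  then obtain r' where r': "r' \<in> B" "a 0 * br s (Xa i) = r' * s" by blast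
  have "a 0 * br (s * m) (Xa i) = s * (a 0 * br m (Xa i)) + (a 0 * br s (Xa i)) * m"
    by (simp add: mult_left algebra_simps)
  also have "\<dots> = (r + r') * (s * m)"
    unfolding r r' by (simp add: algebra_simps)
  finally show ?case using r(1) r'(1) gen_subalgebra.add by blast
qed

lemma shift_down:
  assumes u: "u \<in> monoid_gen (a ` {..<i})" and i: "1 \<le> i" "i \<le> n"
    and I: "u * a i ^ Suc k \<in> I"
  shows "a 0 * u * a (i - 1) * a i ^ k \<in> I"
proof -
  let ?v = "a 0 * u * a i ^ k"
  have uB: "u \<in> B" by (rule monomial_in[OF u]) (use i in simp)
  obtain r where r: "r \<in> B" "a 0 * br u (Xa i) = r * u"
    using br_monomial_X[OF u i] by blast
  have "a 0 * br (u * a i ^ Suc k) (Xa i) = r * (u * a i ^ Suc k)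
      + of_nat (Suc k) * (?v * (a (i + 1) - a (i - 1)))"
  proof -
    have "a 0 * br (u * a i ^ Suc k) (Xa i) =
        (a 0 * br u (Xa i)) * a i ^ Suc k + a 0 * u * br (a i ^ Suc k) (Xa i)"
      by (simp only: mult_left distrib_left mult_ac add.commute)
    also have "br (a i ^ Suc k) (Xa i) = of_nat (Suc k) * a i ^ k * (a (i + 1) - a (i - 1))"
      by (simp only: power_left br_a_X_self[OF i] diff_Suc_1)
    finally show ?thesis unfolding r by (simp only: mult_ac)
  qed
  moreover have "a 0 * br (u * a i ^ Suc k) (Xa i) \<in> I"
    by (intro I_mult I_br I a_in X_in) (use i in auto)
  moreover have "r * (u * a i ^ Suc k) \<in> I"
    by (rule I_mult[OF I r(1)])
  ultimately have "of_nat (Suc k) * (?v * (a (i + 1) - a (i - 1))) \<in> I"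
    using I_diff[of "a 0 * br (u * a i ^ Suc k) (Xa i)" "r * (u * a i ^ Suc k)"] by simp
  then have 1: "?v * (a (i + 1) - a (i - 1)) \<in> I" by (rule I_cancel_nat)
  have "a 0 * Xa i * (u * a i ^ Suc k) \<in> I"
    by (intro I_mult I gen_subalgebra.mult a_in X_in) (use i in auto)
  moreover have "a 0 * Xa i * (u * a i ^ Suc k) = ?v * (Xa i * a i)" by (simp add: mult_ac)
  ultimately have 2: "?v * (a (i - 1) + a (i + 1)) \<in> I"
    unfolding X_mult[OF i] by (simp only:)
  have "of_nat (Suc 1) * (a 0 * u * a (i - 1) * a i ^ k) \<in> I"
    using I_diff[OF 2 1] by (simp add: algebra_simps)
  then show ?thesis by (rule I_cancel_nat)
qed

lemma eliminate_variable:
  assumes "u \<in> monoid_gen (a ` {..<i})" "1 \<le> i" "i \<le> n" "u * a i ^ k \<in> I"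
  shows "\<exists>u'\<in>monoid_gen (a ` {..<i}). u' \<in> I"
  using assms
proof (induction k arbitrary: u)
  case (Suc k)
  have "a 0 * u * a (i - 1) \<in> monoid_gen (a ` {..<i})"
    using Suc.prems by (intro monoid_gen_mult) (auto intro: monoid_gen_gen)
  then show ?case
    using Suc.IH[of "a 0 * u * a (i - 1)"] shift_down[OF Suc.prems] Suc.prems by blast
qed auto

lemma eliminate_variables:
  assumes "u \<in> monoid_gen (a ` {..<Suc i})" "i \<le> n" "u \<in> I"
  shows "\<exists>N. a 0 ^ N \<in> I"
  using assms
proof (induction i arbitrary: u)
  case 0
  have "{..<Suc 0} = {0::nat}" by auto
  then have "u \<in> monoid_gen (insert (a 0) {})" using 0 by simp
  then obtain v k where v: "v \<in> monoid_gen {}" "u = v * a 0 ^ k" by (rule monoid_gen_insert)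
  then have "v = 1" by (auto elim: monoid_gen.cases)
  then show ?case using v 0 by auto
next
  case (Suc i)
  have "{..<Suc (Suc i)} = insert (Suc i) {..<Suc i}" by auto
  then have "u \<in> monoid_gen (insert (a (Suc i)) (a ` {..<Suc i}))" using Suc.prems by simp
  then obtain v k where "v \<in> monoid_gen (a ` {..<Suc i})" "u = v * a (Suc i) ^ k"
    by (rule monoid_gen_insert)
  then obtain u' where "u' \<in> monoid_gen (a ` {..<Suc i})" "u' \<in> I"
    using eliminate_variable[of v "Suc i" k] Suc.prems by auto
  then show ?case using Suc.IH Suc.prems by auto
qed

lemma mixed_powers:
  assumes "a 0 ^ N \<in> I" "j \<le> N"
  shows "a 0 ^ (N - j) * a 1 ^ j \<in> I"
  using assms(2)
proof (induction j)
  case (Suc j)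
  define k where "k = N - Suc j"
  have k: "N - j = Suc k" using Suc.prems by (simp add: k_def)
  have I: "a 0 ^ Suc k * a 1 ^ j \<in> I" using Suc k by simp
  have j: "br (a 1 ^ j) (Xa n) = of_nat j * (a 1 ^ j * Xa n)"
  proof (cases j)
    case (Suc i)
    have "br (a 1) (Xa n) = a 1 * Xa n" using n by (intro br_a_X_even) auto
    then show ?thesis unfolding power_left using Suc by (simp add: mult_ac)
  qed simp
  have k': "br (a 0 ^ Suc k) (Xa n) = of_nat (Suc k) * a 0 ^ k * (2 * a 1 - a 0 * Xa n)"
    by (simp only: power_left br_0_X_n diff_Suc_1)
  let ?m = "a 0 ^ Suc k * a 1 ^ j"
  have "br ?m (Xa n) = (of_nat j - of_nat (Suc k)) * Xa n * ?m
      + of_nat (Suc k) * (of_nat (Suc 1) * (a 0 ^ k * a 1 ^ Suc j))"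
    unfolding mult_left j k' by (simp add: algebra_simps)
  moreover have "br ?m (Xa n) \<in> I"
    by (intro I_br I X_in) (use n in auto)
  moreover have "(of_nat j - of_nat (Suc k)) * Xa n * ?m \<in> I"
  proof (rule I_mult[OF I])
    have nat: "of_nat l \<in> B" for l using gen_subalgebra_of_int[of "int l"] by simp
    then show "(of_nat j - of_nat (Suc k)) * Xa n \<in> B"
      using n by (intro gen_subalgebra.mult gen_subalgebra_diff X_in nat) auto
  qed
  ultimately have "of_nat (Suc k) * (of_nat (Suc 1) * (a 0 ^ k * a 1 ^ Suc j)) \<in> I"
    using I_diff[of "br ?m (Xa n)" "(of_nat j - of_nat (Suc k)) * Xa n * ?m"] by simp
  then have "a 0 ^ k * a 1 ^ Suc j \<in> I" using I_cancel_nat by blast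
  then show ?case by (simp add: k_def)
qed (use assms in simp)

theorem one_in_I_if_monomial:
  assumes "u \<in> monoid_gen (a ` {..n})" "u \<in> I"
  shows "1 \<in> I"
proof -
  obtain N where N: "a 0 ^ N \<in> I"
    using eliminate_variables[of u n] assms by (auto simp: lessThan_Suc_atMost)
  have "1 = (a 0 * a (n + 1) + - (a 1 * a n)) ^ N"
    using det_one by simp
  also have "\<dots> = (\<Sum>k\<le>N. of_nat (N choose k) * (a 0 * a (n + 1)) ^ k * (- (a 1 * a n)) ^ (N - k))"
    by (rule binomial_ring)
  also have "\<dots> \<in> I"
  proof -
    have "of_nat (N choose k) * (a 0 * a (n + 1)) ^ k * (- (a 1 * a n)) ^ (N - k) \<in> I" if "k \<le> N" for k
    proof -
      have "of_nat (N choose k) * a (n + 1) ^ k * (- a n) ^ (N - k) \<in> B"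
        using gen_subalgebra_of_int[of "int (N choose k)" "frieze_gens n a"]
        by (intro gen_subalgebra.mult gen_subalgebra_power gen_subalgebra_uminus a_in) auto
      moreover have "a 0 ^ k * a 1 ^ (N - k) \<in> I"
        using mixed_powers[OF N, of "N - k"] that by simp
      ultimately have "of_nat (N choose k) * a (n + 1) ^ k * (- a n) ^ (N - k) * (a 0 ^ k * a 1 ^ (N - k)) \<in> I"
        by (rule I_mult[rotated])
      moreover have "(- (a 1 * a n)) ^ (N - k) = a 1 ^ (N - k) * (- a n) ^ (N - k)"
        by (simp add: power_mult_distrib [symmetric])
      ultimately show ?thesis by (simp add: power_mult_distrib mult_ac)
    qed
    moreover have "sum h A \<in> I" if "\<And>k. k \<in> A \<Longrightarrow> h k \<in> I" for h :: "nat \<Rightarrow> 'k ratfun" and A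
      using that by (induction A rule: infinite_finite_induct) (auto simp: I_zero intro!: I_add)
    ultimately show ?thesis by (metis (no_types, lifting) atMost_iff)
  qed
  finally show ?thesis .
qed

end

section \<open>Poisson ideals contain monomials\<close>

definition poly_rat :: "'k::field mpoly \<Rightarrow> 'k ratfun" where
  "poly_rat p = Fract p 1"

definition polys_upto :: "nat \<Rightarrow> 'k::field mpoly set" where
  "polys_upto n = {p. \<forall>m\<in>Poly_Mapping.keys p. Poly_Mapping.keys m \<subseteq> {..n}}"

lemma poly_rat_add: "poly_rat (p + q) = poly_rat p + poly_rat q"
  by (simp add: poly_rat_def)

lemma poly_rat_mult: "poly_rat (p * q) = poly_rat p * poly_rat q"
  by (simp add: poly_rat_def)

lemma poly_rat_sum: "poly_rat (sum f A) = (\<Sum>a\<in>A. poly_rat (f a))"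
  by (induction A rule: infinite_finite_induct) (simp_all add: poly_rat_add, simp_all add: poly_rat_def Zero_fract_def)

definition mono_rat :: "(nat \<Rightarrow>\<^sub>0 nat) \<Rightarrow> 'k::field ratfun" where
  "mono_rat m = poly_rat (Poly_Mapping.single m 1)"

lemma mono_rat_0 [simp]: "mono_rat 0 = 1"
  by (simp add: mono_rat_def poly_rat_def One_fract_def)

lemma mono_rat_add: "mono_rat (m + m') = mono_rat m * mono_rat m'"
  by (simp add: mono_rat_def poly_rat_mult [symmetric] mult_single)

lemma mono_rat_single: "mono_rat (Poly_Mapping.single i k) = rvar i ^ k"
proof (induction k)
  case (Suc k)
  have "Poly_Mapping.single i (Suc k) = Poly_Mapping.single i 1 + Poly_Mapping.single i k"
    by (simp add: single_add [symmetric])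
  then show ?case using Suc by (simp add: mono_rat_add) (simp add: mono_rat_def poly_rat_def rvar_def)
qed simp

lemma poly_rat_single: "poly_rat (Poly_Mapping.single m c) = rconst c * mono_rat m"
  by (simp add: mono_rat_def rconst_def poly_rat_def mult_single)

lemma poly_rat_expand: "poly_rat p = (\<Sum>m\<in>Poly_Mapping.keys p. rconst (Poly_Mapping.lookup p m) * mono_rat m)"
  by (subst mpoly_sum_monomials[of p]) (simp add: poly_rat_sum poly_rat_single)

lemma mono_rat_induct:
  assumes "Poly_Mapping.keys m \<subseteq> {..n}" "P 0" "\<And>a b. P a \<Longrightarrow> P b \<Longrightarrow> P (a + b)"
    "\<And>i k. i \<le> n \<Longrightarrow> P (Poly_Mapping.single i k)"
  shows "P (m :: nat \<Rightarrow>\<^sub>0 nat)"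
proof -
  have "P (\<Sum>i\<in>A. Poly_Mapping.single i (Poly_Mapping.lookup m i))" if "A \<subseteq> {..n}" for A
    using finite_subset[OF that finite_atMost] that
    by (induction A rule: finite_induct) (auto intro: assms)
  from this[OF assms(1)] show ?thesis
    by (simp add: mpoly_sum_monomials [symmetric])
qed

lemma mono_rat_in:
  assumes "Poly_Mapping.keys m \<subseteq> {..n}"
  shows "mono_rat m \<in> monoid_gen (rvar ` {..n})"
  by (rule mono_rat_induct[OF assms])
     (auto simp: mono_rat_add mono_rat_single intro: monoid_gen.one monoid_gen_mult monoid_gen_power
        monoid_gen_gen)

definition weight :: "nat \<Rightarrow> nat \<Rightarrow> (nat \<Rightarrow>\<^sub>0 nat) \<Rightarrow> int" where
  "weight n j m = (\<Sum>i\<le>n. w_coeff j i * int (Poly_Mapping.lookup m i))"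

lemma weight_add: "weight n j (a + b) = weight n j a + weight n j b"
  by (simp add: weight_def lookup_add algebra_simps sum.distrib)

lemma weight_single: "i \<le> n \<Longrightarrow> weight n j (Poly_Mapping.single i k) = w_coeff j i * int k"
  by (simp add: weight_def lookup_single when_def if_distrib[of int] if_distrib[of "(*) _"] sum.delta cong: if_cong)

lemma w_bracket_mono:
  assumes "Poly_Mapping.keys m \<subseteq> {..n}" "j \<le> n"
  shows "w_bracket n (rvar j) (mono_rat m) = of_int (weight n j m) * (rvar j * mono_rat m)"
proof (rule mono_rat_induct[OF assms(1)])
  fix i k assume i: "i \<le> n"
  have "w_bracket n (rvar j) (rvar i ^ k) = of_int (w_coeff j i * int k) * (rvar j * rvar i ^ k)" for k
  proof (induction k)
    case (Suc k)
    then show ?case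
      using i assms(2) by (simp add: w.mult_right w_bracket_rvar algebra_simps)
  qed simp
  then show "w_bracket n (rvar j) (mono_rat (Poly_Mapping.single i k)) =
      of_int (weight n j (Poly_Mapping.single i k)) * (rvar j * mono_rat (Poly_Mapping.single i k))"
    using i by (simp add: mono_rat_single weight_single)
qed (simp_all add: weight_def[of _ _ 0] mono_rat_add weight_add w.mult_right algebra_simps)

lemma w_bracket_monoid:
  assumes "u \<in> monoid_gen (rvar ` {..n})" "j \<le> n"
  shows "\<exists>z::int. w_bracket n (rvar j) u = of_int z * (rvar j * u)"
  using assms(1)
proof induction
  case one
  show ?case by (intro exI[of _ 0]) simp
next
  case (mult s m)
  then obtain i z where i: "s = rvar i" "i \<le> n" "w_bracket n (rvar j) m = of_int z * (rvar j * m)" by auto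
  then have "w_bracket n (rvar j) (s * m) = of_int (w_coeff j i + z) * (rvar j * (s * m))"
    using assms(2) by (simp add: w.mult_right w_bracket_rvar algebra_simps)
  then show ?case ..
qed

lemma weights_separate:
  assumes n: "odd n" "n \<ge> 3" and keys: "Poly_Mapping.keys m \<subseteq> {..n}" "Poly_Mapping.keys m' \<subseteq> {..n}"
    and eq: "\<And>j. j \<le> n \<Longrightarrow> weight n j m = weight n j m'"
  shows "m = m'"
proof (rule poly_mapping_eqI)
  define d where "d i = int (Poly_Mapping.lookup m i) - int (Poly_Mapping.lookup m' i)" for i
  have w: "(\<Sum>i\<le>n. w_coeff j i * d i) = 0" if "j \<le> n" for j
    using eq[OF that] by (simp add: weight_def d_def algebra_simps sum_subtractf)
  have mid: "d i = 0" if "1 \<le> i" "i < n" for i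
  proof -
    define j where "j = i - 1"
    then have j: "i = Suc j" using that by simp
    have "0 = (\<Sum>l\<le>n. w_coeff j l * d l) - (\<Sum>l\<le>n. w_coeff (j + 2) l * d l)"
      using w[of j] w[of "j + 2"] that j by simp
    also have "\<dots> = (\<Sum>l\<le>n. if l = i then 2 * d i else 0)"
      unfolding sum_subtractf [symmetric]
    proof (intro sum.cong refl)
      fix l
      show "w_coeff j l * d l - w_coeff (j + 2) l * d l = (if l = i then 2 * d i else 0)"
      proof (cases "l = i")
        case False
        then have "w_coeff j l = w_coeff (j + 2) l" using j by (cases "l = j + 2"; cases "l = j") (auto simp: w_coeff_def)
        with False show ?thesis by simp
      qed (simp add: w_coeff_def j)
    qed
    also have "\<dots> = 2 * d i" using that by (simp add: sum.delta)
    finally show ?thesis by simp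
  qed
  have ends: "(\<Sum>i\<le>n. w_coeff j i * d i) = w_coeff j 0 * d 0 + w_coeff j n * d n" for j
  proof -
    have "(\<Sum>i\<le>n. w_coeff j i * d i) = (\<Sum>i\<in>{0, n}. w_coeff j i * d i)"
      using mid by (intro sum.mono_neutral_right) (auto simp: Suc_le_eq)
    then show ?thesis using n by auto
  qed
  have "d n = 0" "d 0 = 0"
    using w[of 0] w[of n] n unfolding ends by (auto simp: w_coeff_def)
  with mid have d: "d i = 0" if "i \<le> n" for i
    using that by (cases "i = 0 \<or> i = n") auto
  show "Poly_Mapping.lookup m i = Poly_Mapping.lookup m' i" for i
  proof (cases "i \<le> n")
    case True
    then show ?thesis using d[of i] by (simp add: d_def)
  next
    case False
    then have "i \<notin> Poly_Mapping.keys m" "i \<notin> Poly_Mapping.keys m'" using keys by auto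
    then show ?thesis by (simp add: in_keys_iff)
  qed
qed

lemma polys_upto_closed:
  "Poly_Mapping.single 0 c \<in> polys_upto n"
  "i \<le> n \<Longrightarrow> Poly_Mapping.single (Poly_Mapping.single i 1) 1 \<in> polys_upto n"
  "p \<in> polys_upto n \<Longrightarrow> q \<in> polys_upto n \<Longrightarrow> p + q \<in> polys_upto n"
  "p \<in> polys_upto n \<Longrightarrow> q \<in> polys_upto n \<Longrightarrow> p * q \<in> polys_upto n"
proof -
  show "Poly_Mapping.single 0 c \<in> polys_upto n" by (simp add: polys_upto_def)
  show "i \<le> n \<Longrightarrow> Poly_Mapping.single (Poly_Mapping.single i 1) 1 \<in> polys_upto n"
    by (simp add: polys_upto_def)
  show "p \<in> polys_upto n \<Longrightarrow> q \<in> polys_upto n \<Longrightarrow> p + q \<in> polys_upto n"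
    using keys_add[of p q] by (auto simp: polys_upto_def)
  show "p \<in> polys_upto n \<Longrightarrow> q \<in> polys_upto n \<Longrightarrow> p * q \<in> polys_upto n"
  proof -
    assume *: "p \<in> polys_upto n" "q \<in> polys_upto n"
    have "Poly_Mapping.keys m \<subseteq> {..n}" if m: "m \<in> Poly_Mapping.keys (p * q)" for m
    proof -
      obtain a b where "a \<in> Poly_Mapping.keys p" "b \<in> Poly_Mapping.keys q" "m = a + b"
        using keys_mult[of p q] m by auto
      moreover from this have "Poly_Mapping.keys a \<subseteq> {..n}" "Poly_Mapping.keys b \<subseteq> {..n}"
        using * by (simp_all add: polys_upto_def)
      ultimately show ?thesis using keys_add[of a b] by blast
    qed
    then show "p * q \<in> polys_upto n" by (auto simp: polys_upto_def)
  qed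
qed

lemma rvar_poly_rat: "rvar i = poly_rat (Poly_Mapping.single (Poly_Mapping.single i 1) 1)"
  by (simp add: rvar_def poly_rat_def)

lemma rconst_poly_rat: "rconst c = poly_rat (Poly_Mapping.single 0 c)"
  by (simp add: rconst_def poly_rat_def)

lemma poly_rat_0: "poly_rat 0 = 0"
  by (simp add: poly_rat_def Zero_fract_def)

lemma gen_subalgebra_rvar_polys:
  assumes "f \<in> gen_subalgebra (rvar ` {..n})"
  shows "\<exists>p\<in>polys_upto n. f = poly_rat p"
  using assms
proof induction
  case (const c)
  then show ?case using rconst_poly_rat polys_upto_closed(1) by blast
next
  case (gen f)
  then show ?case using rvar_poly_rat polys_upto_closed(2) by blast
next
  case (add f g)
  then show ?case using poly_rat_add polys_upto_closed(3) by metis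
next
  case (mult f g)
  then show ?case using poly_rat_mult polys_upto_closed(4) by metis
qed

lemma monoid_gen_rvar_subset: "monoid_gen (rvar ` {..n}) \<subseteq> gen_subalgebra (rvar ` {..n})"
proof
  fix u assume "u \<in> monoid_gen (rvar ` {..n} :: 'a ratfun set)"
  then show "u \<in> gen_subalgebra (rvar ` {..n})"
    by induction (auto intro: gen_subalgebra.mult gen_subalgebra.gen)
qed

lemma clear_denominators:
  fixes f :: "'k::field ratfun"
  assumes n: "n \<ge> 1" and f: "f \<in> gen_subalgebra (frieze_gens n (w_seq n))"
  shows "\<exists>u\<in>monoid_gen (rvar ` {..n}). u * f \<in> gen_subalgebra (rvar ` {..n})"
  using f
proof induction
  case (const c)
  show ?case by (intro bexI[of _ 1]) (auto intro: monoid_gen.one gen_subalgebra.const)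
next
  case (gen f)
  let ?R = "gen_subalgebra (rvar ` {..n})"
  have v: "rvar i \<in> ?R" if "i \<le> n" for i using that by (auto intro: gen_subalgebra.gen)
  have m: "rvar i \<in> monoid_gen (rvar ` {..n})" if "i \<le> n" for i
    using that by (intro monoid_gen_gen) auto
  from gen consider "f = rvar 0 \<or> f = rvar 1" | i where "1 \<le> i" "i < n" "f = X_of (w_seq n) i" | "f = X_of (w_seq n) n"
    using n by (fastforce simp: frieze_gens_def w_seq_def)
  then show ?case
  proof cases
    case 1
    then show ?thesis using v[of 0] v[of 1] n by (intro bexI[of _ 1]) (auto intro: monoid_gen.one)
  next
    case 2
    then have "rvar i * f = rvar (i - 1) + rvar (i + 1)"
      by (auto simp: X_of_def w_seq_def)
    moreover have "i - 1 \<le> n" using 2 by simp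
    ultimately show ?thesis using v[of "i - 1"] v[of "i + 1"] m[of i] 2
      by (intro bexI[of _ "rvar i"]) (auto intro: gen_subalgebra.add)
  next
    case 3
    have "rvar 0 * rvar n * f = rvar 0 * (w_seq n (n - 1) + w_seq n (n + 1))"
      unfolding 3 X_of_def w_seq_def[of n n] by simp
    also have "\<dots> = rvar 0 * rvar (n - 1) + (1 + rvar 1 * rvar n)"
    proof -
      have "rvar 0 * w_seq n (n + 1) = 1 + rvar 1 * (rvar n :: 'k ratfun)"
        "w_seq n (n - 1) = (rvar (n - 1) :: 'k ratfun)"
        by (simp_all add: w_seq_def)
      then show ?thesis by (simp only: distrib_left)
    qed
    also have "\<dots> \<in> ?R" using v n by (intro gen_subalgebra.add gen_subalgebra.mult gen_subalgebra_1) auto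
    finally show ?thesis using m by (intro bexI[of _ "rvar 0 * rvar n"] monoid_gen_mult) auto
  qed
next
  case (add f g)
  then obtain u v where uv: "u \<in> monoid_gen (rvar ` {..n})" "u * f \<in> gen_subalgebra (rvar ` {..n})"
    "v \<in> monoid_gen (rvar ` {..n})" "v * g \<in> gen_subalgebra (rvar ` {..n})" by blast
  have "v * (u * f) + u * (v * g) \<in> gen_subalgebra (rvar ` {..n})"
    by (rule gen_subalgebra.add; rule gen_subalgebra.mult; use uv monoid_gen_rvar_subset in blast)
  then have "(u * v) * (f + g) \<in> gen_subalgebra (rvar ` {..n})"
    by (simp add: algebra_simps)
  then show ?case using uv monoid_gen_mult by blast
next
  case (mult f g)
  then obtain u v where uv: "u \<in> monoid_gen (rvar ` {..n})" "u * f \<in> gen_subalgebra (rvar ` {..n})"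
    "v \<in> monoid_gen (rvar ` {..n})" "v * g \<in> gen_subalgebra (rvar ` {..n})" by blast
  have "(u * f) * (v * g) \<in> gen_subalgebra (rvar ` {..n})"
    using uv by (rule_tac gen_subalgebra.mult)
  then have "(u * v) * (f * g) \<in> gen_subalgebra (rvar ` {..n})"
    by (simp add: mult_ac)
  then show ?case using uv monoid_gen_mult by blast
qed

locale w_poisson_ideal = frieze_poisson_ideal "w_bracket n" n "w_seq n" I
  for n and I :: "'k::field_char_0 ratfun set"
begin

lemma rvar_in: "j \<le> n \<Longrightarrow> rvar j \<in> B"
  using a_in[of j] by (simp add: w_seq_def)

lemma monoid_gen_in: "u \<in> monoid_gen (rvar ` {..n}) \<Longrightarrow> u \<in> B"
  by (induction rule: monoid_gen.induct) (auto intro!: gen_subalgebra.mult rvar_in)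

text \<open>Bracketing with a variable scales the monomials by their weights, so that a suitable combination
  removes one monomial and keeps another one.\<close>

lemma reduce_support:
  assumes "u \<in> monoid_gen (rvar ` {..n})" "u * poly_rat p \<in> I" "p \<in> polys_upto n" "p \<noteq> 0"
  shows "\<exists>v\<in>monoid_gen (rvar ` {..n}). v \<in> I"
  using assms
proof (induction "card (Poly_Mapping.keys p)" arbitrary: u p rule: less_induct)
  case less
  obtain m1 where m1: "m1 \<in> Poly_Mapping.keys p" using less.prems(4) by fastforce
  have keys: "Poly_Mapping.keys m \<subseteq> {..n}" if "m \<in> Poly_Mapping.keys p" for m
    using less.prems(3) that by (auto simp: polys_upto_def)
  show ?case
  proof (cases "Poly_Mapping.keys p = {m1}")
    case True
    let ?c = "Poly_Mapping.lookup p m1"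
    have "?c \<noteq> 0" using m1 by (simp add: in_keys_iff)
    have "poly_rat p = rconst ?c * mono_rat m1"
      by (subst poly_rat_expand) (simp add: True)
    then have "rconst (inverse ?c) * (u * (rconst ?c * mono_rat m1)) \<in> I"
      using less.prems(2) by (intro I_mult[OF _ gen_subalgebra.const]) simp
    moreover have "rconst (inverse ?c) * (u * (rconst ?c * mono_rat m1)) =
        rconst (inverse ?c * ?c) * (u * mono_rat m1)"
      by (simp add: rconst_mult mult_ac)
    ultimately have "u * mono_rat m1 \<in> I"
      using \<open>?c \<noteq> 0\<close> by simp
    then show ?thesis
      using mono_rat_in[OF keys[OF m1]] less.prems(1) monoid_gen_mult by blast
  next
    case False
    then obtain m2 where m2: "m2 \<in> Poly_Mapping.keys p" "m2 \<noteq> m1" using m1 by blast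
    obtain j where j: "j \<le> n" "weight n j m1 \<noteq> weight n j m2"
      using weights_separate[of n m1 m2] n keys m1 m2 by metis
    define wt where "wt m = weight n j m - weight n j m1" for m
    define p' where "p' = (\<Sum>m\<in>Poly_Mapping.keys p.
      Poly_Mapping.single m (of_int (wt m) * Poly_Mapping.lookup p m))"
    have lookup': "Poly_Mapping.lookup p' m = of_int (wt m) * Poly_Mapping.lookup p m" for m
      by (simp add: p'_def lookup_sum lookup_single when_def in_keys_iff sum.delta')
    have sub: "Poly_Mapping.keys p' \<subseteq> Poly_Mapping.keys p"
      by (auto simp: in_keys_iff lookup')
    moreover have "m1 \<notin> Poly_Mapping.keys p'" by (simp add: in_keys_iff lookup' wt_def)
    ultimately have "card (Poly_Mapping.keys p') < card (Poly_Mapping.keys p)"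
      using m1 by (intro psubset_card_mono) auto
    moreover have "p' \<in> polys_upto n" using sub less.prems(3) by (auto simp: polys_upto_def)
    moreover have "p' \<noteq> 0"
    proof
      assume "p' = 0"
      then have "of_int (wt m2) * Poly_Mapping.lookup p m2 = 0" using lookup'[of m2] by simp
      then show False using j m2 by (simp add: wt_def in_keys_iff)
    qed
    moreover have "rvar j * u \<in> monoid_gen (rvar ` {..n})"
      using j less.prems(1) by (intro monoid_gen.mult) auto
    moreover have "(rvar j * u) * poly_rat p' \<in> I"
    proof -
      obtain z :: int where z: "w_bracket n (rvar j) u = of_int z * (rvar j * u)"
        using w_bracket_monoid[OF less.prems(1) j(1)] by blast
      have c: "w_bracket n f (rconst c * g) = rconst c * w_bracket n f g" for f c g
        by (simp add: w.mult_right)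
      have "w_bracket n (rvar j) (poly_rat p) =
          (\<Sum>m\<in>Poly_Mapping.keys p. rconst (Poly_Mapping.lookup p m) * (of_int (weight n j m) * (rvar j * mono_rat m)))"
      proof -
        have s: "w_bracket n f (sum g A) = (\<Sum>a\<in>A. w_bracket n f (g a))" for f g and A :: "(nat \<Rightarrow>\<^sub>0 nat) set"
          by (induction A rule: infinite_finite_induct) (simp_all add: w.add_right)
        show ?thesis
          unfolding poly_rat_expand[of p] s c
          by (intro sum.cong refl) (simp add: w_bracket_mono[OF keys j(1)])
      qed
      also have "\<dots> = (\<Sum>m\<in>Poly_Mapping.keys p. rvar j * (of_int (wt m) * rconst (Poly_Mapping.lookup p m) * mono_rat m)
          + of_int (weight n j m1) * rvar j * (rconst (Poly_Mapping.lookup p m) * mono_rat m))"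
        by (intro sum.cong refl) (simp add: wt_def algebra_simps)
      also have "\<dots> = rvar j * poly_rat p' + of_int (weight n j m1) * rvar j * poly_rat p"
      proof -
        have "poly_rat p' = (\<Sum>m\<in>Poly_Mapping.keys p. of_int (wt m) * rconst (Poly_Mapping.lookup p m) * mono_rat m)"
          by (simp add: p'_def poly_rat_sum poly_rat_single rconst_mult rconst_of_int)
        then show ?thesis
          unfolding poly_rat_expand[of p] sum.distrib by (simp add: sum_distrib_left)
      qed
      finally have "w_bracket n (rvar j) (u * poly_rat p) = (rvar j * u) * poly_rat p'
          + (of_int (weight n j m1) + of_int z) * rvar j * (u * poly_rat p)"
        by (simp add: w.mult_right z algebra_simps)
      moreover have "w_bracket n (rvar j) (u * poly_rat p) \<in> I"
      proof -
        have "- 1 * w_bracket n (u * poly_rat p) (rvar j) \<in> I"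
          by (intro I_mult I_br less.prems rvar_in j gen_subalgebra_uminus gen_subalgebra_1)
        then show ?thesis using w.skew[of n "rvar j" "u * poly_rat p"] by simp
      qed
      moreover have "(of_int (weight n j m1) + of_int z) * rvar j * (u * poly_rat p) \<in> I"
        by (intro I_mult less.prems gen_subalgebra.mult gen_subalgebra.add gen_subalgebra_of_int rvar_in j)
      ultimately show ?thesis
        using I_diff by (metis add_diff_cancel_right')
    qed
    ultimately show ?thesis using less.hyps by blast
  qed
qed

theorem one_in_I:
  assumes f: "f \<in> I" "f \<noteq> 0" "f \<in> B"
  shows "1 \<in> I"
proof -
  have n1: "n \<ge> 1" using n by simp
  obtain u where u: "u \<in> monoid_gen (rvar ` {..n})" "u * f \<in> gen_subalgebra (rvar ` {..n})"
    using clear_denominators[OF n1 f(3)] by blast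
  then obtain p where p: "p \<in> polys_upto n" "u * f = poly_rat p"
    using gen_subalgebra_rvar_polys by blast
  have "u \<noteq> 0" using u(1) by induction auto
  then have "p \<noteq> 0" using p(2) f(2) by (auto simp: poly_rat_0)
  have "1 * poly_rat p \<in> I"
    using I_mult[OF f(1) monoid_gen_in[OF u(1)]] p(2) by simp
  then obtain v where "v \<in> monoid_gen (rvar ` {..n})" "v \<in> I"
    using reduce_support[OF monoid_gen.one _ p(1) \<open>p \<noteq> 0\<close>] by blast
  moreover have "rvar ` {..n} = (w_seq n ` {..n} :: 'k ratfun set)"
    by (intro image_cong refl) (simp add: w_seq_def)
  ultimately show ?thesis
    using one_in_I_if_monomial by simp
qed

end

section \<open>Transfer to the quotient\<close>

lemma poisson_algebra_transfer:
  assumes P: "poisson_algebra K P" and bij: "bij_betw h (carrier P) (carrier Q)"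
    and one: "\<one>\<^bsub>Q\<^esub> = h \<one>\<^bsub>P\<^esub>" and zero: "\<zero>\<^bsub>Q\<^esub> = h \<zero>\<^bsub>P\<^esub>"
    and add: "\<And>x y. x \<in> carrier P \<Longrightarrow> y \<in> carrier P \<Longrightarrow> h x \<oplus>\<^bsub>Q\<^esub> h y = h (x \<oplus>\<^bsub>P\<^esub> y)"
    and mult: "\<And>x y. x \<in> carrier P \<Longrightarrow> y \<in> carrier P \<Longrightarrow> h x \<otimes>\<^bsub>Q\<^esub> h y = h (x \<otimes>\<^bsub>P\<^esub> y)"
    and smult: "\<And>c x. c \<in> carrier K \<Longrightarrow> x \<in> carrier P \<Longrightarrow> c \<odot>\<^bsub>Q\<^esub> h x = h (c \<odot>\<^bsub>P\<^esub> x)"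
    and br: "\<And>x y. x \<in> carrier P \<Longrightarrow> y \<in> carrier P \<Longrightarrow> bracket Q (h x) (h y) = h (bracket P x y)"
  shows "poisson_algebra K Q"
proof -
  interpret P: poisson_algebra K P by fact
  have img: "carrier Q = h ` carrier P" using bij by (simp add: bij_betw_def)
  note hom = one zero add mult smult br P.bracket_closed
  have ag: "abelian_group Q"
  proof (rule abelian_groupI)
    fix x assume "x \<in> carrier Q"
    then obtain x' where "x = h x'" "x' \<in> carrier P" using img by auto
    then show "\<exists>y\<in>carrier Q. y \<oplus>\<^bsub>Q\<^esub> x = \<zero>\<^bsub>Q\<^esub>"
      by (intro bexI[of _ "h (\<ominus>\<^bsub>P\<^esub> x')"]) (auto simp: img hom P.l_neg)
  qed (auto simp: img hom P.a_ac)
  have "Group.comm_monoid Q"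
    by (rule comm_monoidI) (auto simp: img hom P.m_ac)
  then have "cring Q"
    by (rule cringI[OF ag]) (auto simp: img hom P.l_distr)
  moreover have "module K Q"
    by (rule moduleI[OF P.R.cring_axioms ag])
       (auto simp: img hom P.smult_l_distr P.smult_r_distr P.smult_assoc1)
  ultimately have "algebra K Q"
    by (intro algebra.intro algebra_axioms.intro) (auto simp: img hom P.smult_assoc2)
  then show ?thesis
    by (intro poisson_algebra.intro poisson_algebra_axioms.intro)
       (auto simp: img hom P.bracket_add_left P.bracket_add_right P.bracket_smult_left
         P.bracket_smult_right P.bracket_self P.bracket_jacobi P.bracket_leibniz)
qed

context
  fixes n :: nat
  assumes n: "n \<ge> 3" "odd n"
begin

lemma alg_J_eq:
  "(alg_J n :: ('k::field, _) poisson) = ratfun_poisson (gen_subalgebra (frieze_gens n rvar)) (W_bracket n)"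
proof -
  have "elt_X = (X_of rvar :: _ \<Rightarrow> 'k ratfun)" by (simp add: fun_eq_iff elt_X_def X_of_def)
  then show ?thesis by (simp add: alg_J_def frieze_gens_def)
qed

lemma alg_J_simps:
  "carrier (alg_J n) = gen_subalgebra (frieze_gens n (rvar :: _ \<Rightarrow> 'k::field ratfun))"
  "f \<otimes>\<^bsub>alg_J n\<^esub> g = f * (g :: 'k ratfun)" "f \<oplus>\<^bsub>alg_J n\<^esub> g = f + g" "\<one>\<^bsub>alg_J n\<^esub> = (1 :: 'k ratfun)"
  "c \<odot>\<^bsub>alg_J n\<^esub> f = rconst c * f" "bracket (alg_J n) f g = W_bracket n f g"
  by (simp_all add: alg_J_eq ratfun_poisson_def)

lemma alg_A_eq: "(alg_A n :: ('k::field_char_0, _) poisson) =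
    ratfun_poisson (gen_subalgebra (frieze_gens n (w_seq n))) (w_bracket n)"
  using cluster_algebra_P1[OF n(1), where 'k = 'k] by (simp add: alg_A_def)

definition fibre :: "'k::field_char_0 ratfun \<Rightarrow> 'k ratfun set" where
  "fibre x = {f \<in> gen_subalgebra (frieze_gens n rvar). phi n f = x}"

lemma cgenideal_Delta:
  "PIdl\<^bsub>alg_J n\<^esub> (elt_Delta n) = (fibre 0 :: 'k::field_char_0 ratfun set)"
proof -
  let ?J = "gen_subalgebra (frieze_gens n (rvar :: nat \<Rightarrow> 'k ratfun))"
  have "f \<in> fibre 0 \<longleftrightarrow> (\<exists>g\<in>?J. f = g * elt_Delta n)" for f :: "'k ratfun"
  proof
    assume "f \<in> fibre 0"
    then show "\<exists>g\<in>?J. f = g * elt_Delta n"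
      using kernel_phi[OF n(1), of f] by (auto simp: fibre_def mult.commute)
  next
    assume "\<exists>g\<in>?J. f = g * elt_Delta n"
    then show "f \<in> fibre 0"
      using Delta_in_J[OF n(1), where 'a = 'k] phi_Delta[OF n(1), where 'k = 'k]
      by (auto simp: fibre_def phi_simps intro: gen_subalgebra.mult)
  qed
  then show ?thesis
    by (auto simp: cgenideal_def alg_J_simps)
qed

lemma coset_fibre:
  assumes "f \<in> gen_subalgebra (frieze_gens n rvar)"
  shows "fibre 0 +>\<^bsub>alg_J n\<^esub> f = fibre (phi n (f :: 'k::field_char_0 ratfun))"
proof -
  have "g \<in> fibre (phi n f) \<Longrightarrow> \<exists>i\<in>fibre 0. g = i + f" for g
    using assms by (intro bexI[of _ "g - f"]) (auto simp: fibre_def phi_simps gen_subalgebra_diff)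
  moreover have "i \<in> fibre 0 \<Longrightarrow> i + f \<in> fibre (phi n f)" for i
    using assms by (auto simp: fibre_def phi_simps gen_subalgebra.add)
  ultimately show ?thesis
    by (auto simp: a_r_coset_def' alg_J_simps)
qed

lemma fibre_nonempty:
  assumes "x \<in> gen_subalgebra (frieze_gens n (w_seq n))"
  obtains f :: "'k::field_char_0 ratfun" where "f \<in> gen_subalgebra (frieze_gens n rvar)" "phi n f = x" "f \<in> fibre x"
  using phi_surj[OF assms] by (auto simp: fibre_def)

lemma fibre_neq_empty: "x \<in> gen_subalgebra (frieze_gens n (w_seq n)) \<Longrightarrow> fibre (x :: 'k::field_char_0 ratfun) \<noteq> {}"
  using fibre_nonempty[of x] by blast

abbreviation (input) quot :: "('k::field_char_0, 'k ratfun set) poisson" where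
  "quot \<equiv> alg_J_mod_Delta n"

lemma quot_carrier: "carrier (quot :: ('k::field_char_0, _) poisson) = fibre ` gen_subalgebra (frieze_gens n (w_seq n))"
proof -
  have "carrier (quot :: ('k, _) poisson) =
      (\<lambda>f. fibre 0 +>\<^bsub>alg_J n\<^esub> f) ` gen_subalgebra (frieze_gens n rvar)"
    by (auto simp: alg_J_mod_Delta_def poisson_quot_def FactRing_def cgenideal_Delta A_RCOSETS_def'
        alg_J_simps)
  also have "\<dots> = (\<lambda>f. fibre (phi n f)) ` gen_subalgebra (frieze_gens n rvar)"
    by (intro image_cong refl coset_fibre)
  also have "\<dots> = fibre ` gen_subalgebra (frieze_gens n (w_seq n))"
    using phi_in phi_surj by (fastforce simp: image_iff)
  finally show ?thesis .
qed

lemma quot_zero: "\<zero>\<^bsub>quot\<^esub> = fibre 0"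
  by (simp add: alg_J_mod_Delta_def poisson_quot_def FactRing_def cgenideal_Delta)

lemma quot_one: "\<one>\<^bsub>quot\<^esub> = fibre 1"
proof -
  have "\<one>\<^bsub>quot\<^esub> = fibre 0 +>\<^bsub>alg_J n\<^esub> 1"
    by (simp add: alg_J_mod_Delta_def poisson_quot_def FactRing_def cgenideal_Delta alg_J_simps)
  then show ?thesis by (simp add: coset_fibre)
qed

lemma quot_add:
  assumes "x \<in> gen_subalgebra (frieze_gens n (w_seq n))" "y \<in> gen_subalgebra (frieze_gens n (w_seq n))"
  shows "fibre x \<oplus>\<^bsub>quot\<^esub> fibre y = fibre (x + (y :: 'k::field_char_0 ratfun))"
proof -
  have "fibre x \<oplus>\<^bsub>quot\<^esub> fibre y = (\<Union>f\<in>fibre x. \<Union>g\<in>fibre y. {f + g})"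
    by (simp add: alg_J_mod_Delta_def poisson_quot_def FactRing_def set_add_def' alg_J_simps)
  also have "\<dots> = fibre (x + y)"
  proof
    show "(\<Union>f\<in>fibre x. \<Union>g\<in>fibre y. {f + g}) \<subseteq> fibre (x + y)"
      by (auto simp: fibre_def phi_simps gen_subalgebra.add)
    obtain f where f: "f \<in> gen_subalgebra (frieze_gens n rvar)" "phi n f = x" "f \<in> fibre x"
      using fibre_nonempty[OF assms(1)] .
    show "fibre (x + y) \<subseteq> (\<Union>f\<in>fibre x. \<Union>g\<in>fibre y. {f + g})"
    proof
      fix h assume "h \<in> fibre (x + y)"
      then have "h - f \<in> fibre y" using f by (auto simp: fibre_def phi_simps gen_subalgebra_diff)
      then have "h \<in> (\<Union>g\<in>fibre y. {f + g})" by (auto intro!: bexI[of _ "h - f"])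
      then show "h \<in> (\<Union>f\<in>fibre x. \<Union>g\<in>fibre y. {f + g})" using f by blast
    qed
  qed
  finally show ?thesis .
qed

lemma quot_mult:
  assumes "x \<in> gen_subalgebra (frieze_gens n (w_seq n))" "y \<in> gen_subalgebra (frieze_gens n (w_seq n))"
  shows "fibre x \<otimes>\<^bsub>quot\<^esub> fibre y = fibre (x * (y :: 'k::field_char_0 ratfun))"
proof -
  have "fibre x \<otimes>\<^bsub>quot\<^esub> fibre y = (\<Union>f\<in>fibre x. \<Union>g\<in>fibre y. fibre 0 +>\<^bsub>alg_J n\<^esub> (f * g))"
    by (simp add: alg_J_mod_Delta_def poisson_quot_def FactRing_def rcoset_mult_def cgenideal_Delta alg_J_simps)
  also have "\<dots> = (\<Union>f\<in>fibre x. \<Union>g\<in>fibre y. fibre (x * y))"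
    by (intro SUP_cong refl) (auto simp: fibre_def[of x] fibre_def[of y] coset_fibre phi_simps gen_subalgebra.mult)
  also have "\<dots> = fibre (x * y)"
    using assms by (simp add: fibre_neq_empty)
  finally show ?thesis .
qed

lemma quot_smult:
  assumes "x \<in> gen_subalgebra (frieze_gens n (w_seq n))"
  shows "c \<odot>\<^bsub>quot\<^esub> fibre x = fibre (rconst c * (x :: 'k::field_char_0 ratfun))"
proof -
  have "c \<odot>\<^bsub>quot\<^esub> fibre x = (\<Union>f\<in>fibre x. fibre 0 +>\<^bsub>alg_J n\<^esub> (rconst c * f))"
    by (simp add: alg_J_mod_Delta_def poisson_quot_def cgenideal_Delta alg_J_simps)
  also have "\<dots> = (\<Union>f\<in>fibre x. fibre (rconst c * x))"
    by (intro SUP_cong refl)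
       (auto simp: fibre_def[of x] coset_fibre phi_simps gen_subalgebra.mult gen_subalgebra.const)
  also have "\<dots> = fibre (rconst c * x)"
    using assms by (simp add: fibre_neq_empty)
  finally show ?thesis .
qed

lemma quot_bracket:
  assumes "x \<in> gen_subalgebra (frieze_gens n (w_seq n))" "y \<in> gen_subalgebra (frieze_gens n (w_seq n))"
  shows "bracket quot (fibre x) (fibre y) = fibre (w_bracket n x (y :: 'k::field_char_0 ratfun))"
proof -
  interpret W: frieze_bracket "W_bracket n" n "rvar :: nat \<Rightarrow> 'k ratfun"
    by (rule frieze_bracket_W[OF n])
  have "bracket quot (fibre x) (fibre y) =
      (\<Union>f\<in>fibre x. \<Union>g\<in>fibre y. fibre 0 +>\<^bsub>alg_J n\<^esub> (W_bracket n f g))"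
    by (simp add: alg_J_mod_Delta_def poisson_quot_def cgenideal_Delta alg_J_simps)
  also have "\<dots> = (\<Union>f\<in>fibre x. \<Union>g\<in>fibre y. fibre (w_bracket n x y))"
    by (intro SUP_cong refl)
       (auto simp: fibre_def[of x] fibre_def[of y] coset_fibre phi_bracket[OF n] W.algebra_closed)
  also have "\<dots> = fibre (w_bracket n x y)"
    using assms by (simp add: fibre_neq_empty)
  finally show ?thesis .
qed

lemma fibre_bij:
  "bij_betw fibre (gen_subalgebra (frieze_gens n (w_seq n))) (carrier (quot :: ('k::field_char_0, _) poisson))"
proof -
  have "x = y" if "x \<in> gen_subalgebra (frieze_gens n (w_seq n))" "fibre x = fibre y" for x y :: "'k ratfun"
    using fibre_nonempty[OF that(1)] that(2) by (metis (mono_tags, lifting) fibre_def mem_Collect_eq)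
  then show ?thesis
    by (auto simp: bij_betw_def quot_carrier inj_on_def)
qed

lemma quot_simple: "poisson_simple (quot :: ('k::field_char_0, _) poisson)"
proof -
  let ?B = "gen_subalgebra (frieze_gens n (w_seq n :: nat \<Rightarrow> 'k ratfun))"
  interpret fw: frieze_bracket "w_bracket n" n "w_seq n :: nat \<Rightarrow> 'k ratfun"
    by (rule frieze_bracket_w[OF n])
  have inj: "inj_on fibre ?B" using fibre_bij by (rule bij_betw_imp_inj_on)
  have ideal: "I = {\<zero>\<^bsub>quot\<^esub>} \<or> I = carrier quot" if I: "poisson_ideal I (quot :: ('k, _) poisson)" for I
  proof -
    interpret I: ideal I "quot :: ('k, _) poisson" using I by (simp add: poisson_ideal_def)
    define I' where "I' = {x \<in> ?B. fibre x \<in> I}"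
    interpret w_poisson_ideal n I'
    proof unfold_locales
      show "w_seq n 0 * w_seq n (n + 1) - w_seq n 1 * w_seq n n = (1 :: 'k ratfun)"
        using n by (simp add: w_seq_def)
      show "0 \<in> I'"
        using additive_subgroup.zero_closed[OF I.is_additive_subgroup] by (simp add: I'_def quot_zero)
      show "x + y \<in> I'" if "x \<in> I'" "y \<in> I'" for x y
        using that additive_subgroup.a_closed[OF I.is_additive_subgroup, of "fibre x" "fibre y"]
        by (auto simp: I'_def quot_add gen_subalgebra.add)
      show "y * x \<in> I'" if "x \<in> I'" "y \<in> ?B" for x y
        using that I.I_l_closed[of "fibre x" "fibre y"]
        by (auto simp: I'_def quot_mult quot_carrier gen_subalgebra.mult)
      show "w_bracket n x y \<in> I'" if "x \<in> I'" "y \<in> ?B" for x y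
      proof -
        have "bracket quot (fibre x) (fibre y) \<in> I"
          using I that by (auto simp: poisson_ideal_def I'_def quot_carrier)
        then show ?thesis using that fw.algebra_closed by (auto simp: I'_def quot_bracket)
      qed
    qed
    show ?thesis
    proof (cases "I' \<subseteq> {0}")
      case True
      have "C = \<zero>\<^bsub>quot\<^esub>" if C: "C \<in> I" for C
      proof -
        obtain x where "C = fibre x" "x \<in> ?B" using I.Icarr[OF C] by (auto simp: quot_carrier)
        then show ?thesis using True C by (auto simp: I'_def quot_zero)
      qed
      moreover have "\<zero>\<^bsub>quot\<^esub> \<in> I" using I_zero by (simp add: I'_def quot_zero)
      ultimately show ?thesis by blast
    next
      case False
      then obtain f where "f \<in> I'" "f \<noteq> 0" by blast
      then have "1 \<in> I'" using one_in_I[of f] by (simp add: I'_def)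
      then have "x \<in> I'" if "x \<in> ?B" for x using I_mult[of 1 x] that by simp
      then have "carrier quot \<subseteq> I" by (auto simp: quot_carrier I'_def)
      then show ?thesis using I.a_subset by blast
    qed
  qed
  have "fibre 1 \<noteq> (fibre 0 :: 'k ratfun set)"
    using inj_onD[OF inj, of 1 0] by auto
  moreover have "fibre 1 \<in> carrier (quot :: ('k, _) poisson)" by (simp add: quot_carrier)
  ultimately have "carrier (quot :: ('k, _) poisson) \<noteq> {\<zero>\<^bsub>quot\<^esub>}" by (auto simp: quot_zero)
  with ideal show ?thesis by (auto simp: poisson_simple_def)
qed

lemma poisson_algebra_A:
  "poisson_algebra (ring_of_type_algebra :: 'k::field_char_0 ring) (alg_A n)"
proof -
  interpret fw: frieze_bracket "w_bracket n" n "w_seq n :: nat \<Rightarrow> 'k ratfun"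
    by (rule frieze_bracket_w[OF n])
  have sub: "gen_subalgebra (frieze_gens n (w_seq n)) \<subseteq> gen_subfield (rvar ` {..n} :: 'k ratfun set)"
    using n by (intro frieze_gens_w_subfield) simp
  show ?thesis
    unfolding alg_A_eq
  proof (rule poisson_algebra_ratfun[OF w.biderivation_axioms fw.algebra_closed])
    fix f g h :: "'k ratfun"
    assume "f \<in> gen_subalgebra (frieze_gens n (w_seq n))" "g \<in> gen_subalgebra (frieze_gens n (w_seq n))"
      "h \<in> gen_subalgebra (frieze_gens n (w_seq n))"
    then show "w_bracket n f (w_bracket n g h) + w_bracket n g (w_bracket n h f) + w_bracket n h (w_bracket n f g) = 0"
      using w_jacobi[of f n g h] sub by (auto simp: w.jacobiator_def)
  qed
qed

end

theorem proposition8p7: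
  fixes n :: nat
  assumes "n \<ge> 3" and "odd n"
  shows "poisson_algebra (ring_of_type_algebra :: 'k::{alg_closed_field, field_char_0} ring) (alg_A n)
    \<and> poisson_algebra (ring_of_type_algebra :: 'k ring) (alg_J_mod_Delta n)
    \<and> poisson_simple (alg_J_mod_Delta n :: ('k, 'k ratfun set) poisson)
    \<and> poisson_isomorphic (ring_of_type_algebra :: 'k ring) (alg_A n) (alg_J_mod_Delta n)"
proof -
  let ?A = "alg_A n :: ('k, 'k ratfun) poisson" and ?h = "fibre n :: 'k ratfun \<Rightarrow> _"
  let ?K = "ring_of_type_algebra :: 'k ring" and ?Q = "alg_J_mod_Delta n :: ('k, 'k ratfun set) poisson"
  note q = quot_zero[OF assms] quot_one[OF assms] quot_add[OF assms] quot_mult[OF assms]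
    quot_smult[OF assms] quot_bracket[OF assms]
  have A: "poisson_algebra ?K ?A" by (rule poisson_algebra_A[OF assms])
  have bij: "bij_betw ?h (carrier ?A) (carrier ?Q)"
    using fibre_bij[OF assms, where 'k = 'k] by (simp add: alg_A_eq[OF assms] ratfun_poisson_def)
  have "poisson_algebra ?K ?Q"
    by (rule poisson_algebra_transfer[OF A bij]) (simp_all add: alg_A_eq[OF assms] ratfun_poisson_def q)
  moreover have "poisson_isomorphic ?K ?A ?Q"
    unfolding poisson_isomorphic_def
    using bij by (intro exI[of _ ?h])
      (auto simp: ring_hom_def alg_A_eq[OF assms] ratfun_poisson_def q bij_betw_def)
  ultimately show ?thesis
    using A quot_simple[OF assms] by blast
qed

end
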